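(* Let $a,b\in\mathbb{C}$, let $P(z)=z^2+az+b$, and let $E_P=\{z\in\mathbb{C}:P(z)\in[-2,2]\}$. Then $$\mathcal{W}_{2n,\infty}(E_P)=2\quad\text{for all } n\ge 1,$$ and $$\lim_{n\to\infty}\mathcal{W}_{2n+1,\infty}(E_P)=\sqrt{2\left|c+\sqrt{c^2-4}\right|},$$ where $c=b-a^2/4$ and the branch of the square root is such that $z+\sqrt{z^2-4}$ maps the exterior of $[-2,2]$ to the exterior of the closed disk of radius $2$ centered at $0$. In particular, if $c\in[-2,2]$, then $$\lim_{n\to\infty}\mathcal{W}_{2n+1,\infty}(E_P)=2.$$
   Context: For a compact set $E\subset\mathbb{C}$ with infinitely many points, $T_n^E$ denotes the $n$th Chebyshev polynomial of $E$, i.e. the unique monic polynomial of degree $n$ minimising the supremum norm $\|P\|_E=\max_{z\in E}|P(z)|$ among all monic polynomials $P$ of degree $n$ with complex coefficients. $\operatorname{Cap}(E)$ denotes the logarithmic capacity of $E$. The Widom factors are $\mathcal{W}_{n,\infty}(E)=\|T_n^E\|_E/\operatorname{Cap}(E)^n$. The map $z\mapsto z+\sqrt{z^2-4}$ is the conformal map of $\mathbb{C}\setminus[-2,2]$ onto $\{w:|w|>2\}$; its modulus extends continuously to $[-2,2]$ (where either value of the square root gives the same modulus $|z+\sqrt{z^2-4}|$). *)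

theory Defs
  imports "HOL-Probability.Probability" "HOL-Computational_Algebra.Polynomial"
begin

definition sup_norm :: "complex set \<Rightarrow> complex poly \<Rightarrow> real" where
  "sup_norm E p = (SUP z\<in>E. cmod (poly p z))"

definition monic_of_degree :: "nat \<Rightarrow> complex poly \<Rightarrow> bool" where
  "monic_of_degree n p \<longleftrightarrow> degree p = n \<and> lead_coeff p = 1"

definition chebyshev_poly :: "complex set \<Rightarrow> nat \<Rightarrow> complex poly" where
  "chebyshev_poly E n =
     (THE p. monic_of_degree n p \<and> (\<forall>q. monic_of_degree n q \<longrightarrow> sup_norm E p \<le> sup_norm E q))"

text \<open>
  The energy is the double integral of the kernel \<open>- ln (dist z w)\<close>, split into its positive and
  negative parts. The kernel is infinite on the diagonal, which has to be said explicitly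
  because \<open>ln 0 = 0\<close> in HOL. Negative reals are truncated to \<open>0\<close> by \<^const>\<open>ennreal\<close>. If the
  measure has bounded support, then the subtrahend is finite.
\<close>

definition log_energy :: "complex measure \<Rightarrow> ereal" where
  "log_energy \<mu> =
     enn2ereal (\<integral>\<^sup>+z. \<integral>\<^sup>+w. (if z = w then \<infinity> else ennreal (- ln (dist z w))) \<partial>\<mu> \<partial>\<mu>)
   - enn2ereal (\<integral>\<^sup>+z. \<integral>\<^sup>+w. (if z = w then 0 else ennreal (ln (dist z w))) \<partial>\<mu> \<partial>\<mu>)"

definition robin_constant :: "complex set \<Rightarrow> ereal" where
  "robin_constant E =
     (INF \<mu>\<in>{\<mu>. prob_space \<mu> \<and> sets \<mu> = sets borel \<and> emeasure \<mu> E = 1}. log_energy \<mu>)"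

text \<open>
  On compact sets the Robin constant is never \<open>-\<infinity>\<close>, so that \<^const>\<open>real_of_ereal\<close> loses nothing.
\<close>

definition log_capacity :: "complex set \<Rightarrow> real" where
  "log_capacity E =
     (if robin_constant E = \<infinity> then 0 else exp (- real_of_ereal (robin_constant E)))"

definition widom_factor :: "nat \<Rightarrow> complex set \<Rightarrow> real" where
  "widom_factor n E = sup_norm E (chebyshev_poly E n) / log_capacity E ^ n"

text \<open>
  The branch of \<open>sqrt (z\<^sup>2 - 4)\<close> for which \<open>z + sqrt (z\<^sup>2 - 4)\<close> maps the exterior of \<open>[-2, 2]\<close>
  onto the exterior of the closed disk of radius 2, see \<open>sqrt_branch_power2\<close> and
  \<open>bij_betw_sqrt_branch\<close> below. On \<open>[-2, 2]\<close> the modulus of \<open>z + sqrt (z\<^sup>2 - 4)\<close> is 2 for either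
  root (\<open>norm_eq_2_if_real_segment\<close>).
\<close>

definition sqrt_branch :: "complex \<Rightarrow> complex" where
  "sqrt_branch z = csqrt (z - 2) * csqrt (z + 2)"

abbreviation real_segment :: "complex set" where
  "real_segment \<equiv> complex_of_real ` {-2..2}"

lemma sqrt_branch_power2: "(sqrt_branch z)\<^sup>2 = z\<^sup>2 - 4"
  by (simp add: sqrt_branch_def power_mult_distrib) (simp add: power2_eq_square algebra_simps)

lemma sqrt_branch_mult: "(z + sqrt_branch z) * (z - sqrt_branch z) = 4"
  using sqrt_branch_power2[of z] by (simp add: power2_eq_square algebra_simps)

lemma sqrt_branch_larger: "cmod (z - sqrt_branch z) \<le> cmod (z + sqrt_branch z)"
proof -
  define u where "u = csqrt (z - 2)"
  define v where "v = csqrt (z + 2)"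
  have uv: "u\<^sup>2 = z - 2" "v\<^sup>2 = z + 2" by (simp_all add: u_def v_def)
  have s: "sqrt_branch z = u * v" by (simp add: sqrt_branch_def u_def v_def)
  have Re: "Re u \<ge> 0" "Re v \<ge> 0"
    unfolding u_def v_def by (rule Re_csqrt)+
  have nonneg: "0 \<le> cmod x - Re x" for x
    using complex_Re_le_cmod[of x] by simp
  have "Im u * Im v \<ge> 0"
    using nonneg[of "z - 2"] nonneg[of "z + 2"]
    by (cases "Im z" "0 :: real" rule: linorder_cases) (simp_all add: u_def v_def)
  have "Re u * Re v + Im u * Im v \<ge> 0" using Re \<open>Im u * Im v \<ge> 0\<close> by simp
  then have "(cmod (u - v))\<^sup>2 \<le> (cmod (u + v))\<^sup>2"
    unfolding cmod_power2 by (simp add: power2_eq_square algebra_simps)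
  moreover have "z + u * v = (u + v)\<^sup>2 / 2" "z - u * v = (u - v)\<^sup>2 / 2"
    using uv by (simp_all add: power2_eq_square field_simps)
  ultimately show ?thesis by (simp only: s norm_divide norm_power) simp
qed

lemma norm_sqrt_branch_ge: "2 \<le> cmod (z + sqrt_branch z)"
proof (rule ccontr)
  assume "\<not> ?thesis"
  then have "cmod (z + sqrt_branch z) * cmod (z - sqrt_branch z) < 2 * 2"
    using sqrt_branch_larger[of z] by (intro mult_strict_mono') auto
  moreover have "cmod (z + sqrt_branch z) * cmod (z - sqrt_branch z) = 4"
    by (simp flip: norm_mult add: sqrt_branch_mult)
  ultimately show False by simp
qed

lemma norm_eq_2_imp_real_segment:
  assumes "s\<^sup>2 = z\<^sup>2 - 4" "cmod (z + s) = 2"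
  shows "z \<in> real_segment"
proof -
  define w where "w = z + s"
  have m: "w * (z - s) = 4" using assms(1) by (simp add: w_def power2_eq_square algebra_simps)
  have "w * cnj w = 4"
    using assms(2) complex_norm_square[of w] by (simp add: w_def)
  with m have "w * (z - s) = w * cnj w" by simp
  moreover have "w \<noteq> 0" using m by auto
  ultimately have "z - s = cnj w" by simp
  then have "2 * z = w + cnj w" unfolding w_def by (metis add.assoc add.commute diff_add_cancel mult_2)
  then have "z = complex_of_real (Re w)" by (simp add: complex_add_cnj)
  moreover have "\<bar>Re w\<bar> \<le> 2" using abs_Re_le_cmod[of w] assms(2) by (simp add: w_def)
  ultimately show ?thesis by (auto simp: abs_le_iff)
qed

lemma norm_eq_2_if_real_segment:
  assumes "s\<^sup>2 = z\<^sup>2 - 4" "z \<in> real_segment"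
  shows "cmod (z + s) = 2"
proof -
  obtain x where x: "z = complex_of_real x" "\<bar>x\<bar> \<le> 2" using assms(2) by (auto simp: abs_le_iff)
  have "s\<^sup>2 = (\<i> * complex_of_real (sqrt (4 - x\<^sup>2)))\<^sup>2"
    using abs_le_square_iff[of x 2] x
    by (simp add: assms(1) power_mult_distrib flip: of_real_power)
  then have "s = \<i> * complex_of_real (sqrt (4 - x\<^sup>2)) \<or> s = - (\<i> * complex_of_real (sqrt (4 - x\<^sup>2)))"
    by (simp only: power2_eq_iff)
  moreover have "x\<^sup>2 \<le> 4" using abs_le_square_iff[of x 2] x by simp
  ultimately show ?thesis using x by (auto simp: cmod_def)
qed

lemma bij_betw_sqrt_branch: "bij_betw (\<lambda>z. z + sqrt_branch z) (- real_segment) (- cball 0 2)"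
proof (rule bij_betwI[where g = "\<lambda>w. (w + 4 / w) / 2"])
  show "(\<lambda>z. z + sqrt_branch z) \<in> - real_segment \<rightarrow> - cball 0 2"
  proof
    fix z assume "z \<in> - real_segment"
    then have "cmod (z + sqrt_branch z) \<noteq> 2"
      using norm_eq_2_imp_real_segment[OF sqrt_branch_power2] by blast
    then show "z + sqrt_branch z \<in> - cball 0 2"
      using norm_sqrt_branch_ge[of z] by simp
  qed
  have *: "w = z + sqrt_branch z \<and> z \<notin> real_segment" if "cmod w > 2" "z = (w + 4 / w) / 2" for w z
  proof -
    define s where "s = w - z"
    have "w \<noteq> 0" using that(1) by auto
    then have s2: "s\<^sup>2 = z\<^sup>2 - 4"
      unfolding s_def that(2) by (simp add: field_simps power2_eq_square)
    have z: "z \<notin> real_segment"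
      using norm_eq_2_if_real_segment[OF s2] that(1) by (auto simp: s_def)
    have "s\<^sup>2 = (sqrt_branch z)\<^sup>2" by (simp add: s2 sqrt_branch_power2)
    then have "s = sqrt_branch z \<or> s = - sqrt_branch z" by (simp only: power2_eq_iff)
    moreover have False if "s = - sqrt_branch z"
    proof -
      have "w = z - sqrt_branch z" using that by (simp add: s_def algebra_simps)
      then have "cmod (z - sqrt_branch z) > 2" using \<open>cmod w > 2\<close> by simp
      then have "2 * 2 < cmod (z + sqrt_branch z) * cmod (z - sqrt_branch z)"
        using sqrt_branch_larger[of z] by (intro mult_strict_mono) auto
      then show False by (simp flip: norm_mult add: sqrt_branch_mult)
    qed
    ultimately have "w - z = sqrt_branch z" by (auto simp: s_def)
    then have "w = z + sqrt_branch z" by (simp only: diff_eq_eq add.commute)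
    with z show ?thesis by blast
  qed
  show "(\<lambda>w. (w + 4 / w) / 2) \<in> - cball 0 2 \<rightarrow> - real_segment"
  proof
    fix w :: complex assume "w \<in> - cball 0 2"
    then have "cmod w > 2" by simp
    from *[OF this refl] show "(w + 4 / w) / 2 \<in> - real_segment" by blast
  qed
  show "(z + sqrt_branch z + 4 / (z + sqrt_branch z)) / 2 = z" for z
  proof -
    have "4 / (z + sqrt_branch z) = z - sqrt_branch z"
      using sqrt_branch_mult[of z] by (metis nonzero_mult_div_cancel_left mult_zero_left zero_neq_numeral)
    then show ?thesis by simp
  qed
  show "(w + 4 / w) / 2 + sqrt_branch ((w + 4 / w) / 2) = w" if "w \<in> - cball 0 2" for w
  proof -
    from that have "cmod w > 2" by simp
    from *[OF this refl] show ?thesis by simp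
  qed
qed

end

theory Submission
  imports Defs
    "HOL-Complex_Analysis.Conformal_Mappings"
    "HOL-Computational_Algebra.Fundamental_Theorem_Algebra"
    "HOL-Real_Asymp.Real_Asymp"
begin

text \<open>
  Put \<open>w = z + a / 2\<close>, so that \<open>P z = w\<^sup>2 + c\<close>. Averaging over \<open>w \<mapsto> - w\<close> turns the extremal problem of
  degree \<open>2 n + e\<close> on \<open>E\<close> into minimising \<open>\<bar>y - c\<bar>\<^sup>e\<^sup>/\<^sup>2 \<bar>R(y)\<bar>\<close> over monic \<open>R\<close> of degree \<open>n\<close> on \<open>[-2, 2]\<close>.
  For \<open>e = 0\<close> this is the classical Chebyshev problem with minimum 2. For \<open>e = 1\<close> write \<open>y = u + 1/u\<close> and
  \<open>c = s + 1/s\<close> with \<open>\<bar>s\<bar> \<le> 1\<close>; the weight is then \<open>(\<bar>1 - s u\<bar> \<bar>1 - s\<^sup>* u\<bar> / \<bar>s\<bar>)\<^sup>1\<^sup>/\<^sup>2\<close> with \<open>s\<^sup>*\<close> the conjugate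
  of \<open>s\<close>, and it can be compared with \<open>1/\<bar>h\<bar>\<close> for a polynomial \<open>h\<close> without zeros in the closed unit disc.
  Weights of this form admit Bernstein's explicit extremal polynomials, which give the upper bound,
  and a quadrature formula, which gives the lower bound if \<open>\<bar>s\<bar> < 1\<close>.

  The capacity of \<open>E\<close> is 1: the logarithmic kernel on \<open>E\<close> is positive definite up to a small
  error, so all energies are nonnegative, and the energy of the preimage of the arcsine measure is \<open>\<le> 0\<close>.
\<close>

section \<open>Interpolation and Chebyshev polynomials\<close>

text \<open>The constant in the limit: for the weight \<open>1/|h|\<close> with
  \<open>h(0) = 1\<close> the minimum is 2 once \<open>n\<close> is large, and \<open>h\<close>
  approximates the inverse square root of \<open>(1 - s u) (1 - cnj s u)\<close>. The factor
  \<open>1/sqrt |s|\<close> of the weight remains, so the minimum tends to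
  \<open>2/sqrt |s|\<close>; since \<open>1/s\<close> is half of \<open>c + sqrt_branch c\<close>,
  this is the stated value. The obstacle is \<open>|s| = 1\<close>, that is, \<open>c\<close> on the
  segment: the weight then has zeros on the circle and no \<open>h\<close> approximates uniformly.
  Replacing \<open>s\<close> by \<open>r s\<close> with \<open>r < 1\<close> rests on
  \<open>|1 - z| <= 2/(1 + r) |1 - r z|\<close>. This goes one way only and serves the upper bound;
  the lower bound on the segment comes from counting signs. The same estimate regularises the
  logarithmic kernel in the capacity part. Positive definiteness is used concretely, as uniform
  approximability by finite sums of \<open>f z * f w\<close>, so that nonnegativity of an energy
  reduces to a sum of squares and no equilibrium potential is needed.\<close>

definition lagrange_basis :: "'a::field set \<Rightarrow> 'a \<Rightarrow> 'a poly" where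
  "lagrange_basis A a = (\<Prod>b\<in>A - {a}. smult (inverse (a - b)) [:-b, 1:])"

lemma poly_lagrange_basis_prod:
  "poly (lagrange_basis A a) z = (\<Prod>b\<in>A - {a}. (z - b) / (a - b))"
  unfolding lagrange_basis_def poly_prod by (intro prod.cong) (simp_all add: divide_simps)

lemma poly_lagrange_basis:
  assumes "finite A" "a \<in> A" "b \<in> A"
  shows "poly (lagrange_basis A a) b = (if b = a then 1 else 0)"
proof (cases "b = a")
  case True
  then show ?thesis unfolding poly_lagrange_basis_prod by (subst prod.neutral) auto
next
  case False
  then have "(\<Prod>d\<in>A - {a}. (b - d) / (a - d)) = 0"
    using assms by (intro prod_zero) auto
  with False show ?thesis by (simp add: poly_lagrange_basis_prod)
qed

lemma degree_lagrange_basis: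
  assumes "finite A" "a \<in> A"
  shows "degree (lagrange_basis A a) \<le> card A - 1"
proof -
  have "degree (lagrange_basis A a) \<le> (\<Sum>b\<in>A - {a}. degree (smult (inverse (a - b)) [:-b, 1:]))"
    unfolding lagrange_basis_def using assms
    by (intro order.trans[OF degree_prod_sum_le]) (auto simp: o_def)
  also have "\<dots> \<le> (\<Sum>b\<in>A - {a}. 1)"
    by (intro sum_mono) auto
  finally show ?thesis using assms by simp
qed

definition lagrange_interp :: "'a::field set \<Rightarrow> ('a \<Rightarrow> 'a) \<Rightarrow> 'a poly" where
  "lagrange_interp A v = (\<Sum>a\<in>A. smult (v a) (lagrange_basis A a))"

lemma poly_lagrange_interp:
  "poly (lagrange_interp A v) z = (\<Sum>a\<in>A. v a * poly (lagrange_basis A a) z)"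
  by (simp add: lagrange_interp_def poly_sum)

lemma poly_lagrange_interp_node:
  assumes "finite A" "b \<in> A"
  shows "poly (lagrange_interp A v) b = v b"
proof -
  have "(\<Sum>a\<in>A. v a * poly (lagrange_basis A a) b) = (\<Sum>a\<in>A. if a = b then v a else 0)"
    using assms by (intro sum.cong) (auto simp: poly_lagrange_basis)
  then show ?thesis using assms by (simp add: poly_lagrange_interp)
qed

lemma degree_lagrange_interp:
  assumes "finite A" "A \<noteq> {}"
  shows "degree (lagrange_interp A v) < card A"
proof -
  have "degree (lagrange_interp A v) \<le> card A - 1"
    unfolding lagrange_interp_def
    using assms degree_lagrange_basis
    by (intro degree_sum_le) (auto intro: order.trans[OF degree_smult_le])
  moreover have "0 < card A" using assms by (simp add: card_gt_0_iff)
  ultimately show ?thesis by linarith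
qed

definition nodal_poly :: "'a::comm_ring_1 set \<Rightarrow> 'a poly" where
  "nodal_poly A = (\<Prod>a\<in>A. [:-a, 1:])"

lemma poly_nodal_poly: "poly (nodal_poly A) z = (\<Prod>a\<in>A. z - a)"
  by (simp add: nodal_poly_def poly_prod)

lemma degree_nodal_poly: "degree (nodal_poly (A :: 'a::idom set)) = card A"
  by (cases "finite A") (simp_all add: nodal_poly_def degree_prod_eq_sum_degree)

lemma lead_coeff_nodal_poly: "lead_coeff (nodal_poly (A :: 'a::idom set)) = 1"
  by (simp add: nodal_poly_def lead_coeff_prod)

lemma monic_of_degree_nodal_poly: "monic_of_degree (card A) (nodal_poly A)"
  using lead_coeff_nodal_poly[of A] by (simp add: monic_of_degree_def degree_nodal_poly)

lemma monic_of_degree_add: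
  assumes "monic_of_degree n p" "degree q < n \<or> q = 0"
  shows "monic_of_degree n (p + q)"
proof (cases "q = 0")
  case False
  with assms have "degree q < degree p" by (auto simp: monic_of_degree_def)
  then show ?thesis using assms
    by (auto simp: monic_of_degree_def degree_add_eq_left lead_coeff_add_le coeff_eq_0)
qed (use assms in simp)

lemma monic_of_degree_diff:
  assumes "monic_of_degree n p" "monic_of_degree n q"
  shows "p = q \<or> degree (p - q) < n"
proof (cases "degree (p - q) < n")
  case False
  have "degree (p - q) \<le> n"
    using assms by (intro degree_diff_le) (auto simp: monic_of_degree_def)
  with False have "degree (p - q) = n" by simp
  moreover have "coeff (p - q) n = 0" using assms by (auto simp: monic_of_degree_def)
  ultimately show ?thesis using leading_coeff_0_iff[of "p - q"] by simp
qed simp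

text \<open>The leading coefficient replaces one node: \<open>p\<close> minus the nodal polynomial
  has degree below \<open>card A\<close>, so \<open>card A\<close> values determine
  \<open>p\<close>. This lets finitely many point values stand in for coefficients in the
  compactness argument.\<close>

lemma lagrange_interp_monic:
  fixes p :: "complex poly"
  assumes "finite A" "monic_of_degree (card A) p"
  shows "p = nodal_poly A + lagrange_interp A (poly p)"
proof (cases "A = {}")
  case True
  with assms show ?thesis
    by (auto simp: monic_of_degree_def nodal_poly_def lagrange_interp_def elim!: degree_eq_zeroE)
next
  case False
  let ?q = "nodal_poly A + lagrange_interp A (poly p)"
  have "monic_of_degree (card A) ?q"
    using assms False by (intro monic_of_degree_add monic_of_degree_nodal_poly)
      (auto simp: degree_lagrange_interp)
  then show ?thesis using assms
    by (intro poly_eqI_degree_lead_coeff[where n = "card A" and A = A])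
      (auto simp: monic_of_degree_def poly_nodal_poly poly_lagrange_interp_node prod_zero_iff)
qed

lemma ex_convergent_subseq_on_finite:
  fixes v :: "nat \<Rightarrow> 'a \<Rightarrow> complex"
  assumes "finite A" "\<And>a. a \<in> A \<Longrightarrow> bounded (range (\<lambda>k. v k a))"
  shows "\<exists>r l. strict_mono (r :: nat \<Rightarrow> nat) \<and> (\<forall>a\<in>A. (\<lambda>k. v (r k) a) \<longlonglongrightarrow> l a)"
  using assms
proof (induction A rule: finite_induct)
  case empty
  then show ?case by (auto intro!: exI[of _ id] strict_mono_id)
next
  case (insert b A)
  then obtain r l where r: "strict_mono (r :: nat \<Rightarrow> nat)" "\<forall>a\<in>A. (\<lambda>k. v (r k) a) \<longlonglongrightarrow> l a"
    by auto
  have "bounded (range (\<lambda>k. v (r k) b))"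
    using insert.prems[of b] by (rule bounded_subset) auto
  from bounded_imp_convergent_subsequence[OF this] obtain m s
    where s: "strict_mono (s :: nat \<Rightarrow> nat)" "((\<lambda>k. v (r k) b) \<circ> s) \<longlonglongrightarrow> m"
    by auto
  have "(\<lambda>k. v ((r \<circ> s) k) a) \<longlonglongrightarrow> l a" if "a \<in> A" for a
    using LIMSEQ_subseq_LIMSEQ[OF r(2)[rule_format, OF that] s(1)] by (simp add: o_def)
  then show ?case using r(1) s insert.hyps
    by (intro exI[of _ "r \<circ> s"] exI[of _ "l(b := m)"]) (auto simp: o_def strict_mono_def)
qed

section \<open>Existence and uniqueness of the extremal polynomial\<close>

lemma bdd_above_norm_poly:
  assumes "compact E"
  shows "bdd_above ((\<lambda>z. cmod (poly p z)) ` E)"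
  using assms
  by (intro bounded_imp_bdd_above compact_imp_bounded compact_continuous_image continuous_intros)

lemma norm_poly_le_sup_norm:
  assumes "compact E" "z \<in> E"
  shows "cmod (poly p z) \<le> sup_norm E p"
  unfolding sup_norm_def using assms by (intro cSUP_upper bdd_above_norm_poly)

lemma sup_norm_le:
  assumes "E \<noteq> {}" "\<And>z. z \<in> E \<Longrightarrow> cmod (poly p z) \<le> M"
  shows "sup_norm E p \<le> M"
  unfolding sup_norm_def using assms by (intro cSUP_least)

lemma sup_norm_nonneg:
  assumes "compact E" "E \<noteq> {}"
  shows "0 \<le> sup_norm E p"
  using assms norm_poly_le_sup_norm[OF assms(1)] by (metis all_not_in_conv norm_ge_zero order_trans)

text \<open>The values of a minimising sequence at \<open>n\<close> points of \<open>E\<close> are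
  bounded by its norms and determine the polynomials. A subsequence converges at these nodes, hence
  everywhere, to the monic polynomial with the limit values.\<close>

lemma ex_minimal_monic:
  assumes "compact E" "infinite E"
  shows "\<exists>p. monic_of_degree n p \<and> (\<forall>q. monic_of_degree n q \<longrightarrow> sup_norm E p \<le> sup_norm E q)"
proof -
  have ne: "E \<noteq> {}" using assms(2) by auto
  obtain A where A: "finite A" "card A = n" "A \<subseteq> E"
    using infinite_arbitrarily_large[OF assms(2)] by metis
  define S where "S = sup_norm E ` Collect (monic_of_degree n)"
  have S: "S \<noteq> {}" "bdd_below S"
    using monic_of_degree_nodal_poly[of A] A sup_norm_nonneg[OF assms(1) ne]
    by (auto simp: S_def intro!: bdd_belowI[of _ 0])
  define m where "m = Inf S"
  have "\<exists>q. monic_of_degree n q \<and> sup_norm E q < m + inverse (real (Suc k))" for k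
    using cInf_lessD[of S "m + inverse (real (Suc k))"] S by (auto simp: S_def m_def)
  then obtain q where q: "\<And>k. monic_of_degree n (q k)"
      "\<And>k. sup_norm E (q k) < m + inverse (real (Suc k))"
    by metis
  have "bounded (range (\<lambda>k. poly (q k) a))" if "a \<in> A" for a
  proof (rule boundedI[of _ "m + 1"])
    fix x assume "x \<in> range (\<lambda>k. poly (q k) a)"
    then obtain k where "x = poly (q k) a" by auto
    then have "cmod x \<le> sup_norm E (q k)"
      using that A by (auto intro!: norm_poly_le_sup_norm assms)
    also have "\<dots> \<le> m + inverse (real (Suc k))" using q(2)[of k] by simp
    also have "\<dots> \<le> m + 1" by (simp add: field_simps)
    finally show "cmod x \<le> m + 1" .
  qed
  from ex_convergent_subseq_on_finite[where v = "\<lambda>k. poly (q k)", OF A(1) this] obtain r l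
    where r: "strict_mono (r :: nat \<Rightarrow> nat)" "\<forall>a\<in>A. (\<lambda>k. poly (q (r k)) a) \<longlonglongrightarrow> l a"
    by blast
  define p where "p = nodal_poly A + lagrange_interp A l"
  have p: "monic_of_degree n p"
    unfolding p_def using A monic_of_degree_nodal_poly[of A] degree_lagrange_interp[OF A(1), of l]
    by (cases "A = {}") (auto simp: lagrange_interp_def intro!: monic_of_degree_add)
  have lim: "(\<lambda>k. poly (q (r k)) z) \<longlonglongrightarrow> poly p z" for z
  proof -
    have "(\<lambda>k. poly (nodal_poly A + lagrange_interp A (poly (q (r k)))) z) \<longlonglongrightarrow> poly p z"
      unfolding p_def poly_add poly_lagrange_interp
      by (intro tendsto_intros) (use r in auto)
    moreover have "nodal_poly A + lagrange_interp A (poly (q (r k))) = q (r k)" for k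
      using lagrange_interp_monic[of A "q (r k)"] A q(1) by simp
    ultimately show ?thesis by simp
  qed
  have "cmod (poly p z) \<le> m" if "z \<in> E" for z
  proof -
    have "(\<lambda>k. m + inverse (real (Suc (r k)))) \<longlonglongrightarrow> m"
      using LIMSEQ_subseq_LIMSEQ[OF LIMSEQ_inverse_real_of_nat_add r(1)] by (simp add: o_def)
    moreover have "cmod (poly (q (r k)) z) \<le> m + inverse (real (Suc (r k)))" for k
      using norm_poly_le_sup_norm[OF assms(1) that, of "q (r k)"] q(2)[of "r k"] by simp
    ultimately show ?thesis
      using tendsto_norm[OF lim[of z]] by (intro LIMSEQ_le) auto
  qed
  then have "sup_norm E p \<le> m" by (intro sup_norm_le ne)
  moreover have "m \<le> sup_norm E q" if "monic_of_degree n q" for q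
    unfolding m_def using that S by (intro cInf_lower) (auto simp: S_def)
  ultimately show ?thesis using p by (meson order_trans)
qed

text \<open>
  If a minimiser attained its norm on at most \<open>n\<close> points only, subtracting a small multiple of the
  polynomial of degree \<open>< n\<close> interpolating it at these points would decrease the norm.
\<close>

lemma minimal_monic_extremal_points:
  assumes E: "compact E" "infinite E" and p: "monic_of_degree n p"
    and min: "\<And>q. monic_of_degree n q \<Longrightarrow> sup_norm E p \<le> sup_norm E q"
    and fin: "finite {z\<in>E. cmod (poly p z) = sup_norm E p}"
  shows "n < card {z\<in>E. cmod (poly p z) = sup_norm E p}"
proof (rule ccontr)
  define m where "m = sup_norm E p"
  define A where "A = {z\<in>E. cmod (poly p z) = m}"
  assume "\<not> ?thesis"
  then have card: "card A \<le> n" and fA: "finite A" using fin by (auto simp: A_def m_def)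
  have ne: "E \<noteq> {}" using E(2) by auto
  have p0: "p \<noteq> 0" using p by (auto simp: monic_of_degree_def)
  obtain z0 where "z0 \<in> E" "poly p z0 \<noteq> 0"
    using E(2) poly_roots_finite[OF p0] by (metis (mono_tags, lifting) finite_subset mem_Collect_eq subsetI)
  then have m0: "m > 0"
    using norm_poly_le_sup_norm[OF E(1), of z0 p]
    by (metis m_def norm_le_zero_iff not_le order_trans)
  have "\<exists>z\<in>E. \<forall>y\<in>E. cmod (poly p y) \<le> cmod (poly p z)"
    using E ne by (intro continuous_attains_sup continuous_intros) auto
  then obtain z1 where z1: "z1 \<in> E" "\<forall>y\<in>E. cmod (poly p y) \<le> cmod (poly p z1)" by auto
  then have "cmod (poly p z1) = m"
    unfolding m_def using sup_norm_le[OF ne, of p] norm_poly_le_sup_norm[OF E(1), of z1 p]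
    by (simp add: order_antisym)
  then have Ane: "A \<noteq> {}" using z1 by (auto simp: A_def)
  define q where "q = lagrange_interp A (poly p)"
  have dq: "degree q < n"
    unfolding q_def using degree_lagrange_interp[OF fA Ane] card by (rule order.strict_trans2)
  have qA: "poly q z = poly p z" if "z \<in> A" for z
    using poly_lagrange_interp_node[OF fA that] by (simp add: q_def)
  \<comment> \<open>On \<open>A\<close> this equals \<open>m^2\<close>. Where it exceeds
    \<open>m^2 / 2\<close>, subtracting a small multiple of \<open>q\<close> decreases
    \<open>|p|\<close>; the remaining compact set \<open>V\<close> misses \<open>A\<close>, so that
    \<open>|p|\<close> is bounded away from \<open>m\<close> there.\<close>
  define \<phi> where "\<phi> z = Re (cnj (poly p z) * poly q z)" for z
  define V where "V = {z\<in>E. \<phi> z \<le> m\<^sup>2 / 2}"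
  have cont: "continuous_on E \<phi>" unfolding \<phi>_def by (intro continuous_intros)
  have "closed V"
    unfolding V_def
    by (rule continuous_on_closed_Collect_le[OF cont continuous_on_const compact_imp_closed[OF E(1)]])
  moreover have "V \<subseteq> E" by (auto simp: V_def)
  ultimately have "compact V" using compact_Int_closed[OF E(1)] by (metis Int_absorb1)
  have VA: "V \<inter> A = {}"
  proof -
    have "\<phi> z = m\<^sup>2" if "z \<in> A" for z
      using qA[OF that] that cmod_power2[of "poly p z"]
      by (simp add: \<phi>_def A_def power2_eq_square)
    moreover have "m\<^sup>2 / 2 < m\<^sup>2" using m0 by simp
    ultimately show ?thesis by (fastforce simp: V_def)
  qed
  obtain m' where m': "m' < m" "m' \<ge> 0" "\<And>z. z \<in> V \<Longrightarrow> cmod (poly p z) \<le> m'"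
  proof (cases "V = {}")
    case True
    then show ?thesis using that[of 0] m0 by auto
  next
    case False
    have "\<exists>z\<in>V. \<forall>y\<in>V. cmod (poly p y) \<le> cmod (poly p z)"
      using \<open>compact V\<close> False by (intro continuous_attains_sup continuous_intros) auto
    then obtain z where z: "z \<in> V" "\<forall>y\<in>V. cmod (poly p y) \<le> cmod (poly p z)" by auto
    then have "cmod (poly p z) \<noteq> m" "z \<in> E" using VA by (auto simp: A_def V_def)
    then have "cmod (poly p z) < m"
      using norm_poly_le_sup_norm[OF E(1), of z p] by (simp add: m_def)
    then show ?thesis using that[of "cmod (poly p z)"] z by auto
  qed
  define K where "K = sup_norm E q + 1"
  have K: "K > 0" "\<And>z. z \<in> E \<Longrightarrow> cmod (poly q z) \<le> K"
    using sup_norm_nonneg[OF E(1) ne, of q] norm_poly_le_sup_norm[OF E(1), of _ q]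
    by (auto simp: K_def intro: add_increasing2)
  \<comment> \<open>The first bound keeps the quadratic term \<open>\<eta>^2 K^2\<close> below half
    of the linear gain \<open>\<eta> m^2\<close> off \<open>V\<close>; the second keeps the
    perturbed polynomial below \<open>(m + m') / 2\<close> on \<open>V\<close>.\<close>
  define \<eta> where "\<eta> = min (m\<^sup>2 / (2 * K\<^sup>2)) ((m - m') / (2 * K))"
  have \<eta>: "\<eta> > 0" "\<eta> * K\<^sup>2 \<le> m\<^sup>2 / 2" "\<eta> * K \<le> (m - m') / 2"
  proof -
    show "\<eta> > 0" using m0 K m' by (simp add: \<eta>_def)
    have "\<eta> \<le> m\<^sup>2 / (2 * K\<^sup>2)" "\<eta> \<le> (m - m') / (2 * K)" by (simp_all add: \<eta>_def)
    then show "\<eta> * K\<^sup>2 \<le> m\<^sup>2 / 2" "\<eta> * K \<le> (m - m') / 2" using K by (simp_all add: field_simps)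
  qed
  define M where "M = max ((m + m') / 2) (sqrt (m\<^sup>2 - \<eta> * m\<^sup>2 / 2))"
  have "sqrt (m\<^sup>2 - \<eta> * m\<^sup>2 / 2) < sqrt (m\<^sup>2)"
    using \<eta> m0 by (intro real_sqrt_less_mono) simp
  then have "M < m" using m0 m' by (simp add: M_def)
  have "cmod (poly (p - smult \<eta> q) z) \<le> M" if z: "z \<in> E" for z
  proof (cases "z \<in> V")
    case True
    have "cmod (poly (p - smult \<eta> q) z) \<le> cmod (poly p z) + \<eta> * cmod (poly q z)"
      using norm_triangle_ineq4[of "poly p z" "\<eta> * poly q z"] \<eta> by (simp add: norm_mult)
    also have "\<dots> \<le> m' + \<eta> * K"
      using m'(3)[OF True] K(2)[OF z] \<eta> by (intro add_mono mult_left_mono) auto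
    also have "\<dots> \<le> (m + m') / 2" using \<eta>(3) by (simp add: field_simps)
    also have "\<dots> \<le> M" by (simp add: M_def)
    finally show ?thesis .
  next
    case False
    then have \<phi>: "\<phi> z \<ge> m\<^sup>2 / 2" using z by (simp add: V_def)
    have "(cmod (poly (p - smult \<eta> q) z))\<^sup>2 = (cmod (poly p z))\<^sup>2 - 2 * \<eta> * \<phi> z + \<eta>\<^sup>2 * (cmod (poly q z))\<^sup>2"
      unfolding poly_diff poly_smult cmod_power2 \<phi>_def minus_complex.sel times_complex.sel cnj.sel
        Re_complex_of_real Im_complex_of_real by algebra
    also have "\<dots> \<le> m\<^sup>2 - 2 * \<eta> * (m\<^sup>2 / 2) + \<eta>\<^sup>2 * K\<^sup>2"
      using norm_poly_le_sup_norm[OF E(1) z, of p] K(2)[OF z] \<phi> \<eta>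
      by (intro add_mono diff_mono mult_left_mono power_mono) (auto simp: m_def)
    also have "\<eta>\<^sup>2 * K\<^sup>2 \<le> \<eta> * (m\<^sup>2 / 2)"
      using mult_left_mono[OF \<eta>(2), of \<eta>] \<eta>(1) by (simp add: power2_eq_square mult_ac)
    finally have "(cmod (poly (p - smult \<eta> q) z))\<^sup>2 \<le> m\<^sup>2 - \<eta> * m\<^sup>2 / 2" by simp
    then have "cmod (poly (p - smult \<eta> q) z) \<le> sqrt (m\<^sup>2 - \<eta> * m\<^sup>2 / 2)"
      by (rule real_le_rsqrt)
    then show ?thesis by (simp add: M_def)
  qed
  then have "sup_norm E (p - smult \<eta> q) \<le> M" by (intro sup_norm_le ne)
  moreover have "monic_of_degree n (p - smult \<eta> q)"
    using monic_of_degree_add[OF p, of "- smult \<eta> q"] dq by (auto simp: degree_smult_eq)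
  ultimately show False using min \<open>M < m\<close> by (fastforce simp: m_def)
qed

text \<open>Uniqueness: the midpoint of two minimisers is again one, and where it attains its norm
  the parallelogram law forces the two to agree. So its extremal points are roots of the difference;
  they are finitely many if the difference is nonzero, and more than \<open>n\<close>, against
  degree at most \<open>n\<close>.\<close>

lemma chebyshev_poly_minimal:
  assumes E: "compact E" "infinite E"
  shows "monic_of_degree n (chebyshev_poly E n)"
    and "\<And>q. monic_of_degree n q \<Longrightarrow> sup_norm E (chebyshev_poly E n) \<le> sup_norm E q"
proof -
  define Q where "Q p \<longleftrightarrow> monic_of_degree n p \<and> (\<forall>q. monic_of_degree n q \<longrightarrow> sup_norm E p \<le> sup_norm E q)" for p
  have ne: "E \<noteq> {}" using E(2) by auto
  have uniq: "p1 = p2" if p: "Q p1" "Q p2" for p1 p2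
  proof (rule ccontr)
    assume neq: "p1 \<noteq> p2"
    define m where "m = sup_norm E p1"
    have m2: "sup_norm E p2 = m" using p by (auto simp: Q_def m_def intro: order_antisym)
    define p where "p = smult (1/2) (p1 + p2)"
    define A where "A = {z\<in>E. cmod (poly p z) = sup_norm E p}"
    have mon: "monic_of_degree n p"
    proof -
      have "monic_of_degree n (p1 + smult (1/2) (p2 - p1))"
        using monic_of_degree_diff[of n p2 p1] neq p by (intro monic_of_degree_add) (auto simp: Q_def)
      moreover have "p1 + smult (1/2) (p2 - p1) = p"
        by (intro poly_eqI) (simp add: p_def field_simps)
      ultimately show ?thesis by simp
    qed
    have le: "cmod (poly p z) \<le> m" if "z \<in> E" for z
    proof -
      have "cmod (poly p z) = cmod (poly p1 z + poly p2 z) / 2"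
        by (simp add: p_def norm_mult norm_divide)
      also have "\<dots> \<le> (m + m) / 2"
        using norm_poly_le_sup_norm[OF E(1) that, of p1] norm_poly_le_sup_norm[OF E(1) that, of p2]
        by (intro divide_right_mono order.trans[OF norm_triangle_ineq] add_mono)
          (auto simp: m_def m2[unfolded m_def])
      finally show ?thesis by simp
    qed
    then have "sup_norm E p \<le> m" by (intro sup_norm_le ne)
    moreover have "m \<le> sup_norm E p" using p mon by (auto simp: Q_def m_def)
    ultimately have sp: "sup_norm E p = m" by simp
    have "poly p1 z = poly p2 z" if "z \<in> A" for z
    proof -
      define u v where "u = poly p1 z" and "v = poly p2 z"
      have z: "z \<in> E" using that by (simp add: A_def)
      have 1: "cmod u \<le> m" "cmod v \<le> m"
        using norm_poly_le_sup_norm[OF E(1) z, of p1] norm_poly_le_sup_norm[OF E(1) z, of p2]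
        by (auto simp: m_def m2[unfolded m_def] u_def v_def)
      have 2: "cmod (u + v) = 2 * m"
        using that sp by (simp add: A_def p_def norm_mult norm_divide u_def v_def)
      have "(cmod (u + v))\<^sup>2 + (cmod (u - v))\<^sup>2 = 2 * (cmod u)\<^sup>2 + 2 * (cmod v)\<^sup>2"
        unfolding cmod_power2 by (simp add: power2_eq_square algebra_simps)
      also have "\<dots> \<le> 2 * m\<^sup>2 + 2 * m\<^sup>2"
        using 1 by (intro add_mono mult_left_mono power_mono) auto
      finally have "(cmod (u - v))\<^sup>2 \<le> 0" using 2 by (simp add: power_mult_distrib)
      then show ?thesis by (simp add: u_def v_def)
    qed
    then have sub: "A \<subseteq> {z. poly (p1 - p2) z = 0}" by auto
    have "p1 - p2 \<noteq> 0" using neq by simp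
    then have fin: "finite {z. poly (p1 - p2) z = 0}" by (rule poly_roots_finite)
    have "n < card A"
      unfolding A_def
      by (rule minimal_monic_extremal_points[OF E mon])
        (use p finite_subset[OF sub fin] in \<open>auto simp: sp m_def Q_def A_def\<close>)
    also have "\<dots> \<le> card {z. poly (p1 - p2) z = 0}" by (rule card_mono[OF fin sub])
    also have "\<dots> \<le> degree (p1 - p2)" using neq by (intro card_poly_roots_bound) simp
    also have "\<dots> \<le> n" using p by (intro degree_diff_le) (auto simp: Q_def monic_of_degree_def)
    finally show False by simp
  qed
  obtain p where "Q p" using ex_minimal_monic[OF E, of n] by (auto simp: Q_def)
  then have "Q (THE p. Q p)" using theI[of Q p] uniq by blast
  then have "Q (chebyshev_poly E n)" unfolding chebyshev_poly_def Q_def .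
  then show "monic_of_degree n (chebyshev_poly E n)"
    "\<And>q. monic_of_degree n q \<Longrightarrow> sup_norm E (chebyshev_poly E n) \<le> sup_norm E q"
    by (auto simp: Q_def)
qed

section \<open>A quadrature formula\<close>

text \<open>Lagrange interpolation of \<open>F\<close> evaluated at 0, where the basis polynomial of
  \<open>a\<close> is \<open>- p(0) / (a p'(a))\<close> with \<open>p\<close> the nodal polynomial.
  Equivalently, the residues of \<open>F(z) / (z p(z))\<close>: the 1 is the contribution of
  infinity.\<close>

lemma nodal_quadrature:
  fixes A :: "complex set"
  assumes A: "finite A" "0 \<notin> A" and F: "monic_of_degree (card A) F"
  shows "(\<Sum>a\<in>A. poly F a / (a * poly (pderiv (nodal_poly A)) a)) = 1 - poly F 0 / poly (nodal_poly A) 0"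
proof -
  define p where "p = nodal_poly A"
  have p0: "poly p 0 \<noteq> 0" using A by (auto simp: p_def poly_nodal_poly)
  have basis: "poly (lagrange_basis A a) 0 = - (poly p 0 / (a * poly (pderiv p) a))" if "a \<in> A" for a
  proof -
    have "pderiv p = (\<Sum>b\<in>A. \<Prod>d\<in>A - {b}. [:-d, 1:])"
      by (simp add: p_def nodal_poly_def pderiv_prod pderiv_pCons)
    then have "poly (pderiv p) a = (\<Sum>b\<in>A. \<Prod>d\<in>A - {b}. a - d)"
      by (simp add: poly_sum poly_prod)
    also have "\<dots> = (\<Sum>b\<in>A. if b = a then \<Prod>d\<in>A - {a}. a - d else 0)"
      using A that by (intro sum.cong refl) (auto intro!: prod_zero)
    finally have 1: "poly (pderiv p) a = (\<Prod>d\<in>A - {a}. a - d)" using A that by simp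
    have "poly p 0 = - a * (\<Prod>d\<in>A - {a}. - d)"
      using A that by (simp add: p_def poly_nodal_poly prod.remove[of A a])
    moreover have "poly (lagrange_basis A a) 0 = (\<Prod>d\<in>A - {a}. - d) / (\<Prod>d\<in>A - {a}. a - d)"
      by (simp add: poly_lagrange_basis_prod flip: prod_dividef)
    moreover have "a \<noteq> 0" using A that by auto
    ultimately show ?thesis using 1 by simp
  qed
  have "poly F 0 = poly p 0 + (\<Sum>a\<in>A. poly F a * poly (lagrange_basis A a) 0)"
    using lagrange_interp_monic[OF A(1) F] by (metis p_def poly_add poly_lagrange_interp)
  also have "(\<Sum>a\<in>A. poly F a * poly (lagrange_basis A a) 0)
      = - poly p 0 * (\<Sum>a\<in>A. poly F a / (a * poly (pderiv p) a))"
    unfolding sum_distrib_left by (intro sum.cong) (auto simp: basis)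
  finally show ?thesis using p0 by (simp add: p_def field_simps)
qed

lemma poly_cnj_inverse:
  assumes "\<And>u. poly h (cnj u) = cnj (poly h u)" "cmod u = 1"
  shows "poly h (inverse u) = cnj (poly h u)"
proof -
  have "inverse u = cnj u"
    using assms(2) complex_norm_square[of u] by (intro inverse_unique) simp
  then show ?thesis using assms(1) by simp
qed

lemma poly_pderiv_cnj:
  fixes h :: "complex poly"
  assumes "\<And>u. poly h (cnj u) = cnj (poly h u)"
  shows "poly (pderiv h) (cnj u) = cnj (poly (pderiv h) u)"
proof -
  have "(poly h has_field_derivative poly (pderiv h) u) (at u)" by (rule poly_DERIV)
  then have "(cnj \<circ> poly h \<circ> cnj has_field_derivative cnj (poly (pderiv h) u)) (at (cnj u))"
    using has_field_derivative_cnj_cnj[of "poly h" "poly (pderiv h) u" "cnj u"] by simp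
  moreover have "cnj \<circ> poly h \<circ> cnj = poly h" using assms by (auto simp: o_def)
  ultimately show ?thesis using poly_DERIV DERIV_unique by metis
qed

text \<open>The two polynomials have equal modulus on the unit circle, and their quotient is
  holomorphic inside since \<open>h\<close> has no zeros there, so the maximum principle
  applies.\<close>

lemma norm_reflect_poly_le:
  assumes h: "\<And>u. poly h (cnj u) = cnj (poly h u)" "\<And>u. cmod u \<le> 1 \<Longrightarrow> poly h u \<noteq> 0"
    and u: "cmod u \<le> 1"
  shows "cmod (poly (reflect_poly h) u) \<le> cmod (poly h u)"
proof -
  define f where "f z = poly (reflect_poly h) z / poly h z" for z
  have "cmod (f u) \<le> 1"
  proof (rule maximum_modulus_frontier[where S = "cball 0 1" and f = f])
    show "f holomorphic_on interior (cball 0 1)"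
      unfolding f_def using h by (intro holomorphic_intros) auto
    show "continuous_on (closure (cball 0 1)) f"
      unfolding f_def using h by (intro continuous_intros) auto
    fix z :: complex assume "z \<in> frontier (cball 0 1)"
    then have z: "cmod z = 1" by simp
    then have "poly (reflect_poly h) z = z ^ degree h * cnj (poly h z)"
      using poly_cnj_inverse[OF h(1) z] by (subst poly_reflect_poly_nz) auto
    then show "cmod (f z) \<le> 1" using h z by (simp add: f_def norm_divide norm_mult norm_power)
  qed (use u in auto)
  then show ?thesis using h(2)[OF u] by (simp add: f_def norm_divide divide_le_eq)
qed

text \<open>
  The quadrature formula at the roots of \<open>u\<^sup>2\<^sup>n h(1/u) - h(u)\<close>. These lie on the unit circle and are
  simple, and the weights have modulus \<open>1 / (\<bar>h\<bar> \<beta>)\<close> with \<open>\<beta> > 0\<close>. The polynomial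
  \<open>u\<^sup>2\<^sup>n h(1/u) + h(u)\<close>, which takes the values \<open>2 h\<close> at the nodes, shows that the \<open>1 / \<beta>\<close> sum to 1.
\<close>

lemma weighted_chebyshev_lower_bound:
  fixes h F :: "complex poly"
  assumes h: "\<And>u. poly h (cnj u) = cnj (poly h u)" "\<And>u. cmod u \<le> 1 \<Longrightarrow> poly h u \<noteq> 0" "poly h 0 = 1"
    and deg: "degree h < 2 * n"
    and der: "\<And>u. cmod u = 1 \<Longrightarrow> cmod (u * poly (pderiv h) u / poly h u) < n"
    and F: "monic_of_degree (2 * n) F" "poly F 0 = 1"
    and le: "\<And>u. cmod u = 1 \<Longrightarrow> cmod (poly F u) \<le> M * cmod (poly h u)"
  shows "2 \<le> M"
proof -
  define k where "k = 2 * n - degree h"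
  have k: "k > 0" "k + degree h = 2 * n" using deg by (auto simp: k_def)
  \<comment> \<open>This is \<open>u^(2n) h(1/u)\<close>: \<open>reflect_poly\<close> supplies
    \<open>u^(degree h)\<close> and the monomial the rest. It is monic because
    \<open>h(0) = 1\<close>.\<close>
  define q where "q = monom 1 k * reflect_poly h"
  define p where "p = q - h"
  have h0: "coeff h 0 = 1" "h \<noteq> 0" using h(3) by (auto simp: poly_0_coeff_0)
  have q: "monic_of_degree (2 * n) q"
  proof -
    have "degree q = 2 * n"
      using h0 k by (simp add: q_def degree_mult_eq degree_monom_eq)
    moreover have "lead_coeff q = 1"
      using h0 by (simp add: q_def lead_coeff_mult degree_monom_eq coeff_reflect_poly)
    ultimately show ?thesis by (simp add: monic_of_degree_def)
  qed
  have p: "monic_of_degree (2 * n) p"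
    using monic_of_degree_add[OF q, of "-h"] deg by (simp add: p_def)
  have p0: "poly p 0 = -1" using k h(3) by (simp add: p_def q_def poly_monom)
  have qu: "poly q u = u ^ (2 * n) * poly h (inverse u)" if "u \<noteq> 0" for u
    using that by (simp add: q_def poly_monom poly_reflect_poly_nz power_add flip: k(2))
  have inside: "cmod (poly q u) < cmod (poly h u)" if "cmod u < 1" for u
  proof -
    have "cmod (poly q u) = cmod u ^ k * cmod (poly (reflect_poly h) u)"
      by (simp add: q_def norm_mult poly_monom norm_power)
    also have "\<dots> \<le> cmod u ^ k * cmod (poly h u)"
      using norm_reflect_poly_le[OF h(1,2), of u] that by (intro mult_left_mono) auto
    also have "\<dots> < 1 * cmod (poly h u)"
      using that k h(2)[of u] by (intro mult_strict_right_mono power_Suc_less_one) (auto simp: power_less_one_iff)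
    finally show ?thesis by simp
  qed
  \<comment> \<open>Inside the disc \<open>|q| < |h|\<close>. The exterior reduces to this by
    \<open>u\<close> to \<open>1/u\<close>, which exchanges \<open>q\<close> and \<open>h\<close> up
    to the factor \<open>u^(2n)\<close>.\<close>
  have circle: "cmod u = 1" if "poly p u = 0" for u
  proof (cases "cmod u" "1 :: real" rule: linorder_cases)
    case less
    then show ?thesis using inside[of u] that by (simp add: p_def)
  next
    case greater
    then have u0: "u \<noteq> 0" "cmod (inverse u) < 1" by (auto simp: norm_inverse inverse_less_1_iff)
    have "poly q (inverse u) * u ^ (2 * n) = poly h u" using qu[of "inverse u"] u0 by (simp add: power_inverse)
    moreover have "poly h (inverse u) * u ^ (2 * n) = poly q u" using qu[of u] u0 by simp
    ultimately have "poly q (inverse u) * u ^ (2 * n) = poly h (inverse u) * u ^ (2 * n)"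
      using that by (simp add: p_def)
    then show ?thesis using inside[OF u0(2)] u0 by simp
  qed
  \<comment> \<open>On the circle \<open>u q'(u) / q(u)\<close> is \<open>2 n\<close> minus the
    conjugate of \<open>u h'(u) / h(u)\<close>. At a root of \<open>p\<close> one has
    \<open>q = h\<close>, so \<open>u p'(u) / h(u)\<close> is this real number, and
    \<open>der\<close> makes it positive.\<close>
  define \<beta> where "\<beta> u = 2 * n - 2 * Re (u * poly (pderiv h) u / poly h u)" for u
  have \<beta>: "\<beta> u > 0" if "cmod u = 1" for u
    using der[OF that] complex_Re_le_cmod[of "u * poly (pderiv h) u / poly h u"] by (simp add: \<beta>_def)
  have pder: "u * poly (pderiv p) u = poly h u * \<beta> u" if "poly p u = 0" for u
  proof -
    note u = circle[OF that]
    then have u0: "u \<noteq> 0" by auto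
    have hu: "poly h u \<noteq> 0" using h u by simp
    have "((\<lambda>u. u ^ (2 * n) * poly h (inverse u)) has_field_derivative
        of_nat (2 * n) * u ^ (2 * n - 1) * poly h (inverse u) +
        u ^ (2 * n) * (poly (pderiv h) (inverse u) * - (inverse u ^ 2))) (at u)" (is "(_ has_field_derivative ?D) _")
      using u0 by (auto intro!: derivative_eq_intros simp: power2_eq_square algebra_simps)
    then have "(poly q has_field_derivative ?D) (at u)"
      by (rule has_field_derivative_transform_within_open[where S = "- {0}"]) (use u0 in \<open>auto simp: qu\<close>)
    then have D: "poly (pderiv q) u = ?D" using poly_DERIV DERIV_unique by blast
    have "u * poly (pderiv p) u = u * ?D - u * poly (pderiv h) u"
      by (simp only: p_def pderiv_diff poly_diff D right_diff_distrib)
    also have "u * ?D = of_nat (2 * n) * (u ^ (2 * n) * poly h (inverse u))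
        - u ^ (2 * n) * (inverse u * poly (pderiv h) (inverse u))"
    proof -
      have "u ^ (2 * n) = u * u ^ (2 * n - 1)" using deg power_minus_mult[of "2 * n" u] by (simp add: mult.commute)
      then show ?thesis using u0 by (simp add: field_simps power2_eq_square)
    qed
    also have "u ^ (2 * n) * poly h (inverse u) = poly h u"
      using that qu[OF u0] by (simp add: p_def)
    also have "u ^ (2 * n) = poly h u / cnj (poly h u)"
      using that qu[OF u0] poly_cnj_inverse[OF h(1) u] hu by (simp add: p_def field_simps)
    also have "inverse u * poly (pderiv h) (inverse u) = cnj (u * poly (pderiv h) u)"
    proof -
      have "inverse u = cnj u"
        using u complex_norm_square[of u] by (intro inverse_unique) simp
      then show ?thesis using poly_pderiv_cnj[OF h(1)] by simp
    qed
    finally have "u * poly (pderiv p) u = poly h u *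
       (of_nat (2 * n) - (u * poly (pderiv h) u / poly h u + cnj (u * poly (pderiv h) u / poly h u)))"
      using hu by (simp add: right_diff_distrib distrib_left mult_ac)
    also have "\<dots> = poly h u * \<beta> u"
      unfolding complex_add_cnj by (simp add: \<beta>_def)
    finally show ?thesis .
  qed
  define A where "A = {u. poly p u = 0}"
  have "poly (pderiv p) u \<noteq> 0" if "poly p u = 0" for u
    using pder[OF that] \<beta>[OF circle[OF that]] h(2)[of u] circle[OF that] by auto
  then have "rsquarefree p" by (auto simp: rsquarefree_roots)
  then have pA: "p = nodal_poly A"
    using complex_poly_decompose_rsquarefree[of p] p
    unfolding A_def nodal_poly_def monic_of_degree_def by (metis smult_1_left)
  have fA: "finite A" unfolding A_def using p0 by (intro poly_roots_finite) auto
  have A0: "0 \<notin> A" using p0 by (simp add: A_def)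
  have cA: "card A = 2 * n" using p pA degree_nodal_poly[of A] by (simp add: monic_of_degree_def)
  \<comment> \<open>Since \<open>p(0) = -1\<close>, the value 2 is the 1 of the quadrature formula
    plus \<open>G(0)\<close>.\<close>
  have quad: "(\<Sum>u\<in>A. poly G u / (poly h u * \<beta> u)) = 2"
    if "monic_of_degree (2 * n) G" "poly G 0 = 1" for G
  proof -
    have "(\<Sum>u\<in>A. poly G u / (poly h u * \<beta> u)) = (\<Sum>u\<in>A. poly G u / (u * poly (pderiv (nodal_poly A)) u))"
      unfolding pA[symmetric] by (intro sum.cong refl) (simp add: pder A_def)
    also have "\<dots> = 2" using nodal_quadrature[OF fA A0, of G] that cA p0 by (simp flip: pA)
    finally show ?thesis .
  qed
  have qh: "monic_of_degree (2 * n) (q + h)" "poly (q + h) 0 = 1"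
    using monic_of_degree_add[OF q, of h] deg k h(3) by (simp_all add: q_def poly_monom)
  have "2 = (\<Sum>u\<in>A. poly (q + h) u / (poly h u * \<beta> u))" using quad[OF qh] by simp
  also have "\<dots> = (\<Sum>u\<in>A. of_real (2 / \<beta> u))"
    using h(2) circle by (intro sum.cong) (auto simp: A_def p_def field_simps)
  finally have "of_real 2 = complex_of_real (\<Sum>u\<in>A. 2 / \<beta> u)" by simp
  then have "(\<Sum>u\<in>A. 2 / \<beta> u) = 2" by (simp only: of_real_eq_iff)
  then have "2 * (\<Sum>u\<in>A. 1 / \<beta> u) = 2" unfolding sum_distrib_left by simp
  then have sum1: "(\<Sum>u\<in>A. 1 / \<beta> u) = 1" by simp
  have "2 = cmod (\<Sum>u\<in>A. poly F u / (poly h u * \<beta> u))" using quad[OF F] by simp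
  also have "\<dots> \<le> (\<Sum>u\<in>A. cmod (poly F u / (poly h u * \<beta> u)))" by (rule norm_sum)
  also have "\<dots> \<le> (\<Sum>u\<in>A. M * (1 / \<beta> u))"
  proof (rule sum_mono)
    fix u assume "u \<in> A"
    then have u: "cmod u = 1" using circle by (simp add: A_def)
    have hu: "cmod (poly h u) > 0" using h(2)[of u] u by simp
    have "cmod (poly F u / (poly h u * \<beta> u)) = cmod (poly F u) / (cmod (poly h u) * \<beta> u)"
      using \<beta>[OF u] by (simp add: norm_divide norm_mult)
    also have "\<dots> \<le> (M * cmod (poly h u)) / (cmod (poly h u) * \<beta> u)"
      using \<beta>[OF u] le[OF u] hu by (intro divide_right_mono) auto
    finally show "cmod (poly F u / (poly h u * \<beta> u)) \<le> M * (1 / \<beta> u)" using hu by simp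
  qed
  also have "\<dots> = M" unfolding sum_distrib_left[symmetric] sum1 by simp
  finally show ?thesis .
qed

section \<open>Polynomials in \<open>u + 1/u\<close>\<close>

lemma monic_of_degreeI: "degree p \<le> n \<Longrightarrow> coeff p n = 1 \<Longrightarrow> monic_of_degree n p"
  by (metis monic_of_degree_def le_antisym le_degree zero_neq_one)

lemma monic_of_degree_iff: "monic_of_degree n p \<longleftrightarrow> degree p = n \<and> coeff p n = 1"
  by (auto simp: monic_of_degree_def)

lemma monic_of_degree_mult:
  "monic_of_degree m p \<Longrightarrow> monic_of_degree n q \<Longrightarrow> monic_of_degree (m + n) (p * q)"
  unfolding monic_of_degree_def by (metis degree_mult_eq lead_coeff_mult leading_coeff_0_iff mult_1 zero_neq_one)

lemma monic_of_degree_power: "monic_of_degree n p \<Longrightarrow> monic_of_degree (n * k) (p ^ k)"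
proof (induction k)
  case (Suc k)
  then show ?case using monic_of_degree_mult[OF Suc.prems, of "n * k" "p ^ k"] by (simp add: Suc.IH)
qed (simp add: monic_of_degree_iff)

lemma monic_of_degree_pcompose:
  assumes "monic_of_degree m p" "monic_of_degree n q" "n > 0"
  shows "monic_of_degree (m * n) (pcompose p q)"
  using assms lead_coeff_comp[of q p] by (auto simp: monic_of_degree_def degree_pcompose)

text \<open>In classical terms \<open>2 T_n(y/2)\<close>. The value 2 at index 0 fits
  \<open>u^n + u^(-n)\<close>, at the price of not being monic there.\<close>

fun dickson :: "nat \<Rightarrow> complex poly" where
  "dickson 0 = [:2:]"
| "dickson (Suc 0) = [:0, 1:]"
| "dickson (Suc (Suc n)) = [:0, 1:] * dickson (Suc n) - dickson n"

lemma poly_dickson: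
  assumes "u \<noteq> 0"
  shows "poly (dickson n) (u + inverse u) = u ^ n + inverse u ^ n"
  using assms by (induction n rule: dickson.induct) (simp_all add: field_simps)

lemma monic_of_degree_dickson: "n > 0 \<Longrightarrow> monic_of_degree n (dickson n)"
proof (induction n rule: dickson.induct)
  case (3 n)
  have "monic_of_degree (1 + Suc n) ([:0, 1:] * dickson (Suc n))"
    using 3 by (intro monic_of_degree_mult) (auto simp: monic_of_degree_def)
  moreover have "degree (dickson n) < Suc (Suc n)"
    using 3 by (cases "n = 0") (auto simp: monic_of_degree_def)
  ultimately show ?case using monic_of_degree_add[of "Suc (Suc n)" _ "- dickson n"] by simp
qed (auto simp: monic_of_degree_def)

section \<open>The segment as the image of the unit circle under \<open>u + 1/u\<close>\<close>

lemma real_segment_iff_circle: "y \<in> real_segment \<longleftrightarrow> (\<exists>u. cmod u = 1 \<and> y = u + inverse u)"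
proof
  assume "y \<in> real_segment"
  then obtain x where x: "y = complex_of_real x" "-2 \<le> x" "x \<le> 2" by auto
  have "y = cis (arccos (x / 2)) + inverse (cis (arccos (x / 2)))"
    using x by (intro complex_eqI) (simp_all add: cis_inverse cos_arccos)
  then show "\<exists>u. cmod u = 1 \<and> y = u + inverse u" by (intro exI[of _ "cis (arccos (x / 2))"]) simp
next
  assume "\<exists>u. cmod u = 1 \<and> y = u + inverse u"
  then obtain u where u: "cmod u = 1" "y = u + inverse u" by auto
  then have "inverse u = cnj u"
    using complex_norm_square[of u] by (intro inverse_unique) simp
  then have "y = complex_of_real (2 * Re u)" using u by (simp add: complex_add_cnj)
  moreover have "\<bar>Re u\<bar> \<le> 1" using abs_Re_le_cmod[of u] u by simp
  ultimately show "y \<in> real_segment" by (auto simp: abs_le_iff intro!: image_eqI[of _ _ "2 * Re u"])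
qed

lemma compact_real_segment: "compact real_segment"
  by (intro compact_continuous_image continuous_intros) auto

text \<open>The polynomial \<open>u^n R(u + 1/u)\<close>, spelled out termwise from
  \<open>u (u + 1/u) = 1 + u^2\<close>. Lifting moves problems on the segment to the circle, where
  the quadrature formula lives.\<close>

definition joukowski_lift :: "nat \<Rightarrow> complex poly \<Rightarrow> complex poly" where
  "joukowski_lift n R = (\<Sum>k\<le>n. smult (coeff R k) (monom 1 (n - k) * [:1, 0, 1:] ^ k))"

lemma monic_of_degree_monom: "monic_of_degree n (monom 1 n)"
  by (simp add: monic_of_degree_def degree_monom_eq)

lemma joukowski_lift:
  assumes R: "monic_of_degree n R"
  shows "monic_of_degree (2 * n) (joukowski_lift n R)"
    and "poly (joukowski_lift n R) 0 = 1"
    and "u \<noteq> 0 \<Longrightarrow> poly (joukowski_lift n R) u = u ^ n * poly R (u + inverse u)"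
proof -
  have mon: "monic_of_degree (n - k + 2 * k) (monom 1 (n - k) * [:1, 0, 1:] ^ k)" for k
    by (intro monic_of_degree_mult monic_of_degree_monom monic_of_degree_power)
      (simp add: monic_of_degree_def)
  show "monic_of_degree (2 * n) (joukowski_lift n R)"
  proof (rule monic_of_degreeI)
    show "degree (joukowski_lift n R) \<le> 2 * n"
      unfolding joukowski_lift_def
    proof (intro degree_sum_le)
      fix k assume "k \<in> {..n}"
      then show "degree (smult (coeff R k) (monom 1 (n - k) * [:1, 0, 1:] ^ k)) \<le> 2 * n"
        using mon[of k] by (intro order.trans[OF degree_smult_le]) (auto simp: monic_of_degree_def)
    qed simp
    have "coeff (monom 1 (n - k) * [:1, 0, 1:] ^ k) (2 * n) = (if k = n then 1 else 0 :: complex)" if "k \<le> n" for k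
      using mon[of k] that by (auto simp: monic_of_degree_iff mult_2 intro!: coeff_eq_0)
    then have "coeff (joukowski_lift n R) (2 * n) = (\<Sum>k\<le>n. if k = n then coeff R k else 0)"
      unfolding joukowski_lift_def coeff_sum coeff_smult by (intro sum.cong) auto
    then show "coeff (joukowski_lift n R) (2 * n) = 1"
      using R by (simp add: monic_of_degree_iff)
  qed
  have "poly (joukowski_lift n R) 0 = (\<Sum>k\<le>n. if k = n then coeff R k else 0)"
    unfolding joukowski_lift_def poly_sum by (intro sum.cong) (auto simp: poly_monom)
  then show "poly (joukowski_lift n R) 0 = 1" using R by (simp add: monic_of_degree_iff)
  assume u: "u \<noteq> 0"
  have "poly (joukowski_lift n R) u = (\<Sum>k\<le>n. coeff R k * (u ^ n * (u + inverse u) ^ k))"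
    unfolding joukowski_lift_def poly_sum
  proof (intro sum.cong refl)
    fix k assume "k \<in> {..n}"
    then have "u ^ n = u ^ (n - k) * u ^ k" by (simp flip: power_add)
    moreover have "1 + u * u = u * (u + inverse u)" using u by (simp add: field_simps)
    ultimately show "poly (smult (coeff R k) (monom 1 (n - k) * [:1, 0, 1:] ^ k)) u
        = coeff R k * (u ^ n * (u + inverse u) ^ k)"
      by (simp add: poly_monom power_mult_distrib mult_ac)
  qed
  also have "\<dots> = u ^ n * poly R (u + inverse u)"
    using R by (simp add: poly_altdef monic_of_degree_def sum_distrib_left mult_ac)
  finally show "poly (joukowski_lift n R) u = u ^ n * poly R (u + inverse u)" .
qed

text \<open>Only the constant and the leading coefficient survive averaging over the
  \<open>N\<close>-th roots of unity. Here it is the quadrature formula for \<open>u^N - 1\<close>,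
  whose weights are all \<open>1/N\<close>.\<close>

lemma sum_roots_of_unity_monic:
  assumes "N > 0" "monic_of_degree N F" "poly F 0 = c"
  shows "(\<Sum>u | u ^ N = 1. poly F u) = of_nat N * (1 + c)"
proof -
  define A where "A = {u::complex. u ^ N = 1}"
  have A: "finite A" "card A = N" "0 \<notin> A"
    using assms(1) card_roots_unity_eq[of N] finite_roots_unity[of N] by (auto simp: A_def power_0_left)
  define p :: "complex poly" where "p = monom 1 N - 1"
  have p: "monic_of_degree N p"
    using monic_of_degree_add[OF monic_of_degree_monom, of "-1" N] assms(1) by (simp add: p_def)
  have pA: "nodal_poly A = p"
    using p A monic_of_degree_nodal_poly[of A]
    by (intro poly_eqI_degree_lead_coeff[where n = N and A = A])
      (auto simp: monic_of_degree_def poly_nodal_poly A_def p_def poly_monom)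
  have "u * poly (pderiv p) u = of_nat N" if "u \<in> A" for u
    using that assms(1) power_minus_mult[OF assms(1), of u]
    by (simp add: p_def A_def pderiv_diff pderiv_monom poly_monom mult.commute mult.left_commute)
  then have "(\<Sum>u\<in>A. poly F u / (u * poly (pderiv (nodal_poly A)) u)) = (\<Sum>u\<in>A. poly F u) / of_nat N"
    unfolding pA sum_divide_distrib by (intro sum.cong) auto
  then have "(\<Sum>u\<in>A. poly F u) / of_nat N = 1 - c / (-1)"
    using nodal_quadrature[OF A(1,3), of F] assms A by (simp add: pA p_def poly_monom power_0_left)
  then show ?thesis using assms(1) by (simp add: A_def field_simps)
qed

text \<open>At the \<open>2N\<close>-th roots of unity \<open>u^N\<close> is alternately 1 and -1,
  so the sum is that of the lift of \<open>S\<close>, whose constant and leading coefficients are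
  both 1. The indices \<open>j\<close> and \<open>2N - j\<close> give the same node.\<close>

lemma alternating_sum_chebyshev_nodes:
  fixes S :: "complex poly" and N :: nat
  assumes "N > 0" "monic_of_degree N S"
  shows "(\<Sum>j<2 * N. (-1) ^ j * poly S (of_real (2 * cos (pi * j / N)))) = of_nat (4 * N)"
proof -
  let ?F = "joukowski_lift N S"
  have "of_nat (4 * N) = (\<Sum>u | u ^ (2 * N) = 1. poly ?F u)"
    using sum_roots_of_unity_monic[OF _ joukowski_lift(1,2)[OF assms(2)]] assms(1) by simp
  also have "\<dots> = (\<Sum>j<2 * N. poly ?F (cis (2 * pi * real j / real (2 * N))))"
    using assms(1) sum.reindex_bij_betw[OF Complex.bij_betw_roots_unity[of "2 * N"], of "poly ?F"]
    by simp
  also have "\<dots> = (\<Sum>j<2 * N. (-1) ^ j * poly S (of_real (2 * cos (pi * j / N))))"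
  proof (intro sum.cong refl)
    fix j :: nat
    define u where "u = cis (pi * j / N)"
    have "2 * pi * real j / real (2 * N) = pi * j / N" by simp
    moreover have "u ^ N = (-1) ^ j"
    proof -
      have "u ^ N = cis (real N * (pi * j / N))" unfolding u_def by (rule Complex.DeMoivre)
      also have "\<dots> = cis (real j * pi)" using assms(1) by (simp add: mult.commute)
      also have "\<dots> = cis pi ^ j" by (rule Complex.DeMoivre[symmetric])
      finally show ?thesis by simp
    qed
    moreover have "u + inverse u = of_real (2 * cos (pi * j / N))"
      by (intro complex_eqI) (simp_all add: u_def cis_inverse)
    moreover have "u \<noteq> 0" by (simp add: u_def)
    ultimately show "poly ?F (cis (2 * pi * real j / real (2 * N))) = (-1) ^ j * poly S (of_real (2 * cos (pi * j / N)))"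
      using joukowski_lift(3)[OF assms(2), of u] by (simp add: u_def)
  qed
  finally show ?thesis by simp
qed

section \<open>Reduction to a weighted problem on the segment\<close>

definition quadratic_preimage :: "complex \<Rightarrow> complex \<Rightarrow> complex set" where
  "quadratic_preimage a c = {z. (z + a / 2)\<^sup>2 + c \<in> real_segment}"

lemma ex_quadratic_preimage:
  assumes "y \<in> real_segment"
  obtains w where "w\<^sup>2 + c = y" "w - a / 2 \<in> quadratic_preimage a c" "- w - a / 2 \<in> quadratic_preimage a c"
  using assms that[of "csqrt (y - c)"] by (simp add: quadratic_preimage_def)

lemma compact_quadratic_preimage: "compact (quadratic_preimage a c)"
proof -
  have "closed (quadratic_preimage a c)"
    unfolding quadratic_preimage_def
    using continuous_closed_vimage[OF compact_imp_closed[OF compact_real_segment], of "\<lambda>z. (z + a / 2)\<^sup>2 + c"]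
    by (auto simp: vimage_def intro!: continuous_intros)
  moreover have "cmod z \<le> sqrt (2 + cmod c) + cmod (a / 2)" if "z \<in> quadratic_preimage a c" for z
  proof -
    have "(cmod (z + a / 2))\<^sup>2 = cmod ((z + a / 2)\<^sup>2 + c - c)" by (simp add: norm_power)
    also have "\<dots> \<le> cmod ((z + a / 2)\<^sup>2 + c) + cmod c" by (rule norm_triangle_ineq4)
    also have "\<dots> \<le> 2 + cmod c" using that by (auto simp: quadratic_preimage_def)
    finally have "cmod (z + a / 2) \<le> sqrt (2 + cmod c)" by (rule real_le_rsqrt)
    then show ?thesis using norm_triangle_ineq4[of "z + a / 2" "a / 2"] by simp
  qed
  then have "bounded (quadratic_preimage a c)" by (auto simp: bounded_iff)
  ultimately show ?thesis by (simp add: compact_eq_bounded_closed)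
qed

lemma infinite_quadratic_preimage: "infinite (quadratic_preimage a c)"
proof
  assume "finite (quadratic_preimage a c)"
  then have "finite ((\<lambda>z. (z + a / 2)\<^sup>2 + c) ` quadratic_preimage a c)" by (rule finite_imageI)
  moreover have "real_segment \<subseteq> (\<lambda>z. (z + a / 2)\<^sup>2 + c) ` quadratic_preimage a c"
  proof
    fix y assume "y \<in> real_segment"
    then obtain w where "w\<^sup>2 + c = y" "w - a / 2 \<in> quadratic_preimage a c"
      using ex_quadratic_preimage[of y c a] by auto
    then show "y \<in> (\<lambda>z. (z + a / 2)\<^sup>2 + c) ` quadratic_preimage a c"
      by (intro image_eqI[of _ _ "w - a / 2"]) auto
  qed
  ultimately have "finite real_segment" by (rule rev_finite_subset)
  then have "finite {-2..2::real}" by (rule finite_imageD) (simp add: inj_on_def)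
  then show False using infinite_Icc[of "-2" "2::real"] by simp
qed

text \<open>For \<open>e = 0\<close> or 1, the even or odd part of \<open>Q\<close> is
  \<open>w^e\<close> times this polynomial in \<open>w^2\<close>.\<close>

definition parity_part :: "nat \<Rightarrow> nat \<Rightarrow> complex poly \<Rightarrow> complex poly" where
  "parity_part e n Q = (\<Sum>k\<le>n. monom (coeff Q (2 * k + e)) k)"

lemma coeff_parity_part: "coeff (parity_part e n Q) k = (if k \<le> n then coeff Q (2 * k + e) else 0)"
  by (auto simp: parity_part_def coeff_sum)

lemma monic_of_degree_parity_part:
  assumes "monic_of_degree (2 * n + e) Q"
  shows "monic_of_degree n (parity_part e n Q)"
proof (rule monic_of_degreeI)
  show "degree (parity_part e n Q) \<le> n"
    unfolding parity_part_def by (intro degree_sum_le) (auto intro: order.trans[OF degree_monom_le])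
  show "coeff (parity_part e n Q) n = 1"
    using assms by (simp add: coeff_parity_part monic_of_degree_iff)
qed

lemma poly_parity_part:
  assumes "degree Q \<le> 2 * n + e" "e \<le> 1"
  shows "poly Q w + (-1) ^ e * poly Q (- w) = 2 * w ^ e * poly (parity_part e n Q) (w\<^sup>2)"
proof -
  have split: "(\<Sum>i\<le>Suc (2 * n). f i) = (\<Sum>k\<le>n. f (2 * k) + f (2 * k + 1))" for f :: "nat \<Rightarrow> complex"
    by (induction n) auto
  have Q: "poly Q w = (\<Sum>i\<le>Suc (2 * n). coeff Q i * w ^ i)" for w
    unfolding poly_altdef using assms
    by (intro sum.mono_neutral_left) (auto simp: coeff_eq_0)
  have "poly Q w + (-1) ^ e * poly Q (- w)
      = (\<Sum>k\<le>n. (1 + (-1) ^ e) * (coeff Q (2 * k) * w ^ (2 * k)) + (1 - (-1) ^ e) * (coeff Q (2 * k + 1) * w ^ (2 * k + 1)))"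
    unfolding Q split sum_distrib_left sum.distrib[symmetric]
    by (intro sum.cong refl) (simp add: algebra_simps)
  also have "\<dots> = (\<Sum>k\<le>n. 2 * w ^ e * (coeff Q (2 * k + e) * (w\<^sup>2) ^ k))"
    using assms(2) by (intro sum.cong refl) (auto simp: le_Suc_eq power_mult[symmetric])
  also have "\<dots> = 2 * w ^ e * poly (parity_part e n Q) (w\<^sup>2)"
    by (simp add: parity_part_def poly_sum poly_monom sum_distrib_left)
  finally show ?thesis .
qed

text \<open>The competitor is \<open>R(P z) (z + a/2)^e\<close>; with \<open>y = P z\<close> the
  linear factor has modulus \<open>sqrt (cmod (y - c))\<close>, which is the origin of the
  weight.\<close>

lemma norm_chebyshev_quadratic_preimage_le:
  assumes R: "monic_of_degree n R"
    and le: "\<And>y. y \<in> real_segment \<Longrightarrow> sqrt (cmod (y - c)) ^ e * cmod (poly R y) \<le> M"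
  shows "sup_norm (quadratic_preimage a c) (chebyshev_poly (quadratic_preimage a c) (2 * n + e)) \<le> M"
proof -
  let ?E = "quadratic_preimage a c"
  define P where "P = [:a / 2, 1:]\<^sup>2 + [:c:]"
  have lin: "monic_of_degree 1 [:a / 2, 1:]" by (simp add: monic_of_degree_def)
  have P: "monic_of_degree 2 P"
    unfolding P_def using monic_of_degree_power[OF lin, of 2] by (intro monic_of_degree_add) auto
  have "monic_of_degree (n * 2 + 1 * e) (pcompose R P * [:a / 2, 1:] ^ e)"
    by (intro monic_of_degree_mult monic_of_degree_pcompose R P monic_of_degree_power lin) simp
  then have "sup_norm ?E (chebyshev_poly ?E (2 * n + e)) \<le> sup_norm ?E (pcompose R P * [:a / 2, 1:] ^ e)"
    using chebyshev_poly_minimal(2)[OF compact_quadratic_preimage infinite_quadratic_preimage]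
    by (simp add: mult.commute)
  also have "\<dots> \<le> M"
  proof (rule sup_norm_le)
    show "?E \<noteq> {}" using infinite_quadratic_preimage[of a c] by auto
    fix z assume z: "z \<in> ?E"
    define y where "y = (z + a / 2)\<^sup>2 + c"
    have y: "y \<in> real_segment" "poly P z = y"
      using z by (simp_all add: quadratic_preimage_def y_def P_def power2_eq_square algebra_simps)
    have "sqrt (cmod (y - c)) = cmod (z + a / 2)" by (simp add: y_def norm_power)
    then have "cmod (poly (pcompose R P * [:a / 2, 1:] ^ e) z) = sqrt (cmod (y - c)) ^ e * cmod (poly R y)"
      by (simp add: poly_pcompose y norm_mult norm_power add.commute mult.commute)
    then show "cmod (poly (pcompose R P * [:a / 2, 1:] ^ e) z) \<le> M" using le[OF y(1)] by simp
  qed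
  finally show ?thesis .
qed

text \<open>The even or odd part of the centred Chebyshev polynomial is half a sum of two of its
  values on \<open>E\<close> up to sign, so passing to it does not increase the norm. Its polynomial
  in \<open>y\<close> is the \<open>R\<close> to which the hypothesis is applied, with
  \<open>M\<close> the norm itself.\<close>

lemma norm_chebyshev_quadratic_preimage_ge:
  assumes e: "e \<le> 1"
    and le: "\<And>R M. monic_of_degree n R \<Longrightarrow>
      (\<And>y. y \<in> real_segment \<Longrightarrow> sqrt (cmod (y - c)) ^ e * cmod (poly R y) \<le> M) \<Longrightarrow> L \<le> M"
  shows "L \<le> sup_norm (quadratic_preimage a c) (chebyshev_poly (quadratic_preimage a c) (2 * n + e))"
proof -
  let ?E = "quadratic_preimage a c"
  define T where "T = chebyshev_poly ?E (2 * n + e)"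
  define Q where "Q = pcompose T [:- a / 2, 1:]"
  define R where "R = pcompose (parity_part e n Q) [:- c, 1:]"
  have T: "monic_of_degree (2 * n + e) T"
    unfolding T_def by (intro chebyshev_poly_minimal(1) compact_quadratic_preimage infinite_quadratic_preimage)
  have Q: "monic_of_degree (2 * n + e) Q"
    using monic_of_degree_pcompose[OF T, of 1 "[:- a / 2, 1:]"] by (simp add: Q_def monic_of_degree_iff)
  have R: "monic_of_degree n R"
    using monic_of_degree_pcompose[OF monic_of_degree_parity_part[OF Q], of 1 "[:- c, 1:]"]
    by (simp add: R_def monic_of_degree_iff)
  have "L \<le> sup_norm ?E T"
  proof (rule le[OF R])
    fix y assume y: "y \<in> real_segment"
    then obtain w where w: "w\<^sup>2 + c = y" "w - a / 2 \<in> ?E" "- w - a / 2 \<in> ?E"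
      by (rule ex_quadratic_preimage)
    have wy: "y - c = w\<^sup>2" using w(1) by auto
    have "2 * w ^ e * poly R y = poly Q w + (-1) ^ e * poly Q (- w)"
      using poly_parity_part[of Q n e w] Q e by (simp add: R_def poly_pcompose wy monic_of_degree_def)
    also have "\<dots> = poly T (w - a / 2) + (-1) ^ e * poly T (- w - a / 2)"
      by (simp add: Q_def poly_pcompose minus_diff_commute[of w])
    finally have "2 * (cmod w ^ e * cmod (poly R y)) = cmod (poly T (w - a / 2) + (-1) ^ e * poly T (- w - a / 2))"
      by (metis mult.assoc norm_mult norm_numeral norm_power)
    also have "\<dots> \<le> cmod (poly T (w - a / 2)) + cmod (poly T (- w - a / 2))"
      by (rule order.trans[OF norm_triangle_ineq]) (simp add: norm_mult norm_power)
    also have "\<dots> \<le> sup_norm ?E T + sup_norm ?E T"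
      by (intro add_mono norm_poly_le_sup_norm compact_quadratic_preimage w)
    finally show "sqrt (cmod (y - c)) ^ e * cmod (poly R y) \<le> sup_norm ?E T"
      by (simp add: wy norm_power)
  qed
  then show ?thesis by (simp add: T_def)
qed

lemma segment_lower_bound:
  assumes "n > 0" "monic_of_degree n R" "\<And>y. y \<in> real_segment \<Longrightarrow> cmod (poly R y) \<le> M"
  shows "2 \<le> M"
proof (rule weighted_chebyshev_lower_bound[where h = 1 and n = n])
  show "monic_of_degree (2 * n) (joukowski_lift n R)" "poly (joukowski_lift n R) 0 = 1"
    using joukowski_lift[OF assms(2)] by auto
  fix u :: complex assume u: "cmod u = 1"
  then have "u \<noteq> 0" by auto
  moreover have "u + inverse u \<in> real_segment" using u real_segment_iff_circle by blast
  ultimately show "cmod (poly (joukowski_lift n R) u) \<le> M * cmod (poly 1 u)"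
    using joukowski_lift(3)[OF assms(2), of u] assms(3)[of "u + inverse u"] u
    by (simp add: norm_mult norm_power)
qed (use assms in \<open>auto simp: pderiv_1\<close>)

lemma norm_even_chebyshev_quadratic_preimage:
  assumes "n > 0"
  shows "sup_norm (quadratic_preimage a c) (chebyshev_poly (quadratic_preimage a c) (2 * n)) = 2"
proof (rule antisym)
  have "cmod (poly (dickson n) y) \<le> 2" if "y \<in> real_segment" for y
  proof -
    obtain u where u: "cmod u = 1" "y = u + inverse u"
      using \<open>y \<in> real_segment\<close> real_segment_iff_circle by auto
    then have "u \<noteq> 0" by auto
    then have "cmod (poly (dickson n) y) \<le> cmod (u ^ n) + cmod (inverse u ^ n)"
      unfolding u(2) poly_dickson[OF \<open>u \<noteq> 0\<close>] by (intro norm_triangle_ineq)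
    then show ?thesis using u by (simp add: norm_power norm_inverse)
  qed
  then show "sup_norm (quadratic_preimage a c) (chebyshev_poly (quadratic_preimage a c) (2 * n)) \<le> 2"
    using norm_chebyshev_quadratic_preimage_le[OF monic_of_degree_dickson[OF assms], of c 0 2 a] by simp
  show "2 \<le> sup_norm (quadratic_preimage a c) (chebyshev_poly (quadratic_preimage a c) (2 * n))"
    using norm_chebyshev_quadratic_preimage_ge[of 0 n c 2 a] segment_lower_bound[OF assms] by simp
qed

section \<open>Asymptotics for odd degrees\<close>

text \<open>On the circle \<open>1 - s/u\<close> is the conjugate of \<open>1 - cnj s * u\<close>.
  Trading one for the other turns the weight into the modulus of a polynomial in \<open>u\<close>
  with real coefficients, which for \<open>|s| \<le> 1\<close> has no zeros in the open
  disc.\<close>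

lemma norm_circle_diff:
  assumes "s \<noteq> 0" "cmod u = 1"
  shows "cmod (u + inverse u - (s + inverse s)) = cmod ((1 - s * u) * (1 - cnj s * u)) / cmod s"
proof -
  have u: "u \<noteq> 0" "inverse u = cnj u"
    using assms(2) complex_norm_square[of u] by (auto intro!: inverse_unique)
  have "u + inverse u - (s + inverse s) = - ((1 - s * u) * (1 - s * inverse u)) / s"
    using assms(1) u(1) by (simp add: field_simps)
  moreover have "1 - s * inverse u = cnj (1 - cnj s * u)" by (simp add: u(2))
  then have "cmod (1 - s * inverse u) = cmod (1 - cnj s * u)" by (metis complex_mod_cnj)
  ultimately show ?thesis by (simp add: norm_divide norm_mult)
qed

text \<open>Equality holds at \<open>z = -1\<close>, and the constant tends to 1 as \<open>r\<close>
  does. After squaring, the difference of the two sides is \<open>1 - r\<close> times an expression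
  affine in \<open>Re z\<close> and \<open>|z|^2\<close>, which is least at
  \<open>Re z = -1\<close>, \<open>|z| = 1\<close>, where it vanishes.\<close>

lemma norm_one_minus_le:
  assumes "cmod z \<le> 1" "0 \<le> r" "r \<le> 1"
  shows "cmod (1 - z) \<le> 2 / (1 + r) * cmod (1 - r * z)"
proof -
  define x q where "x = Re z" and "q = (cmod z)\<^sup>2"
  have x: "- 1 \<le> x" and q: "q \<le> 1"
    using abs_Re_le_cmod[of z] assms power_mono[of "cmod z" 1 2] by (auto simp: x_def q_def)
  have "0 \<le> (1 - r) * ((3 + r) + 2 * ((1 - r) * x) - q * (1 + 3 * r))"
  proof (rule mult_nonneg_nonneg)
    have "(1 - r) * (-1) \<le> (1 - r) * x" "q * (1 + 3 * r) \<le> 1 * (1 + 3 * r)"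
      using x q assms by (intro mult_left_mono mult_right_mono; simp)+
    moreover have "0 \<le> (3 + r) + 2 * A - B" if "(1 - r) * (-1) \<le> A" "B \<le> 1 * (1 + 3 * r)" for A B
      using that by simp
    ultimately show "0 \<le> (3 + r) + 2 * ((1 - r) * x) - q * (1 + 3 * r)" by blast
  qed (use assms in simp)
  then have *: "(1 + r)\<^sup>2 * (1 - 2 * x + q) \<le> 2\<^sup>2 * (1 - 2 * r * x + r\<^sup>2 * q)"
    by (simp add: power2_eq_square algebra_simps)
  have "(cmod (1 - z))\<^sup>2 = 1 - 2 * x + q" "(cmod (1 - r * z))\<^sup>2 = 1 - 2 * r * x + r\<^sup>2 * q"
    unfolding q_def x_def cmod_power2 by (simp_all add: power2_eq_square algebra_simps)
  then have "((1 + r) * cmod (1 - z))\<^sup>2 \<le> (2 * cmod (1 - r * z))\<^sup>2"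
    unfolding power_mult_distrib using * by simp
  then have "(1 + r) * cmod (1 - z) \<le> 2 * cmod (1 - r * z)"
    by (rule power2_le_imp_le) simp
  then show ?thesis using assms by (simp add: field_simps)
qed

section \<open>Polynomial approximation of the inverse square root of the weight\<close>

lemma binomial_series_inv_sqrt:
  assumes "cmod z < 1"
  shows "(\<lambda>k. (((-1/2) gchoose k) * (-1) ^ k) * z ^ k) sums (1 - z) powr (-1/2)"
  using gen_binomial_complex[of "-z" "-1/2"] assms by (simp add: power_minus' mult_ac)

text \<open>\<open>h(u)\<close> is \<open>p(u)\<close> times the conjugate of
  \<open>p(cnj u)\<close>, with \<open>p\<close> a partial sum of the binomial series of
  \<open>(1 - \<sigma> u)^(-1/2)\<close>; this product has real coefficients. Stating the estimate
  for \<open>h^2\<close> avoids a branch, and for \<open>\<epsilon> < 1\<close> it also excludes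
  zeros of \<open>h\<close> in the closed disc.\<close>

lemma ex_inv_sqrt_approx:
  fixes \<sigma> :: complex
  assumes \<sigma>: "cmod \<sigma> < 1" and \<epsilon>: "\<epsilon> > 0"
  obtains h :: "complex poly" where "\<And>u. poly h (cnj u) = cnj (poly h u)" "poly h 0 = 1"
    "\<And>u. cmod u \<le> 1 \<Longrightarrow> cmod ((poly h u)\<^sup>2 * ((1 - \<sigma> * u) * (1 - cnj \<sigma> * u)) - 1) \<le> \<epsilon>"
proof -
  define \<rho> where "\<rho> = cmod \<sigma>"
  define a :: "nat \<Rightarrow> complex" where "a k = ((-1/2) gchoose k) * (-1) ^ k" for k
  define f :: "complex \<Rightarrow> complex" where "f z = (1 - z) powr (-1/2)" for z
  define S where "S = cball (0 :: complex) \<rho>"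
  have S: "cmod z < 1" if "z \<in> S" for z using that \<sigma> by (simp add: S_def \<rho>_def)
  have f: "(\<lambda>k. a k * z ^ k) sums f z" if "z \<in> S" for z
    unfolding a_def f_def using binomial_series_inv_sqrt[OF S[OF that]] .
  \<comment> \<open>Convergence at a radius strictly between \<open>\<rho>\<close> and 1 gives
    absolute convergence at \<open>\<rho>\<close>, the majorant for the M-test.\<close>
  define \<rho>' where "\<rho>' = (1 + \<rho>) / 2"
  have \<rho>': "0 \<le> \<rho>" "\<rho> < \<rho>'" "\<rho>' < 1" using \<sigma> by (auto simp: \<rho>'_def \<rho>_def)
  have "summable (\<lambda>k. a k * of_real \<rho>' ^ k)"
    using binomial_series_inv_sqrt[of "of_real \<rho>'"] \<rho>' by (auto simp: a_def sums_iff)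
  then have "summable (\<lambda>k. norm (a k * of_real \<rho> ^ k))"
    by (rule powser_insidea) (use \<rho>' in simp)
  then have sm: "summable (\<lambda>k. norm (a k) * \<rho> ^ k)" using \<rho>' by (simp add: norm_mult norm_power)
  have "uniform_limit S (\<lambda>n z. \<Sum>k<n. a k * z ^ k) (\<lambda>z. \<Sum>k. a k * z ^ k) sequentially"
    by (rule Weierstrass_m_test[OF _ sm])
      (auto simp: S_def norm_mult norm_power intro!: mult_left_mono power_mono)
  then have ul: "uniform_limit S (\<lambda>n z. \<Sum>k<n. a k * z ^ k) f sequentially"
    by (rule uniform_limit_cong'[THEN iffD1, rotated 2]) (auto simp: sums_unique[OF f])
  have Re: "Re z < 1" if "z \<in> S" for z
    using S[OF that] abs_Re_le_cmod[of z] by auto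
  have cf: "continuous_on S f"
    unfolding f_def by (intro continuous_intros) (use Re in \<open>force+\<close>)
  have bdd: "bounded (g ` S)" if "continuous_on S g" for g :: "complex \<Rightarrow> complex"
    by (intro compact_imp_bounded compact_continuous_image that) (simp add: S_def)
  have "uniform_limit S (\<lambda>n z. (\<Sum>k<n. a k * z ^ k) * (\<Sum>k<n. a k * z ^ k) * (1 - z))
      (\<lambda>z. f z * f z * (1 - z)) sequentially"
    by (intro uniform_lim_mult ul uniform_limit_const bdd continuous_intros cf)
  moreover have "f z * f z * (1 - z) = 1" if "z \<in> S" for z
  proof -
    have "1 - z \<noteq> 0" using S[OF that] by auto
    then have "f z * f z = inverse (1 - z)"
      by (simp add: f_def flip: powr_add) (simp add: powr_minus)
    then show ?thesis using \<open>1 - z \<noteq> 0\<close> by simp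
  qed
  ultimately have lim: "uniform_limit S (\<lambda>n z. (\<Sum>k<n. a k * z ^ k)\<^sup>2 * (1 - z)) (\<lambda>_. 1) sequentially"
    by (subst uniform_limit_cong'[where g = "\<lambda>n z. (\<Sum>k<n. a k * z ^ k) * (\<Sum>k<n. a k * z ^ k) * (1 - z)"
          and i = "\<lambda>z. f z * f z * (1 - z)"]) (auto simp: power2_eq_square)
  \<comment> \<open>The product estimate below has the three terms \<open>(X - 1) (Y - 1)\<close>,
    \<open>X - 1\<close> and \<open>Y - 1\<close>; with \<open>\<epsilon>' \<le> 1\<close> each is
    at most \<open>\<epsilon>'\<close>.\<close>
  define \<epsilon>' where "\<epsilon>' = min 1 (\<epsilon> / 3)"
  have \<epsilon>': "\<epsilon>' > 0" "\<epsilon>' \<le> 1" "3 * \<epsilon>' \<le> \<epsilon>" using \<epsilon> by (auto simp: \<epsilon>'_def)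
  \<comment> \<open>The condition \<open>n > 0\<close> keeps the constant term 1 in the partial sum,
    whence \<open>poly h 0 = 1\<close>.\<close>
  have "\<forall>\<^sub>F n in sequentially. n > 0 \<and> (\<forall>z\<in>S. dist ((\<Sum>k<n. a k * z ^ k)\<^sup>2 * (1 - z)) 1 < \<epsilon>')"
    using eventually_gt_at_top[of "0 :: nat"] uniform_limitD[OF lim \<epsilon>'(1)] by eventually_elim auto
  then obtain n where n: "n > 0" "\<And>z. z \<in> S \<Longrightarrow> dist ((\<Sum>k<n. a k * z ^ k)\<^sup>2 * (1 - z)) 1 < \<epsilon>'"
    by (auto simp: eventually_at_top_linorder)
  define p where "p = (\<Sum>k<n. monom (a k * \<sigma> ^ k) k)"
  have p: "poly p u = (\<Sum>k<n. a k * (\<sigma> * u) ^ k)" for u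
    by (simp add: p_def poly_sum poly_monom power_mult_distrib mult_ac)
  have mem: "\<sigma> * u \<in> S" if "cmod u \<le> 1" for u
    using that by (simp add: S_def \<rho>_def norm_mult mult_left_le)
  have p1: "cmod ((poly p u)\<^sup>2 * (1 - \<sigma> * u) - 1) \<le> \<epsilon>'" if "cmod u \<le> 1" for u
    using n(2)[OF mem[OF that]] by (simp add: p dist_norm)
  show ?thesis
  proof (rule that[of "p * map_poly cnj p"])
    show "poly (p * map_poly cnj p) (cnj u) = cnj (poly (p * map_poly cnj p) u)" for u
      by (simp add: mult.commute)
    have "poly p 0 = (\<Sum>k<n. if k = 0 then 1 else 0)"
      unfolding p by (intro sum.cong) (auto simp: a_def)
    then have "poly p 0 = 1" using n(1) by simp
    then show "poly (p * map_poly cnj p) 0 = 1" by simp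
    fix u :: complex assume u: "cmod u \<le> 1"
    define X Y where "X = (poly p u)\<^sup>2 * (1 - \<sigma> * u)"
      and "Y = cnj ((poly p (cnj u))\<^sup>2 * (1 - \<sigma> * cnj u))"
    have X: "cmod (X - 1) \<le> \<epsilon>'" using p1[OF u] by (simp add: X_def)
    have "cmod (Y - 1) = cmod (cnj ((poly p (cnj u))\<^sup>2 * (1 - \<sigma> * cnj u) - 1))"
      by (simp add: Y_def)
    also have "\<dots> \<le> \<epsilon>'" using p1[of "cnj u"] u by (simp only: complex_mod_cnj)
    finally have Y: "cmod (Y - 1) \<le> \<epsilon>'" .
    have "(poly (p * map_poly cnj p) u)\<^sup>2 * ((1 - \<sigma> * u) * (1 - cnj \<sigma> * u)) - 1 = X * Y - 1"
      by (simp add: X_def Y_def power_mult_distrib mult_ac)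
    also have "\<dots> = (X - 1) * (Y - 1) + (X - 1) + (Y - 1)" by (simp add: algebra_simps)
    also have "cmod \<dots> \<le> cmod (X - 1) * cmod (Y - 1) + cmod (X - 1) + cmod (Y - 1)"
      using norm_triangle_ineq[of "(X - 1) * (Y - 1) + (X - 1)" "Y - 1"]
        norm_triangle_ineq[of "(X - 1) * (Y - 1)" "X - 1"] by (simp add: norm_mult)
    also have "\<dots> \<le> \<epsilon>' * 1 + \<epsilon>' + \<epsilon>'"
      using X Y \<epsilon>' by (intro add_mono mult_mono) auto
    also have "\<dots> \<le> \<epsilon>" using \<epsilon>' by simp
    finally show "cmod ((poly (p * map_poly cnj p) u)\<^sup>2 * ((1 - \<sigma> * u) * (1 - cnj \<sigma> * u)) - 1) \<le> \<epsilon>" .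
  qed
qed

text \<open>\<open>R(u + 1/u) = u\<^sup>n h(1/u) + u\<^sup>-\<^sup>n h(u)\<close>, Bernstein's extremal polynomial for the weight \<open>1/\<bar>h\<bar>\<close>.\<close>

lemma ex_bernstein_poly:
  assumes h: "\<And>u. poly h (cnj u) = cnj (poly h u)" "poly h 0 = 1" and n: "degree h < n"
  obtains R where "monic_of_degree n R"
    "\<And>u. cmod u = 1 \<Longrightarrow> cmod (poly R (u + inverse u)) \<le> 2 * cmod (poly h u)"
proof -
  define R where "R = (\<Sum>k\<le>degree h. smult (coeff h k) (dickson (n - k)))"
  have "monic_of_degree n R"
  proof (rule monic_of_degreeI)
    have mon: "monic_of_degree (n - k) (dickson (n - k))" if "k \<le> degree h" for k
      using that n by (intro monic_of_degree_dickson) auto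
    show "degree R \<le> n"
      unfolding R_def using mon
      by (intro degree_sum_le) (auto intro!: order.trans[OF degree_smult_le] simp: monic_of_degree_def)
    have "coeff (dickson (n - k)) n = (if k = 0 then 1 else 0)" if "k \<le> degree h" for k
      using mon[OF that] that n by (auto simp: monic_of_degree_iff intro!: coeff_eq_0)
    then have "coeff R n = (\<Sum>k\<le>degree h. if k = 0 then coeff h 0 else 0)"
      unfolding R_def coeff_sum coeff_smult by (intro sum.cong) auto
    then show "coeff R n = 1" using h(2) by (simp add: poly_0_coeff_0)
  qed
  moreover have "cmod (poly R (u + inverse u)) \<le> 2 * cmod (poly h u)" if u: "cmod u = 1" for u
  proof -
    have u0: "u \<noteq> 0" using u by auto
    have "poly R (u + inverse u) = (\<Sum>k\<le>degree h. coeff h k * (u ^ (n - k) + inverse u ^ (n - k)))"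
      by (simp add: R_def poly_sum poly_dickson[OF u0])
    also have "\<dots> = (\<Sum>k\<le>degree h. u ^ n * (coeff h k * inverse u ^ k) + inverse u ^ n * (coeff h k * u ^ k))"
    proof (intro sum.cong refl)
      fix k assume "k \<in> {..degree h}"
      then have "u ^ n = u ^ (n - k) * u ^ k" "inverse u ^ n = inverse u ^ (n - k) * inverse u ^ k"
        using n by (simp_all flip: power_add)
      then show "coeff h k * (u ^ (n - k) + inverse u ^ (n - k))
          = u ^ n * (coeff h k * inverse u ^ k) + inverse u ^ n * (coeff h k * u ^ k)"
        using u0 by (simp add: field_simps)
    qed
    also have "\<dots> = u ^ n * poly h (inverse u) + inverse u ^ n * poly h u"
      by (simp add: poly_altdef sum.distrib sum_distrib_left)
    also have "cmod \<dots> \<le> cmod (u ^ n * poly h (inverse u)) + cmod (inverse u ^ n * poly h u)"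
      by (rule norm_triangle_ineq)
    also have "\<dots> = 2 * cmod (poly h u)"
      using u poly_cnj_inverse[OF h(1) u] by (simp add: norm_mult norm_power norm_inverse)
    finally show ?thesis .
  qed
  ultimately show ?thesis using that by blast
qed

text \<open>Approximating for \<open>r s\<close> instead of \<open>s\<close> keeps the singularities
  off the closed disc even if \<open>|s| = 1\<close>. Each of the two linear factors of the weight
  then costs \<open>2/(1 + r)\<close>, and the 4 is the square of the 2 in Bernstein's
  bound.\<close>

lemma odd_chebyshev_upper:
  assumes s: "s \<noteq> 0" "cmod s \<le> 1" and r: "0 < r" "r < 1" and \<epsilon>: "\<epsilon> > 0"
    and c: "c = s + inverse s"
  shows "\<forall>\<^sub>F n in sequentially.
    sup_norm (quadratic_preimage a c) (chebyshev_poly (quadratic_preimage a c) (2 * n + 1))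
      \<le> sqrt (4 / cmod s * (2 / (1 + r))\<^sup>2 * (1 + \<epsilon>))"
proof -
  have "r * cmod s \<le> r * 1" using s r by (intro mult_left_mono) auto
  then have "r * cmod s < 1" using r by linarith
  then have "cmod (r * s) < 1" using r by (simp add: norm_mult)
  then obtain h where h: "\<And>u. poly h (cnj u) = cnj (poly h u)" "poly h 0 = 1"
    "\<And>u. cmod u \<le> 1 \<Longrightarrow> cmod ((poly h u)\<^sup>2 * ((1 - r * s * u) * (1 - cnj (r * s) * u)) - 1) \<le> \<epsilon>"
    using ex_inv_sqrt_approx[OF _ \<epsilon>] by metis
  have bound: "sup_norm (quadratic_preimage a c) (chebyshev_poly (quadratic_preimage a c) (2 * n + 1))
      \<le> sqrt (4 / cmod s * (2 / (1 + r))\<^sup>2 * (1 + \<epsilon>))" if n: "degree h < n" for n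
  proof -
    obtain R where R: "monic_of_degree n R"
      "\<And>u. cmod u = 1 \<Longrightarrow> cmod (poly R (u + inverse u)) \<le> 2 * cmod (poly h u)"
      using ex_bernstein_poly[OF h(1,2) n] by metis
    show ?thesis
    proof (rule norm_chebyshev_quadratic_preimage_le[OF R(1)])
      fix y assume "y \<in> real_segment"
      then obtain u where u: "cmod u = 1" "y = u + inverse u" using real_segment_iff_circle by auto
      define X where "X = cmod ((poly h u)\<^sup>2 * ((1 - r * s * u) * (1 - cnj (r * s) * u)))"
      have X: "X \<le> 1 + \<epsilon>"
        unfolding X_def using h(3)[of u] u
          norm_triangle_sub[of "(poly h u)\<^sup>2 * ((1 - r * s * u) * (1 - cnj (r * s) * u))" 1] by simp
      have "cmod (1 - s * u) \<le> 2 / (1 + r) * cmod (1 - r * (s * u))"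
        "cmod (1 - cnj s * u) \<le> 2 / (1 + r) * cmod (1 - r * (cnj s * u))"
        using s r u by (intro norm_one_minus_le; simp add: norm_mult)+
      then have "cmod ((1 - s * u) * (1 - cnj s * u))
          \<le> (2 / (1 + r) * cmod (1 - r * (s * u))) * (2 / (1 + r) * cmod (1 - r * (cnj s * u)))"
        unfolding norm_mult using r by (intro mult_mono) auto
      also have "\<dots> = (2 / (1 + r))\<^sup>2 * cmod ((1 - r * s * u) * (1 - cnj (r * s) * u))"
        by (simp add: norm_mult power2_eq_square mult_ac)
      finally have g: "cmod ((1 - s * u) * (1 - cnj s * u))
          \<le> (2 / (1 + r))\<^sup>2 * cmod ((1 - r * s * u) * (1 - cnj (r * s) * u))" .
      have "(sqrt (cmod (y - c)) * cmod (poly R y))\<^sup>2 = cmod ((1 - s * u) * (1 - cnj s * u)) / cmod s * (cmod (poly R y))\<^sup>2"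
        unfolding u(2) c power_mult_distrib norm_circle_diff[OF s(1) u(1)] by simp
      also have "\<dots> \<le> (2 / (1 + r))\<^sup>2 * cmod ((1 - r * s * u) * (1 - cnj (r * s) * u)) / cmod s * (2 * cmod (poly h u))\<^sup>2"
        using R(2)[OF u(1)] u(2) g by (intro mult_mono power_mono divide_right_mono) auto
      also have "\<dots> = 4 / cmod s * (2 / (1 + r))\<^sup>2 * X"
        by (simp add: X_def norm_mult norm_power power_mult_distrib)
      also have "\<dots> \<le> 4 / cmod s * (2 / (1 + r))\<^sup>2 * (1 + \<epsilon>)"
        using X by (intro mult_left_mono) auto
      finally show "sqrt (cmod (y - c)) ^ 1 * cmod (poly R y) \<le> sqrt (4 / cmod s * (2 / (1 + r))\<^sup>2 * (1 + \<epsilon>))"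
        by (simp add: real_le_rsqrt)
    qed
  qed
  show ?thesis by (rule eventually_mono[OF eventually_gt_at_top[of "degree h"]]) (rule bound)
qed

text \<open>For \<open>|s| < 1\<close> the function \<open>h\<close> approximates the weight itself
  from both sides, so a bound on the weighted \<open>R\<close> becomes a bound of its lift by a
  multiple of \<open>|h|\<close>.\<close>

lemma odd_chebyshev_lower_outside:
  assumes s: "s \<noteq> 0" "cmod s < 1" and \<epsilon>: "0 < \<epsilon>" "\<epsilon> < 1" and c: "c = s + inverse s"
  shows "\<forall>\<^sub>F n in sequentially. sqrt (4 / cmod s * (1 - \<epsilon>))
      \<le> sup_norm (quadratic_preimage a c) (chebyshev_poly (quadratic_preimage a c) (2 * n + 1))"
proof -
  obtain h where h: "\<And>u. poly h (cnj u) = cnj (poly h u)" "poly h 0 = 1"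
    "\<And>u. cmod u \<le> 1 \<Longrightarrow> cmod ((poly h u)\<^sup>2 * ((1 - s * u) * (1 - cnj s * u)) - 1) \<le> \<epsilon>"
    using ex_inv_sqrt_approx[OF s(2) \<epsilon>(1)] by metis
  have ge: "1 - \<epsilon> \<le> (cmod (poly h u))\<^sup>2 * cmod ((1 - s * u) * (1 - cnj s * u))" if "cmod u \<le> 1" for u
    using h(3)[OF that] norm_triangle_ineq2[of 1 "1 - (poly h u)\<^sup>2 * ((1 - s * u) * (1 - cnj s * u))"]
    by (simp add: norm_mult norm_power norm_minus_commute)
  have nz: "poly h u \<noteq> 0" if "cmod u \<le> 1" for u using ge[OF that] \<epsilon> by auto
  \<comment> \<open>Compactness of the circle bounds the logarithmic derivative of \<open>h\<close>,
    so the derivative condition of the quadrature bound holds for all large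
    \<open>n\<close>.\<close>
  have "compact ((\<lambda>u. cmod (u * poly (pderiv h) u / poly h u)) ` sphere 0 1)"
    using nz by (intro compact_continuous_image continuous_intros) auto
  then obtain K where K: "\<And>u. cmod u = 1 \<Longrightarrow> cmod (u * poly (pderiv h) u / poly h u) \<le> K"
    using compact_imp_bounded[THEN bounded_imp_bdd_above] by (fastforce simp: bdd_above_def)
  have bound: "sqrt (4 / cmod s * (1 - \<epsilon>))
      \<le> sup_norm (quadratic_preimage a c) (chebyshev_poly (quadratic_preimage a c) (2 * n + 1))"
    if n: "degree h < n" "K < n" for n
  proof (rule norm_chebyshev_quadratic_preimage_ge)
    fix R M assume R: "monic_of_degree n R"
      and M: "\<And>y. y \<in> real_segment \<Longrightarrow> sqrt (cmod (y - c)) ^ 1 * cmod (poly R y) \<le> M"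
    \<comment> \<open>From \<open>g / |s| * |R|^2 \<le> M^2\<close> and
      \<open>1 - \<epsilon> \<le> |h|^2 g\<close> one gets \<open>|R| \<le> L |h|\<close> with this
      constant.\<close>
    define L where "L = M * sqrt (cmod s / (1 - \<epsilon>))"
    have "2 \<le> L"
    proof (rule weighted_chebyshev_lower_bound[OF h(1) nz h(2), of n])
      show "monic_of_degree (2 * n) (joukowski_lift n R)" "poly (joukowski_lift n R) 0 = 1"
        using joukowski_lift[OF R] by auto
      fix u :: complex assume u: "cmod u = 1"
      show "cmod (u * poly (pderiv h) u / poly h u) < real n" using K[OF u] n by simp
      have u0: "u \<noteq> 0" using u by auto
      define y where "y = u + inverse u"
      have y: "y \<in> real_segment" using u real_segment_iff_circle y_def by blast
      have M0: "0 \<le> M" using M[OF y] by (rule order.trans[rotated]) simp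
      define g where "g = cmod ((1 - s * u) * (1 - cnj s * u))"
      have "1 - \<epsilon> \<le> (cmod (poly h u))\<^sup>2 * g" using ge[of u] u by (simp add: g_def)
      then have g: "g > 0" using \<epsilon> by (metis diff_gt_0_iff_gt g_def less_le_trans mult_zero_right norm_ge_zero not_le order_antisym_conv order_less_irrefl)
      have "(sqrt (cmod (y - c)) * cmod (poly R y))\<^sup>2 \<le> M\<^sup>2"
        using M[OF y] by (intro power_mono) auto
      then have "g / cmod s * (cmod (poly R y))\<^sup>2 \<le> M\<^sup>2"
        unfolding power_mult_distrib y_def c norm_circle_diff[OF s(1) u] by (simp add: g_def)
      then have "(cmod (poly R y))\<^sup>2 \<le> M\<^sup>2 * cmod s / g" using g s by (simp add: field_simps)
      also have "\<dots> \<le> M\<^sup>2 * cmod s / g * ((cmod (poly h u))\<^sup>2 * g / (1 - \<epsilon>))"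
        using \<open>1 - \<epsilon> \<le> (cmod (poly h u))\<^sup>2 * g\<close> \<epsilon> g mult_left_mono[of 1 "(cmod (poly h u))\<^sup>2 * g / (1 - \<epsilon>)" "M\<^sup>2 * cmod s / g"] by simp
      also have "\<dots> = (L * cmod (poly h u))\<^sup>2"
        using g \<epsilon> by (simp add: L_def power_mult_distrib field_simps)
      finally have "cmod (poly R y) \<le> L * cmod (poly h u)"
        by (rule power2_le_imp_le) (use M0 \<epsilon> in \<open>simp add: L_def\<close>)
      then show "cmod (poly (joukowski_lift n R) u) \<le> L * cmod (poly h u)"
        using joukowski_lift(3)[OF R u0] u by (simp add: y_def norm_mult norm_power)
    qed (use n in simp_all)
    have "4 / cmod s * (1 - \<epsilon>) \<le> M\<^sup>2"
    proof -
      have "2\<^sup>2 \<le> L\<^sup>2" using \<open>2 \<le> L\<close> by (intro power_mono) auto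
      then have "4 \<le> M\<^sup>2 * (cmod s / (1 - \<epsilon>))" using \<epsilon> by (simp add: L_def power_mult_distrib)
      then show ?thesis using \<epsilon> s by (simp add: field_simps)
    qed
    moreover have "0 \<le> M"
      using M[of 0] by (rule order.trans[rotated]) (auto intro!: image_eqI[of _ _ 0])
    ultimately show "sqrt (4 / cmod s * (1 - \<epsilon>)) \<le> M" by (rule real_le_lsqrt[rotated])
  qed simp
  have "\<forall>\<^sub>F n in sequentially. real n > K"
    using filterlim_at_top_dense[THEN iffD1, OF filterlim_real_sequentially] by blast
  from eventually_conj[OF eventually_gt_at_top[of "degree h"] this] show ?thesis
    by (rule eventually_mono) (use bound in blast)
qed

text \<open>
  If \<open>c\<close> lies on the segment, \<open>S(y) = (y - c) \<bar>R(y)\<bar>\<^sup>2\<close> has only one sign on either side of \<open>c\<close>, so that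
  about half of the terms of its alternating sum over the Chebyshev nodes are \<open>\<le> 0\<close>.
\<close>

lemma odd_chebyshev_lower_segment:
  assumes c: "c \<in> real_segment"
  shows "sqrt (4 * (2 * real n + 1) / (2 * real n + 2))
      \<le> sup_norm (quadratic_preimage a c) (chebyshev_poly (quadratic_preimage a c) (2 * n + 1))"
proof (rule norm_chebyshev_quadratic_preimage_ge)
  fix R M assume R: "monic_of_degree n R"
    and M: "\<And>y. y \<in> real_segment \<Longrightarrow> sqrt (cmod (y - c)) ^ 1 * cmod (poly R y) \<le> M"
  obtain \<gamma> where \<gamma>: "c = complex_of_real \<gamma>" using c by auto
  define N where "N = 2 * n + 1"
  define S where "S = [:- c, 1:] * (R * map_poly cnj R)"
  have "monic_of_degree n (map_poly cnj R)"
    using R by (simp add: monic_of_degree_iff degree_map_poly coeff_map_poly)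
  then have "monic_of_degree (1 + (n + n)) S"
    unfolding S_def using R by (intro monic_of_degree_mult) (simp_all add: monic_of_degree_iff)
  then have S: "monic_of_degree N S" by (simp add: N_def mult_2)
  define x where "x j = 2 * cos (pi * j / N)" for j :: nat
  define t where "t j = (x j - \<gamma>) * (cmod (poly R (of_real (x j))))\<^sup>2" for j
  have St: "poly S (of_real (x j)) = of_real (t j)" for j
    by (simp add: S_def t_def \<gamma> complex_norm_square del: of_real_power) (simp add: algebra_simps)
  have tM: "\<bar>t j\<bar> \<le> M\<^sup>2" for j
  proof -
    have "complex_of_real (x j) \<in> real_segment" by (auto simp: x_def intro!: image_eqI[of _ _ "x j"])
    from M[OF this] have "(sqrt (cmod (x j - c)) * cmod (poly R (of_real (x j))))\<^sup>2 \<le> M\<^sup>2"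
      by (intro power_mono) auto
    moreover have "cmod (x j - c) = \<bar>x j - \<gamma>\<bar>" by (simp add: \<gamma> flip: of_real_diff)
    ultimately show ?thesis by (simp add: t_def power_mult_distrib abs_mult)
  qed
  have M2: "0 \<le> M\<^sup>2" by simp
  have "complex_of_real (\<Sum>j<2 * N. (-1) ^ j * t j) = (\<Sum>j<2 * N. (-1) ^ j * poly S (of_real (x j)))"
    by (simp add: St)
  also have "\<dots> = of_real (4 * N)"
    unfolding x_def using alternating_sum_chebyshev_nodes[OF _ S] by (simp add: N_def del: sum.lessThan_Suc)
  finally have "complex_of_real (\<Sum>j<2 * N. (-1) ^ j * t j) = of_real (4 * N)" .
  then have "4 * real N = (\<Sum>j<2 * N. (-1) ^ j * t j)" by (simp only: of_real_eq_iff)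
  also have "\<dots> = (\<Sum>i<N. t (2 * i) - t (2 * i + 1))"
    by (induction N) auto
  \<comment> \<open>A difference can exceed \<open>M^2\<close> only if its first term is positive
    and its second negative, that is, if the nodes pass \<open>\<gamma>\<close> downwards within the
    pair; even then it is at most \<open>2 M^2\<close>.\<close>
  also have "\<dots> \<le> (\<Sum>i<N. M\<^sup>2 + (if x (2 * i) > \<gamma> \<and> x (2 * i + 1) < \<gamma> then M\<^sup>2 else 0))"
  proof (rule sum_mono)
    fix i
    have "x j \<le> \<gamma> \<Longrightarrow> t j \<le> 0" "x j \<ge> \<gamma> \<Longrightarrow> t j \<ge> 0" for j
      by (simp_all add: t_def mult_nonpos_nonneg)
    then show "t (2 * i) - t (2 * i + 1) \<le> M\<^sup>2 + (if x (2 * i) > \<gamma> \<and> x (2 * i + 1) < \<gamma> then M\<^sup>2 else 0)"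
      using tM[of "2 * i"] tM[of "2 * i + 1"] M2 by (smt (verit, best))
  qed
  also have "\<dots> = N * M\<^sup>2 + card {i\<in>{..<N}. x (2 * i) > \<gamma> \<and> x (2 * i + 1) < \<gamma>} * M\<^sup>2"
    by (simp add: sum.distrib flip: sum.inter_filter)
  \<comment> \<open>The nodes decrease up to index \<open>N\<close> and increase afterwards, so at
    most one pair passes \<open>\<gamma>\<close> downwards. This leaves
    \<open>4 N \<le> (N + 1) M^2\<close>.\<close>
  also have "\<dots> \<le> N * M\<^sup>2 + 1 * M\<^sup>2"
  proof (intro add_left_mono mult_right_mono M2)
    have mono: "pi * j / N \<le> pi * k / N" if "j \<le> k" for j k :: nat
      using that by (intro divide_right_mono mult_left_mono) auto
    have dec: "x j \<ge> x k" if "j \<le> k" "k \<le> N" for j k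
      unfolding x_def using mono[OF that(1)] mono[OF that(2)]
      by (intro mult_left_mono cos_monotone_0_pi_le) (auto simp: N_def)
    have inc: "x j \<le> x k" if "j \<le> k" "N \<le> j" "k \<le> 2 * N" for j k
    proof -
      have "cos (2 * pi - pi * k / N) \<ge> cos (2 * pi - pi * j / N)"
      proof (rule cos_monotone_0_pi_le)
        have "N \<noteq> 0" by (simp add: N_def)
        then have "pi * real (2 * N) / real N = 2 * pi" by simp
        with mono[OF that(3)] show "0 \<le> 2 * pi - pi * k / N" by linarith
        have "pi * real N / real N = pi" by (simp add: N_def)
        with mono[OF that(2)] show "2 * pi - pi * j / N \<le> pi" by linarith
      qed (use mono[OF that(1)] in simp)
      then show ?thesis by (simp add: x_def cos_diff)
    qed
    have "i = i'" if *: "i < N" "i' < N" "x (2 * i) > \<gamma>" "x (2 * i + 1) < \<gamma>" "x (2 * i') > \<gamma>" "x (2 * i' + 1) < \<gamma>"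
      for i i'
    proof -
      have small: "2 * k + 1 \<le> N" if "k < N" "x (2 * k) > \<gamma>" "x (2 * k + 1) < \<gamma>" for k
      proof (rule ccontr)
        assume "\<not> ?thesis"
        then have "x (2 * k) \<le> x (2 * k + 1)" using that(1) by (intro inc) (auto simp: N_def)
        then show False using that by simp
      qed
      show ?thesis
        using dec[of "2 * i + 1" "2 * i'"] dec[of "2 * i' + 1" "2 * i"] small[of i] small[of i'] *
        by (cases i i' rule: linorder_cases) auto
    qed
    then show "real (card {i\<in>{..<N}. x (2 * i) > \<gamma> \<and> x (2 * i + 1) < \<gamma>}) \<le> 1"
      by (auto simp: card_le_Suc0_iff_eq)
  qed
  finally have "4 * (2 * real n + 1) / (2 * real n + 2) \<le> M\<^sup>2" by (simp add: N_def field_simps)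
  moreover have "0 \<le> M"
    using M[of 0] by (rule order.trans[rotated]) (auto intro!: image_eqI[of _ _ 0])
  ultimately show "sqrt (4 * (2 * real n + 1) / (2 * real n + 2)) \<le> M" by (intro real_le_lsqrt)
qed simp

lemma odd_chebyshev_tendsto:
  "(\<lambda>n. sup_norm (quadratic_preimage a c) (chebyshev_poly (quadratic_preimage a c) (2 * n + 1)))
    \<longlonglongrightarrow> sqrt (2 * cmod (c + sqrt_branch c))" (is "?f \<longlonglongrightarrow> ?L")
proof -
  \<comment> \<open>The solution of \<open>s + 1/s = c\<close> in the closed unit disc:
    \<open>sqrt_branch\<close> makes \<open>c + sqrt_branch c\<close> the larger of the two factors
    of 4.\<close>
  define s where "s = (c - sqrt_branch c) / 2"
  have m: "s * ((c + sqrt_branch c) / 2) = 1"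
    using sqrt_branch_mult[of c] by (simp add: s_def mult.commute)
  then have s0: "s \<noteq> 0" and inv: "inverse s = (c + sqrt_branch c) / 2"
    by (force, intro inverse_unique)
  have c: "c = s + inverse s" unfolding inv by (simp add: s_def field_simps)
  have inv_ge: "1 \<le> cmod (inverse s)" using norm_sqrt_branch_ge[of c] by (simp add: inv)
  then have s1: "cmod s \<le> 1" using s0 by (simp add: norm_inverse one_le_inverse_iff)
  have L: "?L = sqrt (4 / cmod s)"
  proof -
    have "2 * cmod (c + sqrt_branch c) = 4 * cmod (inverse s)" by (simp add: inv)
    then show ?thesis by (simp add: norm_inverse divide_inverse)
  qed
  show ?thesis
    unfolding L
  proof (rule order_tendstoI)
    fix l assume l: "sqrt (4 / cmod s) < l"
    \<comment> \<open>One parameter \<open>t\<close> serves both as \<open>\<epsilon>\<close> and as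
      \<open>1 - r\<close>.\<close>
    have "((\<lambda>t. sqrt (4 / cmod s * (2 / (1 + (1 - t)))\<^sup>2 * (1 + t))) \<longlongrightarrow> sqrt (4 / cmod s * (2 / (1 + (1 - 0)))\<^sup>2 * (1 + 0))) (at_right (0::real))"
      by (intro tendsto_intros) auto
    then have "\<forall>\<^sub>F t in at_right 0. sqrt (4 / cmod s * (2 / (1 + (1 - t)))\<^sup>2 * (1 + t)) < l"
      using l by (intro order_tendstoD(2)) auto
    moreover have "\<forall>\<^sub>F t in at_right (0::real). 0 < t \<and> t < 1"
      using eventually_at_right_real[of 0 "1::real"] by auto
    ultimately have "\<forall>\<^sub>F t in at_right 0. sqrt (4 / cmod s * (2 / (1 + (1 - t)))\<^sup>2 * (1 + t)) < l \<and> 0 < t \<and> t < 1"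
      by eventually_elim auto
    then obtain t where t: "sqrt (4 / cmod s * (2 / (1 + (1 - t)))\<^sup>2 * (1 + t)) < l" "0 < t" "t < 1"
      using eventually_happens'[OF trivial_limit_at_right_real] by blast
    have "\<forall>\<^sub>F n in sequentially. ?f n \<le> sqrt (4 / cmod s * (2 / (1 + (1 - t)))\<^sup>2 * (1 + t))"
      using t by (intro odd_chebyshev_upper s0 s1 c) auto
    then show "\<forall>\<^sub>F n in sequentially. ?f n < l" by eventually_elim (use t in linarith)
  next
    fix l assume l: "l < sqrt (4 / cmod s)"
    show "\<forall>\<^sub>F n in sequentially. l < ?f n"
    proof (cases "c \<in> real_segment")
      case True
      then have "cmod s = 1"
        using norm_eq_2_if_real_segment[OF sqrt_branch_power2 True] inv s0
        by (metis inverse_inverse_eq norm_divide norm_inverse norm_numeral divide_self zero_neq_numeral inverse_1)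
      have "(\<lambda>n. sqrt (4 * (2 * real n + 1) / (2 * real n + 2))) \<longlonglongrightarrow> 2"
        by real_asymp
      then have "\<forall>\<^sub>F n in sequentially. l < sqrt (4 * (2 * real n + 1) / (2 * real n + 2))"
        using l \<open>cmod s = 1\<close> by (intro order_tendstoD(1)) auto
      then show ?thesis
      proof eventually_elim
        case (elim n)
        then show ?case using odd_chebyshev_lower_segment[OF True, of n a] by simp
      qed
    next
      case False
      then have "cmod (c + sqrt_branch c) \<noteq> 2"
        using norm_eq_2_imp_real_segment[OF sqrt_branch_power2] by blast
      then have "1 < cmod (inverse s)" using inv_ge by (auto simp: inv)
      then have s1: "cmod s < 1" using s0 by (simp add: norm_inverse one_less_inverse_iff)
      have "((\<lambda>t. sqrt (4 / cmod s * (1 - t))) \<longlongrightarrow> sqrt (4 / cmod s * (1 - 0))) (at_right (0::real))"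
        by (intro tendsto_intros)
      then have "\<forall>\<^sub>F t in at_right 0. l < sqrt (4 / cmod s * (1 - t))"
        using l by (intro order_tendstoD(1)) auto
      moreover have "\<forall>\<^sub>F t in at_right (0::real). 0 < t \<and> t < 1"
        using eventually_at_right_real[of 0 "1::real"] by auto
      ultimately have "\<forall>\<^sub>F t in at_right 0. l < sqrt (4 / cmod s * (1 - t)) \<and> 0 < t \<and> t < 1"
        by eventually_elim auto
      then obtain t where t: "l < sqrt (4 / cmod s * (1 - t))" "0 < t" "t < 1"
        using eventually_happens'[OF trivial_limit_at_right_real] by blast
      have "\<forall>\<^sub>F n in sequentially. sqrt (4 / cmod s * (1 - t)) \<le> ?f n"
        using t by (intro odd_chebyshev_lower_outside s0 s1 c) auto
      then show ?thesis by eventually_elim (use t in linarith)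
    qed
  qed
qed

section \<open>Positive definite kernels\<close>

text \<open>Finite sums of \<open>f z * f w\<close> with bounded Borel \<open>f\<close>: their
  double integral against a probability measure is a sum of squares. Multiplying out shows closure
  under products, the analogue of Schur's theorem.\<close>

inductive gram_kernel :: "(complex \<Rightarrow> complex \<Rightarrow> real) \<Rightarrow> bool" where
  gram_kernel_zero: "gram_kernel (\<lambda>z w. 0)"
| gram_kernel_add_square: "gram_kernel K \<Longrightarrow> f \<in> borel_measurable borel \<Longrightarrow> (\<And>z. \<bar>f z\<bar> \<le> B)
    \<Longrightarrow> gram_kernel (\<lambda>z w. K z w + f z * f w)"

lemma gram_kernel_square:
  assumes "f \<in> borel_measurable borel" "\<And>z. \<bar>f z\<bar> \<le> B"
  shows "gram_kernel (\<lambda>z w. f z * f w)"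
  using gram_kernel_add_square[OF gram_kernel_zero assms] by simp

lemma gram_kernel_add:
  assumes "gram_kernel K" "gram_kernel L"
  shows "gram_kernel (\<lambda>z w. K z w + L z w)"
  using assms(2)
proof induction
  case gram_kernel_zero
  then show ?case using assms(1) by simp
next
  case (gram_kernel_add_square L f B)
  from gram_kernel.gram_kernel_add_square[OF this(4,2,3)] show ?case by (simp add: add.assoc)
qed

lemma gram_kernel_mult_square:
  assumes "gram_kernel K" "f \<in> borel_measurable borel" "\<And>z. \<bar>f z\<bar> \<le> B"
  shows "gram_kernel (\<lambda>z w. K z w * (f z * f w))"
  using assms(1)
proof induction
  case gram_kernel_zero
  then show ?case by (simp add: gram_kernel.gram_kernel_zero)
next
  case (gram_kernel_add_square L g B')
  have "\<bar>g z * f z\<bar> \<le> B' * B" for z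
    unfolding abs_mult using gram_kernel_add_square(3)[of z] assms(3)[of z] by (intro mult_mono) auto
  moreover have "(\<lambda>z. g z * f z) \<in> borel_measurable borel"
    using gram_kernel_add_square assms by measurable
  ultimately show ?case
    using gram_kernel.gram_kernel_add_square[OF gram_kernel_add_square(4), of "\<lambda>z. g z * f z" "B' * B"]
    by (simp add: algebra_simps)
qed

lemma gram_kernel_mult:
  assumes "gram_kernel K" "gram_kernel L"
  shows "gram_kernel (\<lambda>z w. K z w * L z w)"
  using assms(2)
proof induction
  case gram_kernel_zero
  then show ?case by (simp add: gram_kernel.gram_kernel_zero)
next
  case (gram_kernel_add_square L f B)
  from gram_kernel_add[OF this(4) gram_kernel_mult_square[OF assms(1) this(2,3)]]
  show ?case by (simp add: distrib_left)
qed

lemma gram_kernel_bounded: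
  assumes "gram_kernel K"
  shows "\<exists>B. \<forall>z w. \<bar>K z w\<bar> \<le> B"
  using assms
proof induction
  case (gram_kernel_add_square K f B)
  then obtain B' where B': "\<And>z w. \<bar>K z w\<bar> \<le> B'" by auto
  have "\<bar>K z w + f z * f w\<bar> \<le> B' + B * B" for z w
  proof -
    have "\<bar>f z\<bar> * \<bar>f w\<bar> \<le> B * B"
      using gram_kernel_add_square(3)[of z] gram_kernel_add_square(3)[of w] by (intro mult_mono) auto
    then show ?thesis using B'[of z w] abs_triangle_ineq[of "K z w" "f z * f w"] by (simp add: abs_mult)
  qed
  then show ?case by blast
qed auto

lemma gram_kernel_integral:
  assumes "gram_kernel K" "prob_space \<mu>" "sets \<mu> = sets borel"
  shows "(\<forall>z. integrable \<mu> (K z)) \<and> integrable \<mu> (\<lambda>z. \<integral>w. K z w \<partial>\<mu>) \<and> 0 \<le> (\<integral>z. \<integral>w. K z w \<partial>\<mu> \<partial>\<mu>)"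
  using assms(1)
proof induction
  case (gram_kernel_add_square K f B)
  interpret prob_space \<mu> by fact
  have "f \<in> borel_measurable \<mu>" using gram_kernel_add_square(2) assms(3) by (simp cong: measurable_cong_sets)
  then have "integrable \<mu> f" using gram_kernel_add_square(3) by (intro integrable_const_bound[of _ B]) auto
  then show ?case using gram_kernel_add_square.IH by simp
qed simp

definition pos_kernel :: "complex set \<Rightarrow> (complex \<Rightarrow> complex \<Rightarrow> real) \<Rightarrow> bool" where
  "pos_kernel E K \<longleftrightarrow> (\<forall>\<epsilon>>0. \<exists>G. gram_kernel G \<and> (\<forall>z\<in>E. \<forall>w\<in>E. \<bar>K z w - G z w\<bar> \<le> \<epsilon>))"

lemma pos_kernelE:
  assumes "pos_kernel E K" "\<epsilon> > 0"
  obtains G where "gram_kernel G" "\<And>z w. z \<in> E \<Longrightarrow> w \<in> E \<Longrightarrow> \<bar>K z w - G z w\<bar> \<le> \<epsilon>"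
  using assms unfolding pos_kernel_def by blast

lemma pos_kernel_bounded:
  assumes "pos_kernel E K"
  obtains B where "B \<ge> 0" "\<And>z w. z \<in> E \<Longrightarrow> w \<in> E \<Longrightarrow> \<bar>K z w\<bar> \<le> B"
proof -
  obtain G where G: "gram_kernel G" "\<And>z w. z \<in> E \<Longrightarrow> w \<in> E \<Longrightarrow> \<bar>K z w - G z w\<bar> \<le> 1"
    using pos_kernelE[OF assms, of 1] by auto
  obtain B where B: "\<And>z w. \<bar>G z w\<bar> \<le> B" using gram_kernel_bounded[OF G(1)] by auto
  have "0 \<le> B" using B[of 0 0] by linarith
  then show ?thesis
  proof (intro that[of "B + 1"])
    fix z w assume "z \<in> E" "w \<in> E"
    then show "\<bar>K z w\<bar> \<le> B + 1" using G(2)[of z w] B[of z w] by linarith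
  qed simp
qed

lemma pos_kernel_square:
  assumes E: "compact E" and f: "continuous_on E f"
  shows "pos_kernel E (\<lambda>z w. f z * f w)"
proof -
  \<comment> \<open>Gram kernels need functions that are bounded and Borel on the whole plane, hence
    the extension by 0.\<close>
  define g where "g z = indicator E z *\<^sub>R (f z :: real)" for z
  have "g \<in> borel_measurable borel"
    unfolding g_def using E f by (intro borel_measurable_continuous_on_indicator) (auto intro: borel_closed compact_imp_closed)
  moreover obtain B where B: "\<And>z. z \<in> E \<Longrightarrow> \<bar>f z\<bar> \<le> B"
    using compact_imp_bounded[OF compact_continuous_image[OF f E]] by (auto simp: bounded_iff)
  have "\<bar>g z\<bar> \<le> \<bar>B\<bar>" for z using B[of z] by (auto simp: g_def indicator_def)
  ultimately have "gram_kernel (\<lambda>z w. g z * g w)" by (rule gram_kernel_square)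
  then show ?thesis unfolding pos_kernel_def by (force simp: g_def)
qed

lemma pos_kernel_add:
  assumes "pos_kernel E K" "pos_kernel E L"
  shows "pos_kernel E (\<lambda>z w. K z w + L z w)"
  unfolding pos_kernel_def
proof (intro allI impI)
  fix \<epsilon> :: real assume "\<epsilon> > 0"
  then obtain G H where G: "gram_kernel G" "\<And>z w. z \<in> E \<Longrightarrow> w \<in> E \<Longrightarrow> \<bar>K z w - G z w\<bar> \<le> \<epsilon> / 2"
    and H: "gram_kernel H" "\<And>z w. z \<in> E \<Longrightarrow> w \<in> E \<Longrightarrow> \<bar>L z w - H z w\<bar> \<le> \<epsilon> / 2"
    using pos_kernelE[OF assms(1), of "\<epsilon> / 2"] pos_kernelE[OF assms(2), of "\<epsilon> / 2"] by (metis half_gt_zero)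
  have "\<bar>K z w + L z w - (G z w + H z w)\<bar> \<le> \<epsilon>" if "z \<in> E" "w \<in> E" for z w
    using G(2)[OF that] H(2)[OF that] by linarith
  with gram_kernel_add[OF G(1) H(1)]
  show "\<exists>G. gram_kernel G \<and> (\<forall>z\<in>E. \<forall>w\<in>E. \<bar>K z w + L z w - G z w\<bar> \<le> \<epsilon>)" by blast
qed

lemma pos_kernel_mult:
  assumes "pos_kernel E K" "pos_kernel E L"
  shows "pos_kernel E (\<lambda>z w. K z w * L z w)"
  unfolding pos_kernel_def
proof (intro allI impI)
  fix \<epsilon> :: real assume "\<epsilon> > 0"
  obtain A where A: "A \<ge> 0" "\<And>z w. z \<in> E \<Longrightarrow> w \<in> E \<Longrightarrow> \<bar>K z w\<bar> \<le> A" using pos_kernel_bounded[OF assms(1)] by blast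
  obtain B where B: "B \<ge> 0" "\<And>z w. z \<in> E \<Longrightarrow> w \<in> E \<Longrightarrow> \<bar>L z w\<bar> \<le> B" using pos_kernel_bounded[OF assms(2)] by blast
  \<comment> \<open>From \<open>K L - G H = K (L - H) + (K - G) H\<close> with
    \<open>|H| \<le> B + 1\<close>.\<close>
  define \<delta> where "\<delta> = min 1 (\<epsilon> / (A + B + 1))"
  have \<delta>: "\<delta> > 0" "\<delta> \<le> 1" "\<delta> * (A + B + 1) \<le> \<epsilon>"
  proof -
    show "\<delta> > 0" "\<delta> \<le> 1" using \<open>\<epsilon> > 0\<close> A B by (auto simp: \<delta>_def)
    have "\<delta> \<le> \<epsilon> / (A + B + 1)" by (simp add: \<delta>_def)
    then show "\<delta> * (A + B + 1) \<le> \<epsilon>" using A B by (simp add: pos_le_divide_eq)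
  qed
  obtain G where G: "gram_kernel G" "\<And>z w. z \<in> E \<Longrightarrow> w \<in> E \<Longrightarrow> \<bar>K z w - G z w\<bar> \<le> \<delta>"
    using pos_kernelE[OF assms(1) \<delta>(1)] by blast
  obtain H where H: "gram_kernel H" "\<And>z w. z \<in> E \<Longrightarrow> w \<in> E \<Longrightarrow> \<bar>L z w - H z w\<bar> \<le> \<delta>"
    using pos_kernelE[OF assms(2) \<delta>(1)] by blast
  have "\<bar>K z w * L z w - G z w * H z w\<bar> \<le> \<epsilon>" if "z \<in> E" "w \<in> E" for z w
  proof -
    have "\<bar>H z w\<bar> \<le> B + 1" using B(2)[OF that] H(2)[OF that] \<delta> by linarith
    then have "\<bar>K z w\<bar> * \<bar>L z w - H z w\<bar> + \<bar>K z w - G z w\<bar> * \<bar>H z w\<bar> \<le> A * \<delta> + \<delta> * (B + 1)"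
      using A B G(2)[OF that] H(2)[OF that] \<delta> that by (intro add_mono mult_mono) auto
    moreover have "K z w * L z w - G z w * H z w = K z w * (L z w - H z w) + (K z w - G z w) * H z w"
      by (simp add: algebra_simps)
    then have "\<bar>K z w * L z w - G z w * H z w\<bar> \<le> \<bar>K z w\<bar> * \<bar>L z w - H z w\<bar> + \<bar>K z w - G z w\<bar> * \<bar>H z w\<bar>"
      by (metis abs_mult abs_triangle_ineq)
    moreover have "A * \<delta> + \<delta> * (B + 1) = \<delta> * (A + B + 1)" by (simp add: algebra_simps)
    ultimately show ?thesis using \<delta>(3) by linarith
  qed
  with gram_kernel_mult[OF G(1) H(1)]
  show "\<exists>G. gram_kernel G \<and> (\<forall>z\<in>E. \<forall>w\<in>E. \<bar>K z w * L z w - G z w\<bar> \<le> \<epsilon>)" by blast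
qed

lemma pos_kernel_const:
  assumes "compact E" "c \<ge> 0"
  shows "pos_kernel E (\<lambda>z w. c)"
  using pos_kernel_square[OF assms(1), of "\<lambda>_. sqrt c"] assms(2) by simp

lemma pos_kernel_cmult:
  assumes "compact E" "pos_kernel E K" "c \<ge> 0"
  shows "pos_kernel E (\<lambda>z w. c * K z w)"
  using pos_kernel_mult[OF pos_kernel_const[OF assms(1,3)] assms(2)] .

lemma pos_kernel_power:
  assumes "compact E" "pos_kernel E K"
  shows "pos_kernel E (\<lambda>z w. K z w ^ n)"
  by (induction n) (auto intro: pos_kernel_mult assms pos_kernel_const)

lemma pos_kernel_sum:
  assumes "compact E" "\<And>k. pos_kernel E (K k)"
  shows "pos_kernel E (\<lambda>z w. \<Sum>k<(n::nat). K k z w)"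
  by (induction n) (auto intro: pos_kernel_add assms pos_kernel_const)

lemma pos_kernel_sums:
  assumes E: "compact E" and K: "\<And>k. pos_kernel E (K k)"
    and b: "\<And>k z w. z \<in> E \<Longrightarrow> w \<in> E \<Longrightarrow> \<bar>K k z w\<bar> \<le> b k" "summable b"
    and sums: "\<And>z w. z \<in> E \<Longrightarrow> w \<in> E \<Longrightarrow> (\<lambda>k. K k z w) sums S z w"
  shows "pos_kernel E S"
  unfolding pos_kernel_def
proof (intro allI impI)
  fix \<epsilon> :: real assume "\<epsilon> > 0"
  have "uniform_limit (E \<times> E) (\<lambda>n p. \<Sum>k<n. K k (fst p) (snd p)) (\<lambda>p. \<Sum>k. K k (fst p) (snd p)) sequentially"
    using b by (intro Weierstrass_m_test) auto
  then have "\<forall>\<^sub>F n in sequentially. \<forall>p\<in>E \<times> E. dist (\<Sum>k<n. K k (fst p) (snd p)) (\<Sum>k. K k (fst p) (snd p)) < \<epsilon> / 2"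
    using \<open>\<epsilon> > 0\<close> by (intro uniform_limitD) auto
  then obtain n where "\<forall>p\<in>E \<times> E. dist (\<Sum>k<n. K k (fst p) (snd p)) (\<Sum>k. K k (fst p) (snd p)) < \<epsilon> / 2"
    using eventually_happens'[OF sequentially_bot] by blast
  then have n: "\<bar>S z w - (\<Sum>k<n. K k z w)\<bar> \<le> \<epsilon> / 2" if "z \<in> E" "w \<in> E" for z w
    using that sums_unique[OF sums[OF that]] by (force simp: dist_real_def abs_minus_commute)
  obtain G where G: "gram_kernel G" "\<And>z w. z \<in> E \<Longrightarrow> w \<in> E \<Longrightarrow> \<bar>(\<Sum>k<n. K k z w) - G z w\<bar> \<le> \<epsilon> / 2"
    using pos_kernelE[OF pos_kernel_sum[where K = K and n = n, OF E K], of "\<epsilon> / 2"] \<open>\<epsilon> > 0\<close> by auto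
  have "\<bar>S z w - G z w\<bar> \<le> \<epsilon>" if "z \<in> E" "w \<in> E" for z w
    using n[OF that] G(2)[OF that] by linarith
  with G(1) show "\<exists>G. gram_kernel G \<and> (\<forall>z\<in>E. \<forall>w\<in>E. \<bar>S z w - G z w\<bar> \<le> \<epsilon>)" by blast
qed

text \<open>At \<open>r = 1\<close> this is the distance between the points
  \<open>2 cos \<theta>\<close> and \<open>2 cos \<phi>\<close> of the segment; \<open>r < 1\<close>
  removes the zero on the diagonal.\<close>

definition log_circle_kernel :: "real \<Rightarrow> real \<Rightarrow> real \<Rightarrow> real" where
  "log_circle_kernel r \<theta> \<phi> = cmod (1 - r * cis (\<theta> + \<phi>)) * cmod (1 - r * cis (\<theta> - \<phi>))"

lemma sums_ln_norm_one_minus_cis: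
  fixes \<theta> :: real
  assumes "0 \<le> r" "r < 1"
  shows "(\<lambda>k. r ^ k * cos (k * \<theta>) / k) sums (- ln (cmod (1 - r * cis \<theta>)))"
proof -
  have "cmod (- (r * cis \<theta>)) < 1" using assms by (simp add: norm_mult)
  from Ln_series'[OF this] have "(\<lambda>n. - ((r * cis \<theta>) ^ n) / of_nat n) sums ln (1 - r * cis \<theta>)" by simp
  then have "(\<lambda>n. Re (- ((r * cis \<theta>) ^ n) / of_nat n)) sums Re (ln (1 - r * cis \<theta>))" by (rule sums_Re)
  moreover have "1 - r * cis \<theta> \<noteq> 0"
  proof
    assume "1 - r * cis \<theta> = 0"
    then have "cmod (r * cis \<theta>) = 1" by simp
    then show False using assms by (simp add: norm_mult)
  qed
  ultimately have sums: "(\<lambda>n. - Re (- ((r * cis \<theta>) ^ n) / of_nat n)) sums (- ln (cmod (1 - r * cis \<theta>)))"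
    using sums_minus by fastforce
  have eq: "- Re (- ((r * cis \<theta>) ^ n) / of_nat n) = r ^ n * cos (n * \<theta>) / n" for n
  proof -
    have "(r * cis \<theta>) ^ n = of_real (r ^ n) * cis (real n * \<theta>)"
      by (simp only: power_mult_distrib Complex.DeMoivre of_real_power)
    then show ?thesis by (simp del: of_real_power)
  qed
  show ?thesis using sums unfolding eq .
qed

lemma log_circle_kernel_pos:
  assumes "0 \<le> r" "r < 1"
  shows "(1 - r)\<^sup>2 \<le> log_circle_kernel r \<theta> \<phi>" "0 < log_circle_kernel r \<theta> \<phi>" "log_circle_kernel r \<theta> \<phi> \<le> 4"
proof -
  have ge: "1 - r \<le> cmod (1 - r * cis \<alpha>)" and le: "cmod (1 - r * cis \<alpha>) \<le> 2" for \<alpha>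
    using norm_triangle_ineq2[of 1 "r * cis \<alpha>"] norm_triangle_ineq4[of 1 "r * cis \<alpha>"] assms
    by (simp_all add: norm_mult)
  show "(1 - r)\<^sup>2 \<le> log_circle_kernel r \<theta> \<phi>"
    unfolding log_circle_kernel_def power2_eq_square using ge assms by (intro mult_mono) auto
  moreover have "0 < (1 - r)\<^sup>2" using assms by simp
  ultimately show "0 < log_circle_kernel r \<theta> \<phi>" by linarith
  have "log_circle_kernel r \<theta> \<phi> \<le> 2 * 2" unfolding log_circle_kernel_def using le by (intro mult_mono) auto
  then show "log_circle_kernel r \<theta> \<phi> \<le> 4" by simp
qed

text \<open>The series of \<open>- ln |1 - r cis \<alpha>|\<close> at
  \<open>\<theta> + \<phi>\<close> and \<open>\<theta> - \<phi>\<close> add up to products of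
  cosines, which exhibit the kernel as positive definite. The term at \<open>k = 0\<close> vanishes
  because \<open>x / 0 = 0\<close>.\<close>

lemma sums_log_circle_kernel:
  fixes \<theta> \<phi> :: real
  assumes "0 \<le> r" "r < 1"
  shows "(\<lambda>k. 2 * r ^ k / k * (cos (k * \<theta>) * cos (k * \<phi>))) sums (- ln (log_circle_kernel r \<theta> \<phi>))"
proof -
  have "cmod (1 - r * cis \<alpha>) > 0" for \<alpha>
    using norm_triangle_ineq2[of 1 "r * cis \<alpha>"] assms by (simp add: norm_mult del: zero_less_norm_iff)
  then have "- ln (log_circle_kernel r \<theta> \<phi>) = - ln (cmod (1 - r * cis (\<theta> + \<phi>))) + - ln (cmod (1 - r * cis (\<theta> - \<phi>)))"
    unfolding log_circle_kernel_def by (subst ln_mult_pos) auto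
  moreover have "r ^ k * cos (k * (\<theta> + \<phi>)) / k + r ^ k * cos (k * (\<theta> - \<phi>)) / k = 2 * r ^ k / k * (cos (k * \<theta>) * cos (k * \<phi>))" for k :: nat
    by (simp add: distrib_left right_diff_distrib cos_add cos_diff flip: add_divide_distrib)
  ultimately show ?thesis
    using sums_add[OF sums_ln_norm_one_minus_cis[OF assms, of "\<theta> + \<phi>"] sums_ln_norm_one_minus_cis[OF assms, of "\<theta> - \<phi>"]]
    by simp
qed

lemma cos_diff_eq_norm: "\<bar>2 * cos \<theta> - 2 * cos \<phi>\<bar> = log_circle_kernel 1 \<theta> \<phi>"
proof -
  have "(1 - cis (\<theta> + \<phi>)) * (1 - cis (\<theta> - \<phi>)) = cis \<theta> * of_real (2 * cos \<theta> - 2 * cos \<phi>)"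
  proof -
    have "of_real (2 * cos \<alpha>) = cis \<alpha> + cis (- \<alpha>)" for \<alpha> by (simp add: complex_eq_iff)
    then have "cis \<theta> * of_real (2 * cos \<theta> - 2 * cos \<phi>) = cis \<theta> * (cis \<theta> + cis (- \<theta>) - (cis \<phi> + cis (- \<phi>)))"
      by (simp only: of_real_diff)
    then show ?thesis by (simp add: algebra_simps cis_mult)
  qed
  then have "cmod ((1 - cis (\<theta> + \<phi>)) * (1 - cis (\<theta> - \<phi>))) = cmod (of_real (2 * cos \<theta> - 2 * cos \<phi>))"
    by (simp only: norm_mult norm_cis mult_1)
  then show ?thesis by (simp only: log_circle_kernel_def norm_mult norm_of_real of_real_1 mult_1)
qed

lemma log_circle_kernel_le:
  assumes "0 \<le> r" "r < 1"
  shows "\<bar>2 * cos \<theta> - 2 * cos \<phi>\<bar> \<le> (2 / (1 + r))\<^sup>2 * log_circle_kernel r \<theta> \<phi>"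
proof -
  have "cmod (1 - cis \<alpha>) \<le> 2 / (1 + r) * cmod (1 - r * cis \<alpha>)" for \<alpha>
    using assms by (intro norm_one_minus_le) auto
  then have "log_circle_kernel 1 \<theta> \<phi> \<le> (2 / (1 + r) * cmod (1 - r * cis (\<theta> + \<phi>))) * (2 / (1 + r) * cmod (1 - r * cis (\<theta> - \<phi>)))"
    unfolding log_circle_kernel_def of_real_1 mult_1 using assms by (intro mult_mono) auto
  then show ?thesis
    unfolding cos_diff_eq_norm by (simp add: log_circle_kernel_def power2_eq_square mult_ac)
qed

lemma pos_kernel_log_circle:
  assumes E: "compact E" and \<theta>: "continuous_on E \<theta>" and r: "0 \<le> r" "r < 1"
  shows "pos_kernel E (\<lambda>z w. - ln (log_circle_kernel r (\<theta> z) (\<theta> w)))"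
proof (rule pos_kernel_sums[OF E])
  show "pos_kernel E (\<lambda>z w. 2 * r ^ k / k * (cos (k * \<theta> z) * cos (k * \<theta> w)))" for k :: nat
    by (intro pos_kernel_cmult E pos_kernel_square continuous_intros \<theta>) (use r in auto)
  show "(\<lambda>k. 2 * r ^ k / k * (cos (k * \<theta> z) * cos (k * \<theta> w))) sums - ln (log_circle_kernel r (\<theta> z) (\<theta> w))" for z w
    by (rule sums_log_circle_kernel[OF r])
  show "summable (\<lambda>k. 2 * r ^ k)" using r by (intro summable_mult summable_geometric) auto
  fix k :: nat and z w
  have "\<bar>cos (k * \<theta> z)\<bar> * \<bar>cos (k * \<theta> w)\<bar> \<le> 1 * 1" by (intro mult_mono) auto
  moreover have "2 * r ^ k / k \<le> 2 * r ^ k" using r by (cases k) (auto simp: field_simps mult_left_le)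
  ultimately have "(2 * r ^ k / k) * (\<bar>cos (k * \<theta> z)\<bar> * \<bar>cos (k * \<theta> w)\<bar>) \<le> 2 * r ^ k * 1"
    using r by (intro mult_mono) auto
  then show "\<bar>2 * r ^ k / k * (cos (k * \<theta> z) * cos (k * \<theta> w))\<bar> \<le> 2 * r ^ k"
    using r by (simp add: abs_mult)
qed

text \<open>With \<open>p = (1 - a) / (1 + a)\<close> and \<open>q = (1 - b) / (1 + b)\<close> one has \<open>1 / (p + q) = (1 + a) (1 + b) / (2 (1 - a b))\<close>.\<close>

lemma pos_kernel_inverse_add:
  assumes E: "compact E" and p: "continuous_on E p" "\<And>z. z \<in> E \<Longrightarrow> 0 < p z"
  shows "pos_kernel E (\<lambda>z w. 1 / (p z + p w))"
proof (cases "E = {}")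
  case True
  then show ?thesis by (auto simp: pos_kernel_def intro: gram_kernel_zero)
next
  case False
  define a where "a z = (1 - p z) / (1 + p z)" for z
  have p0: "1 + p z \<noteq> 0" if "z \<in> E" for z using p(2)[OF that] by linarith
  have ca: "continuous_on E a" unfolding a_def by (intro continuous_intros p ballI p0)
  then have "continuous_on E (\<lambda>z. \<bar>a z\<bar>)" by (intro continuous_intros)
  then obtain z0 where z0: "z0 \<in> E" "\<And>z. z \<in> E \<Longrightarrow> \<bar>a z\<bar> \<le> \<bar>a z0\<bar>"
    using continuous_attains_sup[OF E False] by blast
  define \<rho> where "\<rho> = \<bar>a z0\<bar>"
  have "\<rho> < 1" using p(2)[OF z0(1)] by (simp add: \<rho>_def a_def abs_less_iff field_simps)
  then have \<rho>: "0 \<le> \<rho>" "\<rho> < 1" "\<And>z. z \<in> E \<Longrightarrow> \<bar>a z\<bar> \<le> \<rho>" using z0 by (auto simp: \<rho>_def)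
  have \<rho>2: "\<rho> * \<rho> < 1" using mult_strict_mono[of \<rho> 1 \<rho> 1] \<rho> by simp
  show ?thesis
  proof (rule pos_kernel_sums[OF E])
    show "pos_kernel E (\<lambda>z w. 1 / 2 * (((1 + a z) * a z ^ k) * ((1 + a w) * a w ^ k)))" for k
      by (intro pos_kernel_cmult E pos_kernel_square continuous_intros ca) auto
    show "summable (\<lambda>k. 2 * (\<rho> * \<rho>) ^ k)" using \<rho> \<rho>2 by (intro summable_mult summable_geometric) auto
    fix z w assume zw: "z \<in> E" "w \<in> E"
    have a: "\<bar>a z\<bar> \<le> \<rho>" "\<bar>a w\<bar> \<le> \<rho>" using \<rho>(3) zw by auto
    fix k
    have "\<bar>1 + a z\<bar> * \<bar>a z\<bar> ^ k * (\<bar>1 + a w\<bar> * \<bar>a w\<bar> ^ k) \<le> 2 * \<rho> ^ k * (2 * \<rho> ^ k)"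
      using a \<rho> by (intro mult_mono power_mono) auto
    then show "\<bar>1 / 2 * (((1 + a z) * a z ^ k) * ((1 + a w) * a w ^ k))\<bar> \<le> 2 * (\<rho> * \<rho>) ^ k"
      by (simp add: abs_mult power_abs power_mult_distrib)
  next
    fix z w assume zw: "z \<in> E" "w \<in> E"
    have "\<bar>a z\<bar> * \<bar>a w\<bar> \<le> \<rho> * \<rho>" using \<rho> zw by (intro mult_mono) auto
    then have lt: "\<bar>a z * a w\<bar> < 1" using \<rho>2 by (simp add: abs_mult)
    have "(\<lambda>k. 1 / 2 * ((1 + a z) * (1 + a w)) * (a z * a w) ^ k) sums (1 / 2 * ((1 + a z) * (1 + a w)) * (1 / (1 - a z * a w)))"
      using lt by (intro sums_mult geometric_sums) auto
    moreover have "1 / 2 * ((1 + a z) * (1 + a w)) * (1 / (1 - a z * a w)) = 1 / (p z + p w)"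
    proof -
      have a1: "1 + a u = 2 / (1 + p u)" if "u \<in> E" for u using p0[OF that] by (simp add: a_def field_simps)
      have **: "1 - a z * a w = 2 * (p z + p w) / ((1 + p z) * (1 + p w))"
        using p0[OF zw(1)] p0[OF zw(2)] by (simp add: a_def divide_simps) (simp add: algebra_simps)
      have *: "1 / 2 * ((2 / P) * (2 / Q)) * (1 / (2 * s / (P * Q))) = 1 / s"
        if "P \<noteq> 0" "Q \<noteq> 0" for P Q s :: real
        using that by simp
      show ?thesis unfolding ** a1[OF zw(1)] a1[OF zw(2)] by (rule *) (use p0 zw in blast)+
    qed
    ultimately show "(\<lambda>k. 1 / 2 * (((1 + a z) * a z ^ k) * ((1 + a w) * a w ^ k))) sums (1 / (p z + p w))"
      by (simp add: power_mult_distrib mult_ac)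
  qed
qed

text \<open>Numerator and denominator are \<open>p z + p w\<close> plus and minus
  \<open>B z w\<close>, where \<open>B\<close> is twice a real inner product. With
  \<open>x = B / (p + p)\<close> the kernel is \<open>ln ((1 + x) / (1 - x))\<close>, a power series
  in \<open>x\<close> with nonnegative coefficients; \<open>\<eta>\<close> keeps \<open>|x|\<close>
  below a constant less than 1, also on the diagonal.\<close>

lemma pos_kernel_log_reflection:
  assumes E: "compact E" and v: "continuous_on E v" and \<eta>: "\<eta> > 0"
  shows "pos_kernel E (\<lambda>z w. ln (((cmod (v z + v w))\<^sup>2 + \<eta>) / ((cmod (v z - v w))\<^sup>2 + \<eta>)))"
proof -
  define p where "p z = (cmod (v z))\<^sup>2 + \<eta> / 2" for z
  define B where "B z w = 2 * (Re (v z) * Re (v w) + Im (v z) * Im (v w))" for z w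
  define x where "x z w = B z w * (1 / (p z + p w))" for z w
  have p: "p z > 0" for z using \<eta> by (simp add: p_def add_nonneg_pos)
  have "pos_kernel E B"
    unfolding B_def by (intro pos_kernel_cmult E pos_kernel_add pos_kernel_square continuous_intros v) auto
  moreover have "pos_kernel E (\<lambda>z w. 1 / (p z + p w))"
    by (intro pos_kernel_inverse_add E p) (auto simp: p_def intro!: continuous_intros v)
  ultimately have x: "pos_kernel E x" unfolding x_def by (rule pos_kernel_mult)
  have pm: "(cmod (v z + v w))\<^sup>2 + \<eta> = p z + p w + B z w" "(cmod (v z - v w))\<^sup>2 + \<eta> = p z + p w - B z w" for z w
    unfolding p_def B_def cmod_power2 by (simp_all add: power2_eq_square algebra_simps)
  obtain D where D: "\<And>z. z \<in> E \<Longrightarrow> cmod (v z) \<le> D"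
    using compact_imp_bounded[OF compact_continuous_image[OF v E]] by (auto simp: bounded_iff)
  define \<rho> where "\<rho> = 2 * D\<^sup>2 / (2 * D\<^sup>2 + \<eta>)"
  have "0 < 2 * D\<^sup>2 + \<eta>" using \<eta> by (simp add: add_nonneg_pos)
  then have \<rho>: "0 \<le> \<rho>" "\<rho> < 1" using \<eta> by (simp_all add: \<rho>_def)
  have x\<rho>: "\<bar>x z w\<bar> \<le> \<rho>" if "z \<in> E" "w \<in> E" for z w
  proof -
    define A where "A = (cmod (v z))\<^sup>2 + (cmod (v w))\<^sup>2"
    have A: "A \<ge> 0" "p z + p w = A + \<eta>" by (simp_all add: A_def p_def)
    have "B z w + A = (cmod (v z + v w))\<^sup>2" "A - B z w = (cmod (v z - v w))\<^sup>2"
      using pm[of z w] by (simp_all add: p_def A_def)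
    then have "0 \<le> A + B z w" "0 \<le> A - B z w" by (metis add.commute zero_le_power2) (metis \<open>A - B z w = _\<close> zero_le_power2)
    then have "\<bar>B z w\<bar> \<le> A" by linarith
    then have "\<bar>x z w\<bar> \<le> A / (A + \<eta>)"
      using A \<eta> by (simp add: x_def abs_mult divide_right_mono)
    also have "A \<le> D\<^sup>2 + D\<^sup>2"
      unfolding A_def using D that by (intro add_mono power_mono) auto
    then have "A / (A + \<eta>) \<le> \<rho>"
      using A \<eta> by (simp add: \<rho>_def divide_simps add_nonneg_pos) (simp add: algebra_simps)
    finally show ?thesis .
  qed
  \<comment> \<open>The coefficients of \<open>ln ((1 + x) / (1 - x))\<close>: \<open>2 / k\<close>
    for odd \<open>k\<close>, and 0 for even \<open>k\<close>.\<close>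
  define e :: "nat \<Rightarrow> real" where "e k = (1 - (-1) ^ k) / k" for k
  have e: "0 \<le> e k" "e k \<le> 2" for k by (cases "even k"; cases k; simp add: e_def field_simps)+
  show ?thesis
  proof (rule pos_kernel_sums[OF E])
    show "pos_kernel E (\<lambda>z w. e k * x z w ^ k)" for k
      by (intro pos_kernel_cmult pos_kernel_power E x e)
    show "summable (\<lambda>k. 2 * \<rho> ^ k)" using \<rho> by (intro summable_mult summable_geometric) auto
    show "\<bar>e k * x z w ^ k\<bar> \<le> 2 * \<rho> ^ k" if "z \<in> E" "w \<in> E" for k z w
      unfolding abs_mult power_abs using e[of k] x\<rho>[OF that] by (intro mult_mono power_mono) auto
    fix z w assume zw: "z \<in> E" "w \<in> E"
    have lt: "\<bar>x z w\<bar> < 1" using x\<rho>[OF zw] \<rho> by linarith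
    then have "(\<lambda>k. - ((- x z w) ^ k) / k - (- ((- (- x z w)) ^ k) / k)) sums (ln (1 + x z w) - ln (1 + - x z w))"
      by (intro sums_diff Complex_Transcendental.ln_series') auto
    moreover have "- ((- x z w) ^ k) / k - (- ((- (- x z w)) ^ k) / k) = e k * x z w ^ k" for k :: nat
      by (cases "even k") (simp_all add: e_def)
    moreover have "ln (1 + x z w) - ln (1 + - x z w) = ln (((cmod (v z + v w))\<^sup>2 + \<eta>) / ((cmod (v z - v w))\<^sup>2 + \<eta>))"
    proof -
      have "p z + p w \<noteq> 0" using p[of z] p[of w] by linarith
      then have "((cmod (v z + v w))\<^sup>2 + \<eta>) / ((cmod (v z - v w))\<^sup>2 + \<eta>) = (1 + x z w) / (1 + - x z w)"
      proof -
        have "p z + p w + B z w = (p z + p w) * (1 + x z w)" "p z + p w - B z w = (p z + p w) * (1 + - x z w)"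
          using \<open>p z + p w \<noteq> 0\<close> by (simp_all add: x_def distrib_left right_diff_distrib)
        then show ?thesis using \<open>p z + p w \<noteq> 0\<close> unfolding pm by simp
      qed
      moreover have "1 + x z w \<noteq> 0" "1 + - x z w \<noteq> 0" using lt by auto
      ultimately show ?thesis by (simp only: ln_div simp_thms if_True)
    qed
    ultimately show "(\<lambda>k. e k * x z w ^ k) sums ln (((cmod (v z + v w))\<^sup>2 + \<eta>) / ((cmod (v z - v w))\<^sup>2 + \<eta>))" by simp
  qed
qed

section \<open>Logarithmic energy\<close>

text \<open>With \<open>C\<close> at least the logarithm of every distance in \<open>E\<close>,
  nothing is truncated on \<open>E\<close> and one nonnegative integral replaces the difference of
  two. \<open>C = 0\<close> gives the positive part of the original kernel.\<close>

definition shifted_log_kernel :: "real \<Rightarrow> complex \<Rightarrow> complex \<Rightarrow> ennreal" where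
  "shifted_log_kernel C z w = (if z = w then \<infinity> else ennreal (C - ln (dist z w)))"

lemma measurable_shifted_log_kernel [measurable]:
  "case_prod (shifted_log_kernel C) \<in> borel_measurable (borel \<Otimes>\<^sub>M borel)"
proof -
  have "(\<lambda>p. if dist (fst p) (snd p) = 0 then \<infinity> else ennreal (C - ln (dist (fst p) (snd p))))
      \<in> borel_measurable (borel \<Otimes>\<^sub>M (borel :: complex measure))"
    by measurable
  then show ?thesis by (simp add: shifted_log_kernel_def case_prod_beta' cong: if_cong)
qed

lemma nn_integral2_mono_AE:
  assumes AE: "AE z in \<mu>. z \<in> E" and le: "\<And>z w. z \<in> E \<Longrightarrow> w \<in> E \<Longrightarrow> F z w \<le> H z w"
  shows "(\<integral>\<^sup>+z. \<integral>\<^sup>+w. F z w \<partial>\<mu> \<partial>\<mu>) \<le> (\<integral>\<^sup>+z. \<integral>\<^sup>+w. H z w \<partial>\<mu> \<partial>\<mu>)"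
  by (rule nn_integral_mono_AE, rule eventually_mono[OF AE],
      rule nn_integral_mono_AE, rule eventually_mono[OF AE]) (rule le)

text \<open>On \<open>E\<close> the positive part plus \<open>C\<close> equals the negative part
  plus the shifted kernel. The negative part has integral at most \<open>C\<close>, so it may be
  cancelled even if the energy is infinite.\<close>

lemma log_energy_eq_shifted:
  assumes "prob_space \<mu>" and sets: "sets \<mu> = sets borel" and E: "E \<in> sets borel" "emeasure \<mu> E = 1"
    and C: "C \<ge> 0" "\<And>z w. z \<in> E \<Longrightarrow> w \<in> E \<Longrightarrow> z \<noteq> w \<Longrightarrow> ln (dist z w) \<le> C"
  shows "log_energy \<mu> = enn2ereal (\<integral>\<^sup>+z. \<integral>\<^sup>+w. shifted_log_kernel C z w \<partial>\<mu> \<partial>\<mu>) - ereal C"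
proof -
  interpret prob_space \<mu> by fact
  define P :: "complex \<Rightarrow> complex \<Rightarrow> ennreal" where "P = shifted_log_kernel 0"
  define N :: "complex \<Rightarrow> complex \<Rightarrow> ennreal" where
    "N z w = (if z = w then 0 else ennreal (ln (dist z w)))" for z w
  define G where "G = shifted_log_kernel C"
  have [measurable_cong]: "sets \<mu> = sets borel" by (rule sets)
  have [measurable]: "case_prod P \<in> borel_measurable (\<mu> \<Otimes>\<^sub>M \<mu>)" "case_prod G \<in> borel_measurable (\<mu> \<Otimes>\<^sub>M \<mu>)"
    unfolding P_def G_def by measurable
  have "(\<lambda>p. if dist (fst p) (snd p) = 0 then 0 else ennreal (ln (dist (fst p) (snd p))))
      \<in> borel_measurable (borel \<Otimes>\<^sub>M (borel :: complex measure))"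
    by measurable
  then have "case_prod N \<in> borel_measurable (borel \<Otimes>\<^sub>M borel)"
    by (simp add: N_def case_prod_beta' cong: if_cong)
  then have [measurable]: "case_prod N \<in> borel_measurable (\<mu> \<Otimes>\<^sub>M \<mu>)" by measurable
  have AE: "AE z in \<mu>. z \<in> E"
    using E AE_in_set_eq_1[of E] by (simp add: measure_def sets)
  have int: "(\<integral>\<^sup>+z. \<integral>\<^sup>+w. F z w + H z w \<partial>\<mu> \<partial>\<mu>) = (\<integral>\<^sup>+z. \<integral>\<^sup>+w. F z w \<partial>\<mu> \<partial>\<mu>) + (\<integral>\<^sup>+z. \<integral>\<^sup>+w. H z w \<partial>\<mu> \<partial>\<mu>)"
    if [measurable]: "case_prod F \<in> borel_measurable (\<mu> \<Otimes>\<^sub>M \<mu>)" "case_prod H \<in> borel_measurable (\<mu> \<Otimes>\<^sub>M \<mu>)"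
    for F H :: "complex \<Rightarrow> complex \<Rightarrow> ennreal"
  proof -
    have "(\<integral>\<^sup>+z. \<integral>\<^sup>+w. F z w + H z w \<partial>\<mu> \<partial>\<mu>) = (\<integral>\<^sup>+z. (\<integral>\<^sup>+w. F z w \<partial>\<mu>) + (\<integral>\<^sup>+w. H z w \<partial>\<mu>) \<partial>\<mu>)"
      by (intro nn_integral_cong nn_integral_add) measurable
    also have "\<dots> = (\<integral>\<^sup>+z. \<integral>\<^sup>+w. F z w \<partial>\<mu> \<partial>\<mu>) + (\<integral>\<^sup>+z. \<integral>\<^sup>+w. H z w \<partial>\<mu> \<partial>\<mu>)"
      by (intro nn_integral_add) measurable
    finally show ?thesis .
  qed
  have const: "(\<integral>\<^sup>+z. \<integral>\<^sup>+w. ennreal C \<partial>\<mu> \<partial>\<mu>) = ennreal C" by (simp add: emeasure_space_1)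
  have eq: "P z w + ennreal C = N z w + G z w" if "z \<in> E" "w \<in> E" for z w
  proof (cases "z = w")
    case False
    show ?thesis
    proof (cases "ln (dist z w) \<le> 0")
      case True
      then show ?thesis using False C(1)
        by (simp add: P_def N_def G_def shifted_log_kernel_def ennreal_neg flip: ennreal_plus)
    next
      case False': False
      then show ?thesis using False C(2)[OF that False]
        by (simp add: P_def N_def G_def shifted_log_kernel_def ennreal_neg flip: ennreal_plus)
    qed
  qed (simp add: P_def N_def G_def shifted_log_kernel_def)
  have "(\<integral>\<^sup>+z. \<integral>\<^sup>+w. P z w + ennreal C \<partial>\<mu> \<partial>\<mu>) = (\<integral>\<^sup>+z. \<integral>\<^sup>+w. N z w + G z w \<partial>\<mu> \<partial>\<mu>)"
    by (intro antisym nn_integral2_mono_AE[OF AE]) (simp_all add: eq)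
  then have main: "(\<integral>\<^sup>+z. \<integral>\<^sup>+w. P z w \<partial>\<mu> \<partial>\<mu>) + ennreal C = (\<integral>\<^sup>+z. \<integral>\<^sup>+w. N z w \<partial>\<mu> \<partial>\<mu>) + (\<integral>\<^sup>+z. \<integral>\<^sup>+w. G z w \<partial>\<mu> \<partial>\<mu>)"
    by (subst (asm) (1 2) int) (simp_all add: emeasure_space_1)
  have "(\<integral>\<^sup>+z. \<integral>\<^sup>+w. N z w \<partial>\<mu> \<partial>\<mu>) \<le> (\<integral>\<^sup>+z. \<integral>\<^sup>+w. ennreal C \<partial>\<mu> \<partial>\<mu>)"
  proof (rule nn_integral2_mono_AE[OF AE])
    show "N z w \<le> ennreal C" if "z \<in> E" "w \<in> E" for z w
      using C that by (auto simp: N_def intro: ennreal_leI)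
  qed
  then obtain n where n: "(\<integral>\<^sup>+z. \<integral>\<^sup>+w. N z w \<partial>\<mu> \<partial>\<mu>) = ennreal n" "n \<ge> 0"
    unfolding const by (cases "\<integral>\<^sup>+z. \<integral>\<^sup>+w. N z w \<partial>\<mu> \<partial>\<mu>" rule: ennreal_cases) (auto simp: top_unique)
  have le: "log_energy \<mu> = enn2ereal (\<integral>\<^sup>+z. \<integral>\<^sup>+w. P z w \<partial>\<mu> \<partial>\<mu>) - enn2ereal (ennreal n)"
    unfolding log_energy_def n(1)[symmetric]
    by (simp add: P_def N_def[abs_def] shifted_log_kernel_def[abs_def] cong: if_cong)
  show ?thesis
  proof (cases "\<integral>\<^sup>+z. \<integral>\<^sup>+w. P z w \<partial>\<mu> \<partial>\<mu>" rule: ennreal_cases)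
    case top
    then have "(\<integral>\<^sup>+z. \<integral>\<^sup>+w. G z w \<partial>\<mu> \<partial>\<mu>) = top"
      using main n by (metis ennreal_add_eq_top ennreal_neq_top)
    then show ?thesis unfolding le top using n by (simp add: G_def)
  next
    case (real p)
    then have "(\<integral>\<^sup>+z. \<integral>\<^sup>+w. G z w \<partial>\<mu> \<partial>\<mu>) \<noteq> top" using main n C by (auto simp: ennreal_add_eq_top)
    then obtain g where g: "(\<integral>\<^sup>+z. \<integral>\<^sup>+w. G z w \<partial>\<mu> \<partial>\<mu>) = ennreal g" "g \<ge> 0"
      by (cases "\<integral>\<^sup>+z. \<integral>\<^sup>+w. G z w \<partial>\<mu> \<partial>\<mu>" rule: ennreal_cases) auto
    then have "p + C = n + g" using main n C real by (simp flip: ennreal_plus)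
    then show ?thesis unfolding le using real g n by (simp add: G_def)
  qed
qed

lemma ennreal_integral_le_nn_integral:
  fixes f :: "'a \<Rightarrow> real"
  assumes "integrable M f"
  shows "ennreal (\<integral>x. f x \<partial>M) \<le> (\<integral>\<^sup>+x. ennreal (f x) \<partial>M)"
proof -
  have "ennreal (\<integral>x. f x \<partial>M) \<le> ennreal (\<integral>x. max 0 (f x) \<partial>M)"
    using assms by (intro ennreal_leI integral_mono) auto
  also have "\<dots> = (\<integral>\<^sup>+x. ennreal (max 0 (f x)) \<partial>M)"
    using assms by (intro nn_integral_eq_integral[symmetric]) auto
  also have "\<dots> = (\<integral>\<^sup>+x. ennreal (f x) \<partial>M)"
    by (intro nn_integral_cong) (auto simp: max_def ennreal_neg)
  finally show ?thesis .
qed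

text \<open>A Gram kernel close to \<open>K\<close> has nonnegative double integral and lies below
  the logarithmic kernel up to \<open>\<delta> + \<epsilon>\<close>. The diagonal imposes no
  condition, since the kernel is infinite there.\<close>

lemma log_energy_ge_if_pos_kernel:
  assumes "prob_space \<mu>" and sets: "sets \<mu> = sets borel" and E: "compact E" "emeasure \<mu> E = 1"
    and K: "pos_kernel E K"
    and le: "\<And>z w. z \<in> E \<Longrightarrow> w \<in> E \<Longrightarrow> z \<noteq> w \<Longrightarrow> K z w \<le> - ln (dist z w) + \<delta>"
  shows "ereal (- \<delta>) \<le> log_energy \<mu>"
proof -
  interpret prob_space \<mu> by fact
  have EB: "E \<in> sets borel" using E(1) by (auto intro: borel_closed compact_imp_closed)
  have AE: "AE z in \<mu>. z \<in> E"
    using E EB AE_in_set_eq_1[of E] by (simp add: measure_def sets)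
  define C where "C = max (ln (diameter E + 1)) (\<bar>\<delta>\<bar> + 1)"
  have C: "C \<ge> 0" "\<delta> < C" by (auto simp: C_def)
  have lnC: "ln (dist z w) \<le> C" if "z \<in> E" "w \<in> E" "z \<noteq> w" for z w
  proof -
    have "dist z w \<le> diameter E + 1"
      using diameter_bounded_bound[OF compact_imp_bounded[OF E(1)] that(1,2)] by simp
    then have "ln (dist z w) \<le> ln (diameter E + 1)" using that by (intro ln_mono) auto
    then show ?thesis by (simp add: C_def)
  qed
  define G where "G = (\<integral>\<^sup>+z. \<integral>\<^sup>+w. shifted_log_kernel C z w \<partial>\<mu> \<partial>\<mu>)"
  have "ennreal (C - \<delta> - \<epsilon>) \<le> G" if "\<epsilon> > 0" for \<epsilon>
  proof -
    obtain H where H: "gram_kernel H" "\<And>z w. z \<in> E \<Longrightarrow> w \<in> E \<Longrightarrow> \<bar>K z w - H z w\<bar> \<le> \<epsilon>"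
      using pos_kernelE[OF K \<open>\<epsilon> > 0\<close>] by blast
    note int = gram_kernel_integral[OF H(1) \<open>prob_space \<mu>\<close> sets]
    let ?h = "\<lambda>z w. C - \<delta> - \<epsilon> + H z w"
    have "ennreal (C - \<delta> - \<epsilon>) \<le> ennreal (C - \<delta> - \<epsilon> + (\<integral>z. \<integral>w. H z w \<partial>\<mu> \<partial>\<mu>))"
      using int by (intro ennreal_leI) auto
    also have "C - \<delta> - \<epsilon> + (\<integral>z. \<integral>w. H z w \<partial>\<mu> \<partial>\<mu>) = (\<integral>z. C - \<delta> - \<epsilon> + (\<integral>w. H z w \<partial>\<mu>) \<partial>\<mu>)"
      using int by (subst Bochner_Integration.integral_add) (auto simp: prob_space)
    also have "ennreal \<dots> \<le> (\<integral>\<^sup>+z. ennreal (C - \<delta> - \<epsilon> + (\<integral>w. H z w \<partial>\<mu>)) \<partial>\<mu>)"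
      using int by (intro ennreal_integral_le_nn_integral) auto
    also have "\<dots> = (\<integral>\<^sup>+z. ennreal (\<integral>w. ?h z w \<partial>\<mu>) \<partial>\<mu>)"
      using int by (intro nn_integral_cong arg_cong[where f = ennreal])
        (subst Bochner_Integration.integral_add, auto simp: prob_space)
    also have "\<dots> \<le> (\<integral>\<^sup>+z. \<integral>\<^sup>+w. ennreal (?h z w) \<partial>\<mu> \<partial>\<mu>)"
      using int by (intro nn_integral_mono ennreal_integral_le_nn_integral) auto
    also have "\<dots> \<le> G"
      unfolding G_def
    proof (rule nn_integral2_mono_AE[OF AE])
      show "ennreal (?h z w) \<le> shifted_log_kernel C z w" if "z \<in> E" "w \<in> E" for z w
        using H(2)[OF that] le[OF that] by (auto simp: shifted_log_kernel_def intro!: ennreal_leI)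
    qed
    finally show ?thesis .
  qed
  then have "ereal (C - \<delta> - \<epsilon>) \<le> enn2ereal G" if "0 < \<epsilon>" "\<epsilon> < C - \<delta>" for \<epsilon>
    using that by (metis diff_gt_0_iff_gt enn2ereal_ennreal less_eq_ennreal.rep_eq less_imp_le)
  have "ereal (C - \<delta>) \<le> enn2ereal G"
  proof (cases G rule: ennreal_cases)
    case (real g)
    have "C - \<delta> \<le> g"
    proof (rule field_le_epsilon)
      fix \<epsilon> :: real assume "\<epsilon> > 0"
      then have "ennreal (C - \<delta> - \<epsilon>) \<le> ennreal g" using \<open>\<And>\<epsilon>. \<epsilon> > 0 \<Longrightarrow> _ \<le> G\<close> real by metis
      then show "C - \<delta> \<le> g + \<epsilon>" using real by (auto simp: ennreal_le_iff2)
    qed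
    then show ?thesis using real by simp
  qed simp
  then have "ereal (C - \<delta>) - ereal C \<le> enn2ereal G - ereal C" by (intro ereal_minus_mono) auto
  moreover have "log_energy \<mu> = enn2ereal G - ereal C"
    unfolding G_def by (rule log_energy_eq_shifted[OF \<open>prob_space \<mu>\<close> sets EB E(2) C(1) lnC])
  ultimately show ?thesis by simp
qed

text \<open>
  On \<open>E\<close>, up to a small regularisation, \<open>- ln \<bar>z - w\<bar>\<close> is the mean of \<open>- ln \<bar>P z - P w\<bar>\<close> and
  \<open>ln (\<bar>z + w\<bar> / \<bar>z - w\<bar>)\<close> (with \<open>z\<close>, \<open>w\<close> centred at \<open>- a / 2\<close>), and both are positive definite.
\<close>

lemma robin_constant_quadratic_preimage_nonneg:
  "0 \<le> robin_constant (quadratic_preimage a c)"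
  unfolding robin_constant_def
proof (rule INF_greatest)
  fix \<mu> :: "complex measure" assume "\<mu> \<in> {\<mu>. prob_space \<mu> \<and> sets \<mu> = sets borel \<and> emeasure \<mu> (quadratic_preimage a c) = 1}"
  then have \<mu>: "prob_space \<mu>" "sets \<mu> = sets borel" "emeasure \<mu> (quadratic_preimage a c) = 1" by auto
  define E where "E = quadratic_preimage a c"
  have E: "compact E" unfolding E_def by (rule compact_quadratic_preimage)
  define v where "v z = z + a / 2" for z
  have cv: "continuous_on E v" unfolding v_def by (intro continuous_intros)
  define \<theta> where "\<theta> z = arccos (Re ((v z)\<^sup>2 + c) / 2)" for z
  have seg: "(v z)\<^sup>2 + c = of_real (2 * cos (\<theta> z))" "\<bar>Re ((v z)\<^sup>2 + c) / 2\<bar> \<le> 1" if z: "z \<in> E" for z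
  proof -
    obtain x where x: "(v z)\<^sup>2 + c = of_real x" "-2 \<le> x" "x \<le> 2"
      using z by (auto simp: E_def quadratic_preimage_def v_def)
    then show "(v z)\<^sup>2 + c = of_real (2 * cos (\<theta> z))" "\<bar>Re ((v z)\<^sup>2 + c) / 2\<bar> \<le> 1"
      unfolding \<theta>_def x(1) by (simp_all add: cos_arccos)
  qed
  have c\<theta>: "continuous_on E \<theta>"
    unfolding \<theta>_def
  proof (intro continuous_intros cv ballI conjI)
    fix z assume "z \<in> E"
    from seg(2)[OF this] show "- 1 \<le> Re ((v z)\<^sup>2 + c) / 2" "Re ((v z)\<^sup>2 + c) / 2 \<le> 1" by linarith+
  qed simp_all
  obtain D where D: "\<And>z. z \<in> E \<Longrightarrow> cmod (v z) \<le> D"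
    using compact_imp_bounded[OF compact_continuous_image[OF cv E]] by (auto simp: bounded_iff)
  have "ereal (- \<delta>) \<le> log_energy \<mu>" if \<delta>: "\<delta> > 0" for \<delta>
  proof -
    \<comment> \<open>The logarithm of the segment kernel enters \<open>K\<close> with factor 1/2,
      so a multiplicative error \<open>\<tau>\<close> costs \<open>\<delta>\<close>.\<close>
    define \<tau> where "\<tau> = exp (2 * \<delta>)"
    have \<tau>: "\<tau> > 1" using \<delta> by (simp add: \<tau>_def)
    have "((\<lambda>r. (2 / (1 + r))\<^sup>2) \<longlongrightarrow> (2 / (1 + 1))\<^sup>2) (at_left (1::real))"
      by (intro tendsto_intros) auto
    then have "\<forall>\<^sub>F r in at_left 1. (2 / (1 + r))\<^sup>2 < \<tau>"
      using \<tau> by (intro order_tendstoD(2)) auto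
    moreover have "\<forall>\<^sub>F r in at_left (1::real). 0 < r \<and> r < 1"
      using eventually_at_left_real[of 0 "1::real"] by auto
    ultimately have "\<forall>\<^sub>F r in at_left 1. (2 / (1 + r))\<^sup>2 < \<tau> \<and> 0 < r \<and> r < 1"
      by eventually_elim auto
    then obtain r where r: "(2 / (1 + r))\<^sup>2 < \<tau>" "0 < r" "r < 1"
      using eventually_happens'[OF trivial_limit_at_left_real] by blast
    \<comment> \<open>Chosen so that \<open>h d \<le> (\<tau> - (2/(1 + r))^2) q\<close> for all
      pairs, because \<open>d \<le> 2 |D| + 1\<close> and \<open>q \<ge> (1 - r)^2\<close>: the gap
      below \<open>\<tau>\<close> absorbs the regularisation.\<close>
    define h where "h = (\<tau> - (2 / (1 + r))\<^sup>2) * (1 - r)\<^sup>2 / (2 * \<bar>D\<bar> + 1)"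
    have h: "h > 0" using r by (simp add: h_def)
    \<comment> \<open>The second term has 1/4 rather than 1/2 because it uses squared
      moduli.\<close>
    define K where "K z w = 1 / 2 * (- ln (log_circle_kernel r (\<theta> z) (\<theta> w)))
        + 1 / 4 * ln (((cmod (v z + v w))\<^sup>2 + h\<^sup>2) / ((cmod (v z - v w))\<^sup>2 + h\<^sup>2))" for z w
    have "pos_kernel E K"
      unfolding K_def using r h
      by (intro pos_kernel_add pos_kernel_cmult E pos_kernel_log_circle pos_kernel_log_reflection c\<theta> cv) auto
    moreover have "K z w \<le> - ln (dist z w) + \<delta>" if zw: "z \<in> E" "w \<in> E" "z \<noteq> w" for z w
    proof -
      define q where "q = log_circle_kernel r (\<theta> z) (\<theta> w)"
      define A where "A = cmod (v z + v w)"
      define d where "d = cmod (v z - v w)"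
      have d: "d > 0" "dist z w = d" using zw by (simp_all add: d_def v_def dist_norm)
      have q: "q > 0" "(1 - r)\<^sup>2 \<le> q" using log_circle_kernel_pos[of r] r by (simp_all add: q_def)
      have A: "A \<ge> 0" by (simp add: A_def)
      have "A * d = cmod ((v z)\<^sup>2 + c - ((v w)\<^sup>2 + c))"
        unfolding A_def d_def by (simp add: power2_eq_square algebra_simps flip: norm_mult)
      also have "\<dots> = \<bar>2 * cos (\<theta> z) - 2 * cos (\<theta> w)\<bar>"
        unfolding seg(1)[OF zw(1)] seg(1)[OF zw(2)] by (simp only: norm_of_real flip: of_real_diff)
      also have "\<dots> \<le> (2 / (1 + r))\<^sup>2 * q"
        unfolding q_def using r by (intro log_circle_kernel_le) auto
      finally have Ad: "A * d \<le> (2 / (1 + r))\<^sup>2 * q" .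
      have "d \<le> 2 * \<bar>D\<bar> + 1"
        using norm_triangle_ineq4[of "v z" "v w"] D[OF zw(1)] D[OF zw(2)] by (simp add: d_def)
      then have "h * d \<le> h * (2 * \<bar>D\<bar> + 1)" using h by (intro mult_left_mono) auto
      also have "\<dots> = (\<tau> - (2 / (1 + r))\<^sup>2) * (1 - r)\<^sup>2" by (simp add: h_def)
      also have "\<dots> \<le> (\<tau> - (2 / (1 + r))\<^sup>2) * q" using q r by (intro mult_left_mono) auto
      finally have "(A + h) * d \<le> \<tau> * q" using Ad by (simp add: algebra_simps)
      moreover have "sqrt (A\<^sup>2 + h\<^sup>2) \<le> A + h" using A h by (intro real_le_lsqrt) (auto simp: power2_sum)
      then have "sqrt (A\<^sup>2 + h\<^sup>2) * d \<le> (A + h) * d" using d by (intro mult_right_mono) auto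
      ultimately have "sqrt (A\<^sup>2 + h\<^sup>2) * d \<le> \<tau> * q" by linarith
      moreover have "sqrt (A\<^sup>2 + h\<^sup>2) > 0" using h by (simp add: add_nonneg_pos)
      ultimately have "ln (sqrt (A\<^sup>2 + h\<^sup>2) * d) \<le> ln (\<tau> * q)"
        using d by (intro ln_mono) auto
      then have 1: "ln (A\<^sup>2 + h\<^sup>2) / 2 + ln d \<le> 2 * \<delta> + ln q"
        using d q h \<tau> \<open>sqrt (A\<^sup>2 + h\<^sup>2) > 0\<close> by (simp add: ln_mult_pos ln_sqrt add_nonneg_pos) (simp add: \<tau>_def)
      have "ln (d\<^sup>2) \<le> ln (d\<^sup>2 + h\<^sup>2)" using d by (intro ln_mono) auto
      then have 2: "2 * ln d \<le> ln (d\<^sup>2 + h\<^sup>2)" using d by (simp add: ln_realpow)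
      have "ln ((A\<^sup>2 + h\<^sup>2) / (d\<^sup>2 + h\<^sup>2)) = ln (A\<^sup>2 + h\<^sup>2) - ln (d\<^sup>2 + h\<^sup>2)"
        using h by (simp add: ln_div sum_power2_eq_zero_iff)
      then have "K z w = - ln q / 2 + (ln (A\<^sup>2 + h\<^sup>2) - ln (d\<^sup>2 + h\<^sup>2)) / 4"
        by (simp add: K_def flip: q_def A_def d_def)
      moreover have "k \<le> - y + \<delta>" if "k = - p / 2 + (x - u) / 4" "x / 2 + y \<le> 2 * \<delta> + p" "2 * y \<le> u"
        for k p x y u :: real
        using that by (simp add: field_simps)
      ultimately show ?thesis using 1 2 unfolding d(2) by blast
    qed
    ultimately show ?thesis
      using log_energy_ge_if_pos_kernel[OF \<mu>(1,2) E _, of K \<delta>] \<mu>(3) by (simp add: E_def)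
  qed
  note ge = this
  show "0 \<le> log_energy \<mu>"
  proof (cases "log_energy \<mu>")
    case (real x)
    have "0 \<le> x"
    proof (rule field_le_epsilon)
      fix \<delta> :: real assume "\<delta> > 0"
      from ge[OF this] show "0 \<le> x + \<delta>" by (simp add: real)
    qed
    then show ?thesis by (simp add: real)
  next
    case MInf
    with ge[of 1] show ?thesis by simp
  qed simp
qed

section \<open>The equilibrium measure\<close>

text \<open>Under this law \<open>2 cos (2 pi s)\<close> is arcsine distributed for \<open>s\<close>
  of either sign, which leaves the sign of \<open>s\<close> free to select one of the two preimages
  under \<open>P\<close>.\<close>

definition unif :: "real measure" where
  "unif = density lborel (\<lambda>s. ennreal (indicator {-1..1} s / 2))"

lemma sets_unif [measurable_cong]: "sets unif = sets borel"
  by (simp add: unif_def)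

lemma nn_integral_unif:
  assumes [measurable]: "f \<in> borel_measurable borel"
  shows "(\<integral>\<^sup>+s. f s \<partial>unif) = (\<integral>\<^sup>+s. ennreal (indicator {-1..1} s / 2) * f s \<partial>lborel)"
  unfolding unif_def by (rule nn_integral_density) measurable

lemma prob_space_unif: "prob_space unif"
proof
  have "emeasure unif (space unif) = (\<integral>\<^sup>+s. 1 \<partial>unif)" by simp
  also have "\<dots> = (\<integral>\<^sup>+s. ennreal (1 / 2) * indicator {-1..1::real} s \<partial>lborel)"
    by (subst nn_integral_unif) (auto intro!: nn_integral_cong simp: indicator_def)
  also have "\<dots> = ennreal (1 / 2) * ennreal 2" by (subst nn_integral_cmult_indicator) auto
  also have "\<dots> = 1" by (subst ennreal_mult[symmetric]) auto
  finally show "emeasure unif (space unif) = 1" .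
qed

lemma nn_integral_unif_uminus:
  assumes [measurable]: "f \<in> borel_measurable borel"
  shows "(\<integral>\<^sup>+s. f (- s) \<partial>unif) = (\<integral>\<^sup>+s. f s \<partial>unif)"
proof -
  have "(\<integral>\<^sup>+s. f s \<partial>unif) = (\<integral>\<^sup>+s. ennreal (indicator {-1..1} (- s) / 2) * f (- s) \<partial>lborel)"
    using nn_integral_real_affine[of "\<lambda>s. ennreal (indicator {-1..1} s / 2) * f s" "-1" 0]
    by (simp add: nn_integral_unif)
  also have "\<dots> = (\<integral>\<^sup>+s. f (- s) \<partial>unif)"
    by (subst nn_integral_unif) (auto intro!: nn_integral_cong simp: indicator_def)
  finally show ?thesis by simp
qed

lemma integral_unif_cos:
  fixes k :: nat
  assumes "k > 0"
  shows "(\<integral>s. cos (k * (2 * pi * s)) \<partial>unif) = 0"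
proof -
  define F where "F s = sin (k * (2 * pi * s)) / (k * (2 * pi))" for s :: real
  have "(\<integral>s. cos (k * (2 * pi * s)) \<partial>unif) = (\<integral>s. (indicator {-1..1} s / 2) *\<^sub>R cos (k * (2 * pi * s)) \<partial>lborel)"
    unfolding unif_def by (intro integral_density) (auto simp: indicator_def)
  also have "\<dots> = (\<integral>s. 1 / 2 * (cos (k * (2 * pi * s)) * indicator {-1..1} s) \<partial>lborel)"
    by (intro Bochner_Integration.integral_cong) auto
  also have "\<dots> = 1 / 2 * (\<integral>s. cos (k * (2 * pi * s)) * indicator {-1..1} s \<partial>lborel)" by simp
  also have "(\<integral>s. cos (k * (2 * pi * s)) * indicator {-1..1} s \<partial>lborel) = F 1 - F (-1)"
    by (rule integral_FTC_Icc_real)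
      (use assms in \<open>auto simp: F_def intro!: derivative_eq_intros continuous_intros\<close>)
  also have "\<dots> = 0"
  proof -
    have "k * (2 * pi * 1) = real (2 * k) * pi" "k * (2 * pi * (- 1)) = - (real (2 * k) * pi)" by simp_all
    then show ?thesis unfolding F_def by (simp only: sin_npi sin_minus)
  qed
  finally show ?thesis by simp
qed

text \<open>The series has no constant term and every cosine has mean zero; the geometric majorant
  allows termwise integration.\<close>

lemma integral_unif_ln_log_circle_kernel:
  assumes r: "0 \<le> r" "r < 1"
  shows "integrable unif (\<lambda>s. ln (log_circle_kernel r \<theta> (2 * pi * s)))"
    and "(\<integral>s. ln (log_circle_kernel r \<theta> (2 * pi * s)) \<partial>unif) = 0"
proof -
  interpret prob_space unif by (rule prob_space_unif)
  define f where "f k s = 2 * r ^ k / k * (cos (k * \<theta>) * cos (k * (2 * pi * s)))" for k :: nat and s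
  have sums: "(\<lambda>k. f k s) sums (- ln (log_circle_kernel r \<theta> (2 * pi * s)))" for s
    unfolding f_def by (rule sums_log_circle_kernel[OF r])
  have bound: "\<bar>f k s\<bar> \<le> 2 * r ^ k" for k s
  proof -
    have "\<bar>cos (k * \<theta>)\<bar> * \<bar>cos (k * (2 * pi * s))\<bar> \<le> 1 * 1" by (intro mult_mono) auto
    moreover have "2 * r ^ k / k \<le> 2 * r ^ k" using r by (cases k) (auto simp: field_simps mult_left_le)
    ultimately have "(2 * r ^ k / k) * (\<bar>cos (k * \<theta>)\<bar> * \<bar>cos (k * (2 * pi * s))\<bar>) \<le> 2 * r ^ k * 1"
      using r by (intro mult_mono) auto
    then show ?thesis using r by (simp add: f_def abs_mult)
  qed
  have meas: "f k \<in> borel_measurable unif" for k unfolding f_def by measurable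
  have int: "integrable unif (f k)" for k
    using bound meas by (intro integrable_const_bound[of _ "2 * r ^ k"]) auto
  have geo: "summable (\<lambda>k. 2 * r ^ k)" using r by (intro summable_mult summable_geometric) auto
  have 1: "summable (\<lambda>k. norm (f k s))" for s
    by (rule summable_comparison_test'[OF geo, of 0]) (simp add: bound)
  have 2: "summable (\<lambda>k. \<integral>s. norm (f k s) \<partial>unif)"
  proof (rule summable_comparison_test'[OF geo, of 0])
    fix k
    have "(\<integral>s. norm (f k s) \<partial>unif) \<le> (\<integral>s. 2 * r ^ k \<partial>unif)"
      using bound int by (intro integral_mono) auto
    then show "norm (\<integral>s. norm (f k s) \<partial>unif) \<le> 2 * r ^ k" by (simp add: prob_space)
  qed
  have suminf: "(\<Sum>k. f k s) = - ln (log_circle_kernel r \<theta> (2 * pi * s))" for s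
    using sums_unique[OF sums[of s]] by simp
  have "integrable unif (\<lambda>s. \<Sum>k. f k s)"
    by (rule integrable_suminf) (use int 1 2 in auto)
  then show "integrable unif (\<lambda>s. ln (log_circle_kernel r \<theta> (2 * pi * s)))" by (simp add: suminf)
  have "(\<integral>s. (\<Sum>k. f k s) \<partial>unif) = (\<Sum>k. \<integral>s. f k s \<partial>unif)"
    by (rule integral_suminf) (use int 1 2 in auto)
  also have "(\<lambda>k. \<integral>s. f k s \<partial>unif) = (\<lambda>_. 0)"
  proof
    fix k
    show "(\<integral>s. f k s \<partial>unif) = 0"
      using integral_unif_cos[of k] by (cases "k = 0") (simp_all add: f_def)
  qed
  finally show "(\<integral>s. ln (log_circle_kernel r \<theta> (2 * pi * s)) \<partial>unif) = 0" by (simp add: suminf)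
qed

text \<open>This is an equality, but Fatou's lemma gives only the inequality that is needed.\<close>

lemma nn_integral_unif_log_le:
  assumes C: "C \<ge> ln 2"
  shows "(\<integral>\<^sup>+s. (if cos \<theta> = cos (2 * pi * s) then \<infinity>
      else ennreal (2 * C - ln \<bar>2 * cos \<theta> - 2 * cos (2 * pi * s)\<bar>)) \<partial>unif) \<le> ennreal (2 * C)"
proof -
  interpret prob_space unif by (rule prob_space_unif)
  define r :: "nat \<Rightarrow> real" where "r n = 1 - inverse (real (Suc n))" for n
  have r: "0 \<le> r n" "r n < 1" for n by (simp_all add: r_def field_simps)
  have r1: "r \<longlonglongrightarrow> 1"
    unfolding r_def using tendsto_diff[OF tendsto_const LIMSEQ_inverse_real_of_nat] by simp
  define q where "q n s = log_circle_kernel (r n) \<theta> (2 * pi * s)" for n s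
  define H where "H s = (if cos \<theta> = cos (2 * pi * s) then \<infinity>
      else ennreal (2 * C - ln \<bar>2 * cos \<theta> - 2 * cos (2 * pi * s)\<bar>))" for s
  have lim: "(\<lambda>n. ennreal (2 * C - ln (q n s))) \<longlonglongrightarrow> H s" for s
  proof -
    have q: "(\<lambda>n. q n s) \<longlonglongrightarrow> \<bar>2 * cos \<theta> - 2 * cos (2 * pi * s)\<bar>"
      unfolding cos_diff_eq_norm q_def log_circle_kernel_def
      by (intro tendsto_intros r1)
    show ?thesis
    proof (cases "cos \<theta> = cos (2 * pi * s)")
      case True
      have "filterlim (\<lambda>n. q n s) (at_right 0) sequentially"
        using q log_circle_kernel_pos(2)[OF r] True
        by (intro tendsto_imp_filterlim_at_right) (auto simp: q_def)
      then have "filterlim (\<lambda>n. ln (q n s)) at_bot sequentially"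
        by (rule filterlim_compose[OF ln_at_0])
      then have "filterlim (\<lambda>n. 2 * C + - ln (q n s)) at_top sequentially"
        by (intro filterlim_tendsto_add_at_top[OF tendsto_const])
          (simp add: filterlim_uminus_at_top)
      then show ?thesis using True by (simp add: H_def ennreal_tendsto_top_eq_at_top infinity_ennreal_def)
    next
      case False
      then show ?thesis using q by (auto simp: H_def intro!: tendsto_intros tendsto_ennrealI)
    qed
  qed
  have int: "integrable unif (\<lambda>s. ln (q n s))" "(\<integral>s. ln (q n s) \<partial>unif) = 0" for n
    unfolding q_def by (rule integral_unif_ln_log_circle_kernel[OF r])+
  have val: "(\<integral>\<^sup>+s. ennreal (2 * C - ln (q n s)) \<partial>unif) = ennreal (2 * C)" for n
  proof -
    \<comment> \<open>Makes the integrand nonnegative: \<open>q\<close> is at most 4, and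
      \<open>C \<ge> ln 2\<close>.\<close>
    have "ln (q n s) \<le> 2 * C" for s
    proof -
      have "ln (q n s) \<le> ln 4" using log_circle_kernel_pos[OF r] by (simp add: q_def)
      also have "ln 4 = 2 * ln (2::real)" using ln_realpow[of 2 2] by simp
      finally show ?thesis using C by simp
    qed
    then have "(\<integral>\<^sup>+s. ennreal (2 * C - ln (q n s)) \<partial>unif) = ennreal (\<integral>s. 2 * C - ln (q n s) \<partial>unif)"
      using int by (intro nn_integral_eq_integral) auto
    also have "(\<integral>s. 2 * C - ln (q n s) \<partial>unif) = 2 * C"
      using int by (subst Bochner_Integration.integral_diff) (auto simp: prob_space)
    finally show ?thesis .
  qed
  have "(\<integral>\<^sup>+s. H s \<partial>unif) = (\<integral>\<^sup>+s. liminf (\<lambda>n. ennreal (2 * C - ln (q n s))) \<partial>unif)"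
    using lim_imp_Liminf[OF sequentially_bot lim] by simp
  also have "\<dots> \<le> liminf (\<lambda>n. \<integral>\<^sup>+s. ennreal (2 * C - ln (q n s)) \<partial>unif)"
  proof (intro nn_integral_liminf)
    have [measurable]: "q n \<in> borel_measurable borel" for n
      unfolding q_def log_circle_kernel_def by (intro borel_measurable_continuous_onI continuous_intros)
    show "(\<lambda>s. ennreal (2 * C - ln (q n s))) \<in> borel_measurable unif" for n by measurable
  qed
  also have "\<dots> = ennreal (2 * C)" by (simp add: val Liminf_const)
  finally show ?thesis by (simp add: H_def)
qed

text \<open>For nonzero \<open>s\<close>, the values at \<open>s\<close> and \<open>- s\<close> are
  the two preimages of the same point of the segment (equal if that point is
  \<open>c\<close>).\<close>

definition segment_lift :: "complex \<Rightarrow> complex \<Rightarrow> real \<Rightarrow> complex" where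
  "segment_lift a c s = (if s < 0 then -1 else 1) * csqrt (of_real (2 * cos (2 * pi * s)) - c) - a / 2"

text \<open>The principal root jumps across the negative axis, so measurability is read off from its
  real and imaginary parts.\<close>

lemma borel_measurable_csqrt [measurable]: "csqrt \<in> borel_measurable borel"
proof -
  have "(\<lambda>z. Complex (sqrt ((cmod z + Re z) / 2)) ((if Im z = 0 then 1 else sgn (Im z)) * sqrt ((cmod z - Re z) / 2)))
      \<in> borel_measurable borel"
    unfolding borel_measurable_complex_iff by simp
  then show ?thesis by (simp add: csqrt.code[abs_def] case_prod_beta')
qed

lemma segment_lift_power2: "(segment_lift a c s + a / 2)\<^sup>2 + c = of_real (2 * cos (2 * pi * s))"
  by (simp add: segment_lift_def)

text \<open>The test measure is the image of \<open>unif\<close> under the lift. Pairing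
  \<open>s\<close> with \<open>- s\<close> turns the two distances from \<open>\<gamma> t\<close>
  into their product, the distance of the images on the segment, where the potential of the arcsine
  measure is known.\<close>

lemma robin_constant_quadratic_preimage_nonpos:
  "robin_constant (quadratic_preimage a c) \<le> 0"
proof -
  define E where "E = quadratic_preimage a c"
  define \<gamma> where "\<gamma> = segment_lift a c"
  have E: "compact E" unfolding E_def by (rule compact_quadratic_preimage)
  then have EB: "E \<in> sets borel" by (auto intro: borel_closed compact_imp_closed)
  have \<gamma>E: "\<gamma> s \<in> E" for s
    unfolding E_def quadratic_preimage_def \<gamma>_def mem_Collect_eq segment_lift_power2
    by (intro imageI) (simp add: abs_le_iff)
  have [measurable]: "\<gamma> \<in> borel_measurable borel" unfolding \<gamma>_def segment_lift_def by measurable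
  interpret unif: prob_space unif by (rule prob_space_unif)
  define \<omega> where "\<omega> = distr unif borel \<gamma>"
  have \<omega>: "prob_space \<omega>" "sets \<omega> = sets borel"
    unfolding \<omega>_def by (auto intro!: unif.prob_space_distr)
  have \<omega>E: "emeasure \<omega> E = 1"
    using EB \<gamma>E unif.emeasure_space_1 by (simp add: \<omega>_def emeasure_distr vimage_def)
  define C where "C = max (ln (diameter E + 1)) (ln 2)"
  have "C \<ge> ln 2" by (simp add: C_def)
  moreover have "ln (2 :: real) \<ge> 0" by simp
  ultimately have C: "C \<ge> 0" "C \<ge> ln 2" by linarith+
  have lnC: "ln (dist z w) \<le> C" if "z \<in> E" "w \<in> E" "z \<noteq> w" for z w
  proof -
    have "dist z w \<le> diameter E + 1"
      using diameter_bounded_bound[OF compact_imp_bounded[OF E] that(1,2)] by simp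
    then have "ln (dist z w) \<le> ln (diameter E + 1)" using that by (intro ln_mono) auto
    then show ?thesis by (simp add: C_def)
  qed
  define G where "G = shifted_log_kernel C"
  have [measurable]: "case_prod G \<in> borel_measurable (borel \<Otimes>\<^sub>M borel)" unfolding G_def by measurable
  have inner: "(\<integral>\<^sup>+s. G (\<gamma> t) (\<gamma> s) \<partial>unif) \<le> ennreal C" for t
  proof -
    define g where "g s = G (\<gamma> t) (\<gamma> s)" for s
    have [measurable]: "g \<in> borel_measurable borel" unfolding g_def by measurable
    have "2 * (\<integral>\<^sup>+s. g s \<partial>unif) = (\<integral>\<^sup>+s. g s \<partial>unif) + (\<integral>\<^sup>+s. g (- s) \<partial>unif)"
      by (simp add: nn_integral_unif_uminus mult_2)
    also have "\<dots> = (\<integral>\<^sup>+s. g s + g (- s) \<partial>unif)" by (rule nn_integral_add[symmetric]) measurable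
    also have "\<dots> \<le> (\<integral>\<^sup>+s. (if cos (2 * pi * t) = cos (2 * pi * s) then \<infinity>
      else ennreal (2 * C - ln \<bar>2 * cos (2 * pi * t) - 2 * cos (2 * pi * s)\<bar>)) \<partial>unif)"
    proof (rule nn_integral_mono_AE)
      \<comment> \<open>At \<open>s = 0\<close> both signs select the same branch, so the pairing
        fails on this null set.\<close>
      have "AE s in lborel. s \<noteq> (0 :: real)" by (rule AE_lborel_singleton)
      then have "AE s in unif. s \<noteq> 0" unfolding unif_def by (subst AE_density) auto
      then show "AE s in unif. g s + g (- s) \<le> (if cos (2 * pi * t) = cos (2 * pi * s) then \<infinity>
        else ennreal (2 * C - ln \<bar>2 * cos (2 * pi * t) - 2 * cos (2 * pi * s)\<bar>))"
      proof (rule eventually_mono)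
        fix s :: real assume "s \<noteq> 0"
        define w v where "w = \<gamma> t + a / 2" and "v = \<gamma> s + a / 2"
        have v': "\<gamma> (- s) + a / 2 = - v"
          using \<open>s \<noteq> 0\<close> by (auto simp: v_def \<gamma>_def segment_lift_def)
        have wv: "w\<^sup>2 - v\<^sup>2 = of_real (2 * cos (2 * pi * t) - 2 * cos (2 * pi * s))"
          using segment_lift_power2[of a c t] segment_lift_power2[of a c s]
          by (simp add: w_def v_def \<gamma>_def) (metis add_diff_cancel_right)
        show "g s + g (- s) \<le> (if cos (2 * pi * t) = cos (2 * pi * s) then \<infinity>
          else ennreal (2 * C - ln \<bar>2 * cos (2 * pi * t) - 2 * cos (2 * pi * s)\<bar>))"
        proof (cases "cos (2 * pi * t) = cos (2 * pi * s)")
          case False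
          then have "w\<^sup>2 - v\<^sup>2 \<noteq> 0" unfolding wv of_real_eq_0_iff by simp
          then have ne: "w - v \<noteq> 0" "w + v \<noteq> 0" by (auto simp: power2_eq_square square_diff_square_factored)
          then have "\<gamma> t \<noteq> \<gamma> s" by (auto simp: w_def v_def)
          have "\<gamma> t \<noteq> \<gamma> (- s)"
          proof
            assume "\<gamma> t = \<gamma> (- s)"
            then have "w = - v" using v' by (simp add: w_def)
            then show False using ne by simp
          qed
          have d: "dist (\<gamma> t) (\<gamma> s) = cmod (w - v)" "dist (\<gamma> t) (\<gamma> (- s)) = cmod (w + v)"
          proof -
            have "\<gamma> t - \<gamma> s = w - v" "\<gamma> t - \<gamma> (- s) = w - (\<gamma> (- s) + a / 2)"
              by (simp_all add: w_def v_def)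
            then show "dist (\<gamma> t) (\<gamma> s) = cmod (w - v)" "dist (\<gamma> t) (\<gamma> (- s)) = cmod (w + v)"
              unfolding v' by (simp_all add: dist_norm)
          qed
          have "\<bar>2 * cos (2 * pi * t) - 2 * cos (2 * pi * s)\<bar> = cmod (w\<^sup>2 - v\<^sup>2)"
            unfolding wv norm_of_real ..
          also have "\<dots> = cmod (w - v) * cmod (w + v)"
            by (simp add: power2_eq_square square_diff_square_factored mult.commute flip: norm_mult)
          finally have "ln \<bar>2 * cos (2 * pi * t) - 2 * cos (2 * pi * s)\<bar> = ln (cmod (w - v)) + ln (cmod (w + v))"
            using ne by (simp add: ln_mult_pos)
          moreover have "ln (cmod (w - v)) \<le> C" "ln (cmod (w + v)) \<le> C"
            using lnC[OF \<gamma>E \<gamma>E \<open>\<gamma> t \<noteq> \<gamma> s\<close>] lnC[OF \<gamma>E \<gamma>E \<open>\<gamma> t \<noteq> \<gamma> (- s)\<close>] by (simp_all add: d)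
          ultimately show ?thesis
            using False \<open>\<gamma> t \<noteq> \<gamma> s\<close> \<open>\<gamma> t \<noteq> \<gamma> (- s)\<close>
            by (simp add: g_def G_def shifted_log_kernel_def d flip: ennreal_plus)
        qed simp
      qed
    qed
    also have "\<dots> \<le> ennreal (2 * C)" by (rule nn_integral_unif_log_le[OF C(2)])
    also have "\<dots> = 2 * ennreal C" using C by (simp add: ennreal_mult)
    finally show ?thesis unfolding g_def by (subst (asm) ennreal_mult_le_mult_iff) auto
  qed
  interpret \<omega>: prob_space \<omega> by (rule \<omega>)
  have [measurable_cong]: "sets \<omega> = sets borel" by (rule \<omega>)
  have "(\<lambda>z. \<integral>\<^sup>+w. G z w \<partial>\<omega>) \<in> borel_measurable borel"
    by (rule \<omega>.borel_measurable_nn_integral) measurable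
  then have "(\<integral>\<^sup>+z. \<integral>\<^sup>+w. G z w \<partial>\<omega> \<partial>distr unif borel \<gamma>) = (\<integral>\<^sup>+t. \<integral>\<^sup>+w. G (\<gamma> t) w \<partial>\<omega> \<partial>unif)"
    by (intro nn_integral_distr) measurable
  then have "(\<integral>\<^sup>+z. \<integral>\<^sup>+w. G z w \<partial>\<omega> \<partial>\<omega>) = (\<integral>\<^sup>+t. \<integral>\<^sup>+w. G (\<gamma> t) w \<partial>\<omega> \<partial>unif)"
    by (simp flip: \<omega>_def)
  also have "\<dots> = (\<integral>\<^sup>+t. \<integral>\<^sup>+s. G (\<gamma> t) (\<gamma> s) \<partial>unif \<partial>unif)"
    unfolding \<omega>_def by (intro nn_integral_cong nn_integral_distr) measurable
  also have "\<dots> \<le> (\<integral>\<^sup>+t. ennreal C \<partial>unif)" by (intro nn_integral_mono inner)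
  also have "\<dots> = ennreal C" by (simp add: unif.emeasure_space_1)
  finally have "enn2ereal (\<integral>\<^sup>+z. \<integral>\<^sup>+w. G z w \<partial>\<omega> \<partial>\<omega>) \<le> ereal C"
    using C by (metis enn2ereal_ennreal less_eq_ennreal.rep_eq)
  then have "enn2ereal (\<integral>\<^sup>+z. \<integral>\<^sup>+w. G z w \<partial>\<omega> \<partial>\<omega>) - ereal C \<le> ereal C - ereal C"
    by (rule ereal_minus_mono) simp
  moreover have "log_energy \<omega> = enn2ereal (\<integral>\<^sup>+z. \<integral>\<^sup>+w. G z w \<partial>\<omega> \<partial>\<omega>) - ereal C"
    unfolding G_def by (rule log_energy_eq_shifted[OF \<omega> EB \<omega>E C(1) lnC])
  ultimately have "log_energy \<omega> \<le> 0" by simp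
  then show ?thesis
    unfolding robin_constant_def using \<omega> \<omega>E by (intro INF_lower2[of \<omega>]) (auto simp: E_def)
qed

lemma log_capacity_quadratic_preimage: "log_capacity (quadratic_preimage a c) = 1"
proof -
  have "robin_constant (quadratic_preimage a c) = 0"
    by (intro antisym robin_constant_quadratic_preimage_nonneg robin_constant_quadratic_preimage_nonpos)
  then show ?thesis by (simp add: log_capacity_def)
qed

section \<open>Widom factors\<close>

theorem theorem3:
  fixes a b c :: complex and P :: "complex poly" and E :: "complex set"
  assumes "P = [:b, a, 1:]"
    and "E = {z. poly P z \<in> complex_of_real ` {-2..2}}"
    and "c = b - a\<^sup>2 / 4"
  shows "(\<forall>n\<ge>1. widom_factor (2 * n) E = 2)
    \<and> (\<lambda>n. widom_factor (2 * n + 1) E) \<longlonglongrightarrow> sqrt (2 * cmod (c + sqrt_branch c))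
    \<and> (c \<in> complex_of_real ` {-2..2} \<longrightarrow> (\<lambda>n. widom_factor (2 * n + 1) E) \<longlonglongrightarrow> 2)"
proof -
  have "poly P z = (z + a / 2)\<^sup>2 + c" for z
    by (simp add: assms power2_eq_square field_simps)
  then have E: "E = quadratic_preimage a c" by (simp add: assms(2) quadratic_preimage_def)
  have W: "widom_factor n E = sup_norm (quadratic_preimage a c) (chebyshev_poly (quadratic_preimage a c) n)" for n
    by (simp add: widom_factor_def E log_capacity_quadratic_preimage)
  have lim: "(\<lambda>n. widom_factor (2 * n + 1) E) \<longlonglongrightarrow> sqrt (2 * cmod (c + sqrt_branch c))"
    unfolding W by (rule odd_chebyshev_tendsto)
  moreover have "sqrt (2 * cmod (c + sqrt_branch c)) = 2" if "c \<in> real_segment"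
    using norm_eq_2_if_real_segment[OF sqrt_branch_power2 that] by simp
  moreover have "widom_factor (2 * n) E = 2" if "n \<ge> 1" for n
    unfolding W using that by (intro norm_even_chebyshev_quadratic_preimage) simp
  ultimately show ?thesis by auto
qed

end
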